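(* There exist Scott-continuous maps $\pi^S_k: N(k)\to S(k)$, $k\in\mathbb{N}$, each total (mapping $\bar N(k)$ into $\bar S(k)$), such that for every $k\in\mathbb{N}$, every $x\in\bar N(k+1)$ and every $y\in\bar N(k)$ we have $\rho^N_0(x(y))=\rho^S_0(\pi^S_{k+1}(x)(\pi^S_k(y)))$.
   Context: All domains are bounded-complete $\omega$-algebraic with the Scott topology; $D\to D'$ is the domain of Scott-continuous maps. $N(0)=\mathbb{N}_\bot$, $N(k+1)=N(k)\to N(0)$; $n\approx^N_0 m$ iff $n=m\in\mathbb{N}$; $f\approx^N_{k+1}g$ iff $f(a)\approx^N_0 g(b)$ whenever $a\approx^N_k b$; $\bar N(k)=\{x:x\approx^N_kx\}$; $\rho^N_0(n)=n$. $S(0)$ consists of the empty sequence and all finite and infinite sequences $ab_1b_2\dots$ with $a\in\mathbb{Z}$, $b_i\in\{-1,0,1\}$, ordered by extension; for maximal elements $\rho^S_0(ab_1b_2\cdots)=a+\sum_{n\ge1}b_n2^{-n}$; $x_1\sim_0x_2$ iff they have maximal extensions with equal $\rho^S_0$-value; $S(k+1)$ is the set of Scott-continuous $f:S(k)\to S(0)$ with $x_1\sim_kx_2\Rightarrow f(x_1)\sim_0f(x_2)$, ordered pointwise (an algebraic domain); $f_1\sim_{k+1}f_2$ iff $x_1\sim_kx_2\Rightarrow f_1(x_1)\sim_0f_2(x_2)$. $\bar S(0)$ = maximal elements, $\approx^S_0$ = $\sim_0$ restricted to them; $f\approx^S_{k+1}g$ iff $f(x)\approx^S_0 g(y)$ whenever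 $x\approx^S_k y$; $\bar S(k)=\{x\in S(k):x\approx^S_kx\}$. The natural number $\rho^N_0(x(y))$ is regarded as a real. *)

theory Defs
  imports "HOL-Analysis.Analysis"
begin

section \<open>Ordered sets, the Scott topology and Scott-continuous maps\<close>

record 'a ordset =
  elems :: "'a set"
  below :: "'a \<Rightarrow> 'a \<Rightarrow> bool"

definition directed_in :: "'a ordset \<Rightarrow> 'a set \<Rightarrow> bool" where
  "directed_in D X \<longleftrightarrow> X \<subseteq> elems D \<and> X \<noteq> {} \<and>
     (\<forall>x\<in>X. \<forall>y\<in>X. \<exists>z\<in>X. below D x z \<and> below D y z)"

definition is_lub_in :: "'a ordset \<Rightarrow> 'a set \<Rightarrow> 'a \<Rightarrow> bool" where
  "is_lub_in D X s \<longleftrightarrow> s \<in> elems D \<and> (\<forall>x\<in>X. below D x s) \<and>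
     (\<forall>u\<in>elems D. (\<forall>x\<in>X. below D x u) \<longrightarrow> below D s u)"

definition scott_open :: "'a ordset \<Rightarrow> 'a set \<Rightarrow> bool" where
  "scott_open D U \<longleftrightarrow> U \<subseteq> elems D \<and>
     (\<forall>x\<in>U. \<forall>y\<in>elems D. below D x y \<longrightarrow> y \<in> U) \<and>
     (\<forall>X s. directed_in D X \<longrightarrow> is_lub_in D X s \<longrightarrow> s \<in> U \<longrightarrow> X \<inter> U \<noteq> {})"

definition scott_topology :: "'a ordset \<Rightarrow> 'a topology" where
  "scott_topology D = topology (scott_open D)"

definition maximal_in :: "'a ordset \<Rightarrow> 'a \<Rightarrow> bool" where
  "maximal_in D x \<longleftrightarrow> x \<in> elems D \<and> (\<forall>y\<in>elems D. below D x y \<longrightarrow> y = x)"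

definition scott_maps :: "'a ordset \<Rightarrow> 'b ordset \<Rightarrow> ('a \<Rightarrow> 'b) set" where
  "scott_maps D E =
     {f \<in> extensional (elems D). continuous_map (scott_topology D) (scott_topology E) f}"


section \<open>A common type for all levels of a hierarchy\<close>

text \<open>
  The domains at the levels \<open>0, 1, 2, \<dots>\<close> of a hierarchy have to live in one HOL type.
  An object is either an element of the ground domain or a code for a function from
  objects to objects.  The codes are sets of natural numbers.  Since all domains involved are
  countably based, the sets of functions that are encoded have at most the cardinality
  of the continuum, so that an injective coding exists; the choice is immaterial.
  The theorems \<open>bij_betw_N_app\<close> and \<open>bij_betw_S_app\<close> below state that decoding is, at every
  level, a bijection onto the intended set of functions.
\<close>

datatype 'b obj = Ground 'b | Code "nat set"

definition encode :: "('b obj \<Rightarrow> 'b obj) set \<Rightarrow> ('b obj \<Rightarrow> 'b obj) \<Rightarrow> 'b obj" where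
  "encode F f = Code ((SOME c. inj_on c F) f)"

definition decode :: "('b obj \<Rightarrow> 'b obj) set \<Rightarrow> 'b obj \<Rightarrow> ('b obj \<Rightarrow> 'b obj)" where
  "decode F = inv_into F (encode F)"

definition fun_ordset ::
    "'b obj ordset \<Rightarrow> 'b obj ordset \<Rightarrow> ('b obj \<Rightarrow> 'b obj) set \<Rightarrow> 'b obj ordset" where
  "fun_ordset D E F =
     \<lparr>elems = encode F ` F,
      below = (\<lambda>u v. \<forall>x\<in>elems D. below E (decode F u x) (decode F v x))\<rparr>"


section \<open>The hierarchy over the natural numbers\<close>

definition N_ground :: "nat option obj ordset" where
  "N_ground =
     \<lparr>elems = range Ground,
      below = (\<lambda>x y. x = Ground None \<or> x = y)\<rparr>"

primrec N_dom :: "nat \<Rightarrow> nat option obj ordset" where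
  "N_dom 0 = N_ground"
| "N_dom (Suc k) = fun_ordset (N_dom k) N_ground (scott_maps (N_dom k) N_ground)"

definition N_app :: "nat \<Rightarrow> nat option obj \<Rightarrow> nat option obj \<Rightarrow> nat option obj" where
  "N_app k = decode (scott_maps (N_dom k) N_ground)"

definition N_eq0 :: "nat option obj \<Rightarrow> nat option obj \<Rightarrow> bool" where
  "N_eq0 x y \<longleftrightarrow> (\<exists>n. x = Ground (Some n) \<and> y = Ground (Some n))"

primrec N_eq :: "nat \<Rightarrow> nat option obj \<Rightarrow> nat option obj \<Rightarrow> bool" where
  "N_eq 0 = N_eq0"
| "N_eq (Suc k) = (\<lambda>f g. f \<in> elems (N_dom (Suc k)) \<and> g \<in> elems (N_dom (Suc k)) \<and>
     (\<forall>a\<in>elems (N_dom k). \<forall>b\<in>elems (N_dom k).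
        N_eq k a b \<longrightarrow> N_eq0 (N_app k f a) (N_app k g b)))"

definition N_total :: "nat \<Rightarrow> nat option obj set" where
  "N_total k = {x \<in> elems (N_dom k). N_eq k x x}"

definition rho_N :: "nat option obj \<Rightarrow> nat" where
  "rho_N x = (THE n. x = Ground (Some n))"


section \<open>The hierarchy over the signed digit sequences\<close>

text \<open>
  A finite or infinite sequence is a partial function on the natural numbers whose
  domain is an initial segment; the integer part is at position \<open>0\<close>.
\<close>

definition digit_seqs :: "(nat \<rightharpoonup> int) set" where
  "digit_seqs = {s. (\<forall>n. s n = None \<longrightarrow> s (Suc n) = None) \<and>
                    (\<forall>n b. s (Suc n) = Some b \<longrightarrow> b \<in> {-1, 0, 1})}"

definition S_ground :: "(nat \<rightharpoonup> int) obj ordset" where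
  "S_ground =
     \<lparr>elems = Ground ` digit_seqs,
      below = (\<lambda>x y. \<exists>s t. x = Ground s \<and> y = Ground t \<and> s \<subseteq>\<^sub>m t)\<rparr>"

definition seq_val :: "(nat \<rightharpoonup> int) \<Rightarrow> real" where
  "seq_val s = of_int (the (s 0)) + (\<Sum>n. of_int (the (s (Suc n))) / 2 ^ Suc n)"

definition rho_S :: "(nat \<rightharpoonup> int) obj \<Rightarrow> real" where
  "rho_S x = seq_val (THE s. x = Ground s)"

definition S_sim0 :: "(nat \<rightharpoonup> int) obj \<Rightarrow> (nat \<rightharpoonup> int) obj \<Rightarrow> bool" where
  "S_sim0 x1 x2 \<longleftrightarrow> x1 \<in> elems S_ground \<and> x2 \<in> elems S_ground \<and>
     (\<exists>m1 m2. maximal_in S_ground m1 \<and> maximal_in S_ground m2 \<and>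
        below S_ground x1 m1 \<and> below S_ground x2 m2 \<and> rho_S m1 = rho_S m2)"

definition sim_maps ::
    "(nat \<rightharpoonup> int) obj ordset \<Rightarrow> ((nat \<rightharpoonup> int) obj \<Rightarrow> (nat \<rightharpoonup> int) obj \<Rightarrow> bool) \<Rightarrow>
     ((nat \<rightharpoonup> int) obj \<Rightarrow> (nat \<rightharpoonup> int) obj) set" where
  "sim_maps D R = {f \<in> scott_maps D S_ground.
     \<forall>x1\<in>elems D. \<forall>x2\<in>elems D. R x1 x2 \<longrightarrow> S_sim0 (f x1) (f x2)}"

text \<open>
  The domain and the relation \<open>\<sim>\<close> at each level, by simultaneous recursion;
  see \<open>S_dom_Suc\<close> and \<open>S_sim_Suc\<close> for the resulting equations.
\<close>

primrec S_level :: "nat \<Rightarrow>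
    (nat \<rightharpoonup> int) obj ordset \<times> ((nat \<rightharpoonup> int) obj \<Rightarrow> (nat \<rightharpoonup> int) obj \<Rightarrow> bool)" where
  "S_level 0 = (S_ground, S_sim0)"
| "S_level (Suc k) =
     (let D = fst (S_level k); R = snd (S_level k); F = sim_maps D R; D' = fun_ordset D S_ground F
      in (D', \<lambda>f1 f2. f1 \<in> elems D' \<and> f2 \<in> elems D' \<and>
                (\<forall>x1\<in>elems D. \<forall>x2\<in>elems D.
                   R x1 x2 \<longrightarrow> S_sim0 (decode F f1 x1) (decode F f2 x2))))"

definition S_dom :: "nat \<Rightarrow> (nat \<rightharpoonup> int) obj ordset" where
  "S_dom k = fst (S_level k)"

definition S_sim :: "nat \<Rightarrow> (nat \<rightharpoonup> int) obj \<Rightarrow> (nat \<rightharpoonup> int) obj \<Rightarrow> bool" where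
  "S_sim k = snd (S_level k)"

definition S_app :: "nat \<Rightarrow> (nat \<rightharpoonup> int) obj \<Rightarrow> (nat \<rightharpoonup> int) obj \<Rightarrow> (nat \<rightharpoonup> int) obj" where
  "S_app k = decode (sim_maps (S_dom k) (S_sim k))"

lemma S_dom_0: "S_dom 0 = S_ground"
  and S_sim_0: "S_sim 0 = S_sim0"
  and S_dom_Suc: "S_dom (Suc k) = fun_ordset (S_dom k) S_ground (sim_maps (S_dom k) (S_sim k))"
  and S_sim_Suc: "S_sim (Suc k) f1 f2 \<longleftrightarrow>
        f1 \<in> elems (S_dom (Suc k)) \<and> f2 \<in> elems (S_dom (Suc k)) \<and>
        (\<forall>x1\<in>elems (S_dom k). \<forall>x2\<in>elems (S_dom k).
           S_sim k x1 x2 \<longrightarrow> S_sim0 (S_app k f1 x1) (S_app k f2 x2))"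
  by (simp_all add: S_dom_def S_sim_def S_app_def Let_def)

definition S_eq0 :: "(nat \<rightharpoonup> int) obj \<Rightarrow> (nat \<rightharpoonup> int) obj \<Rightarrow> bool" where
  "S_eq0 x y \<longleftrightarrow> maximal_in S_ground x \<and> maximal_in S_ground y \<and> S_sim0 x y"

primrec S_eq :: "nat \<Rightarrow> (nat \<rightharpoonup> int) obj \<Rightarrow> (nat \<rightharpoonup> int) obj \<Rightarrow> bool" where
  "S_eq 0 = S_eq0"
| "S_eq (Suc k) = (\<lambda>f g. f \<in> elems (S_dom (Suc k)) \<and> g \<in> elems (S_dom (Suc k)) \<and>
     (\<forall>x\<in>elems (S_dom k). \<forall>y\<in>elems (S_dom k).
        S_eq k x y \<longrightarrow> S_eq0 (S_app k f x) (S_app k g y)))"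

definition S_total :: "nat \<Rightarrow> (nat \<rightharpoonup> int) obj set" where
  "S_total k = {x \<in> elems (S_dom k). S_eq k x x}"


section \<open>Adequacy of the coding\<close>

lemma istopology_scott_open: "istopology (scott_open D)"
  unfolding istopology_def
proof (intro conjI allI impI)
  fix U V assume U: "scott_open D U" and V: "scott_open D V"
  show "scott_open D (U \<inter> V)"
    unfolding scott_open_def
  proof (intro conjI allI impI)
    show "U \<inter> V \<subseteq> elems D" using U by (auto simp: scott_open_def)
    show "\<forall>x\<in>U \<inter> V. \<forall>y\<in>elems D. below D x y \<longrightarrow> y \<in> U \<inter> V"
      using U V unfolding scott_open_def by blast
    fix X s assume X: "directed_in D X" "is_lub_in D X s" "s \<in> U \<inter> V"
    have "X \<inter> U \<noteq> {}" "X \<inter> V \<noteq> {}" using X U V unfolding scott_open_def by simp_all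
    then obtain x y where x: "x \<in> X" "x \<in> U" and y: "y \<in> X" "y \<in> V" by blast
    obtain z where z: "z \<in> X" "below D x z" "below D y z"
      using X(1) x y unfolding directed_in_def by blast
    have "z \<in> elems D" using X(1) z unfolding directed_in_def by blast
    then have "z \<in> U \<inter> V" using U V x y z unfolding scott_open_def by blast
    then show "X \<inter> (U \<inter> V) \<noteq> {}" using z by blast
  qed
next
  fix K assume K: "\<forall>U\<in>K. scott_open D U"
  show "scott_open D (\<Union>K)"
    unfolding scott_open_def
  proof (intro conjI allI impI)
    show "\<Union>K \<subseteq> elems D" using K by (auto simp: scott_open_def)
    show "\<forall>x\<in>\<Union>K. \<forall>y\<in>elems D. below D x y \<longrightarrow> y \<in> \<Union>K"
      using K unfolding scott_open_def by blast
    fix X s assume X: "directed_in D X" "is_lub_in D X s" "s \<in> \<Union>K"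
    then obtain U where U: "U \<in> K" "s \<in> U" by blast
    then have "X \<inter> U \<noteq> {}" using K X unfolding scott_open_def by blast
    then show "X \<inter> \<Union>K \<noteq> {}" using U by blast
  qed
qed

lemma openin_scott_topology: "openin (scott_topology D) U \<longleftrightarrow> scott_open D U"
  unfolding scott_topology_def using istopology_scott_open topology_inverse' by metis

lemma topspace_scott_topology: "topspace (scott_topology D) = elems D"
proof -
  have "scott_open D (elems D)" by (auto simp: scott_open_def directed_in_def)
  then show ?thesis unfolding topspace_def openin_scott_topology
    by (auto simp: scott_open_def)
qed

definition porder_on :: "'a ordset \<Rightarrow> bool" where
  "porder_on D \<longleftrightarrow> (\<forall>x\<in>elems D. below D x x) \<and>
     (\<forall>x\<in>elems D. \<forall>y\<in>elems D. \<forall>z\<in>elems D. below D x y \<longrightarrow> below D y z \<longrightarrow> below D x z) \<and>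
     (\<forall>x\<in>elems D. \<forall>y\<in>elems D. below D x y \<longrightarrow> below D y x \<longrightarrow> x = y)"

lemma porder_refl: "porder_on D \<Longrightarrow> x \<in> elems D \<Longrightarrow> below D x x"
  and porder_trans: "porder_on D \<Longrightarrow> below D x y \<Longrightarrow> below D y z \<Longrightarrow> x \<in> elems D \<Longrightarrow> y \<in> elems D
        \<Longrightarrow> z \<in> elems D \<Longrightarrow> below D x z"
  and porder_antisym: "porder_on D \<Longrightarrow> below D x y \<Longrightarrow> below D y x \<Longrightarrow> x \<in> elems D \<Longrightarrow> y \<in> elems D
        \<Longrightarrow> x = y"
  unfolding porder_on_def by blast+

lemma lub_unique:
  assumes "porder_on D" "is_lub_in D X s" "is_lub_in D X t"
  shows "s = t"
  using assms unfolding is_lub_in_def by (meson porder_antisym)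

lemma scott_open_not_below:
  assumes "porder_on D" "u \<in> elems D"
  shows "scott_open D {e \<in> elems D. \<not> below D e u}"
  unfolding scott_open_def
proof (intro conjI allI impI ballI)
  fix x y assume "x \<in> {e \<in> elems D. \<not> below D e u}" "y \<in> elems D" "below D x y"
  then show "y \<in> {e \<in> elems D. \<not> below D e u}" using assms porder_trans[of D x y u] by blast
next
  fix X s assume "directed_in D X" "is_lub_in D X s" "s \<in> {e \<in> elems D. \<not> below D e u}"
  then show "X \<inter> {e \<in> elems D. \<not> below D e u} \<noteq> {}"
    using assms unfolding is_lub_in_def directed_in_def by blast
qed auto

lemma lub_pair:
  assumes "porder_on D" "x \<in> elems D" "y \<in> elems D" "below D x y"
  shows "directed_in D {x, y}" "is_lub_in D {x, y} y"
  using assms by (auto simp: directed_in_def is_lub_in_def porder_refl)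

lemma lub_image_mono:
  assumes "porder_on D" "porder_on E"
    and L: "\<And>X s. directed_in D X \<Longrightarrow> is_lub_in D X s \<Longrightarrow> is_lub_in E (f ` X) (f s)"
    and "x \<in> elems D" "y \<in> elems D" "below D x y"
  shows "below E (f x) (f y)"
  using L[OF lub_pair[OF assms(1,4-6)]] by (auto simp: is_lub_in_def)

lemma directed_image:
  assumes "directed_in D X" "f ` elems D \<subseteq> elems E"
    and "\<And>x y. x \<in> elems D \<Longrightarrow> y \<in> elems D \<Longrightarrow> below D x y \<Longrightarrow> below E (f x) (f y)"
  shows "directed_in E (f ` X)"
  unfolding directed_in_def
proof (intro conjI ballI)
  show "f ` X \<subseteq> elems E" "f ` X \<noteq> {}" using assms(1,2) unfolding directed_in_def by blast+
  fix u v assume "u \<in> f ` X" "v \<in> f ` X"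
  then obtain x y where xy: "x \<in> X" "y \<in> X" "u = f x" "v = f y" by blast
  then obtain z where "z \<in> X" "below D x z" "below D y z"
    using assms(1) unfolding directed_in_def by blast
  then show "\<exists>w\<in>f ` X. below E u w \<and> below E v w"
    using xy assms(1,3) unfolding directed_in_def by blast
qed

lemma continuous_map_scott_iff:
  assumes D: "porder_on D" and E: "porder_on E"
  shows "continuous_map (scott_topology D) (scott_topology E) f \<longleftrightarrow>
    f ` elems D \<subseteq> elems E \<and>
    (\<forall>X s. directed_in D X \<longrightarrow> is_lub_in D X s \<longrightarrow> is_lub_in E (f ` X) (f s))"
    (is "?L \<longleftrightarrow> ?R")
proof
  assume ?L
  then have img: "f ` elems D \<subseteq> elems E"
    and op: "\<And>V. scott_open E V \<Longrightarrow> scott_open D {x \<in> elems D. f x \<in> V}"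
    unfolding continuous_map_def topspace_scott_topology openin_scott_topology by auto
  have mono: "below E (f x) (f y)" if "x \<in> elems D" "y \<in> elems D" "below D x y" for x y
  proof (rule ccontr)
    assume n: "\<not> ?thesis"
    have "scott_open D {z \<in> elems D. f z \<in> {e \<in> elems E. \<not> below E e (f y)}}"
      using op[OF scott_open_not_below[OF E]] img that by blast
    moreover have "x \<in> {z \<in> elems D. f z \<in> {e \<in> elems E. \<not> below E e (f y)}}"
      using n that(1) img by blast
    ultimately have "y \<in> {z \<in> elems D. f z \<in> {e \<in> elems E. \<not> below E e (f y)}}"
      using that(2,3) unfolding scott_open_def by blast
    then have "\<not> below E (f y) (f y)" by blast
    then show False using img that porder_refl[OF E] by blast
  qed
  show ?R
  proof (intro conjI allI impI)
    show "f ` elems D \<subseteq> elems E" by fact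
    fix X s assume X: "directed_in D X" "is_lub_in D X s"
    show "is_lub_in E (f ` X) (f s)"
      unfolding is_lub_in_def
    proof (intro conjI ballI impI)
      show "f s \<in> elems E" using X img by (auto simp: is_lub_in_def)
      show "below E y (f s)" if "y \<in> f ` X" for y
        using that X mono unfolding is_lub_in_def directed_in_def by blast
      fix u assume u: "u \<in> elems E" "\<forall>x\<in>f ` X. below E x u"
      show "below E (f s) u"
      proof (rule ccontr)
        assume n: "\<not> ?thesis"
        have "scott_open D {z \<in> elems D. f z \<in> {e \<in> elems E. \<not> below E e u}}"
          using op[OF scott_open_not_below[OF E u(1)]] .
        moreover have "s \<in> {z \<in> elems D. f z \<in> {e \<in> elems E. \<not> below E e u}}"
          using n X img by (auto simp: is_lub_in_def)
        ultimately have "X \<inter> {z \<in> elems D. f z \<in> {e \<in> elems E. \<not> below E e u}} \<noteq> {}"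
          using X unfolding scott_open_def by blast
        then show False using u by blast
      qed
    qed
  qed
next
  assume R: ?R
  then have mono: "below E (f x) (f y)" if "x \<in> elems D" "y \<in> elems D" "below D x y" for x y
    using lub_image_mono[OF D E] that by blast
  show ?L
    unfolding continuous_map_def topspace_scott_topology openin_scott_topology
  proof (intro conjI allI impI)
    show "f \<in> elems D \<rightarrow> elems E" using R by auto
    fix V assume V: "scott_open E V"
    show "scott_open D {x \<in> elems D. f x \<in> V}"
      unfolding scott_open_def
    proof (intro conjI allI impI ballI)
      show "{x \<in> elems D. f x \<in> V} \<subseteq> elems D" by auto
      show "y \<in> {x \<in> elems D. f x \<in> V}"
        if "x \<in> {x \<in> elems D. f x \<in> V}" "y \<in> elems D" "below D x y" for x y
        using that mono[of x y] V R unfolding scott_open_def by blast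
      fix X s assume X: "directed_in D X" "is_lub_in D X s" "s \<in> {x \<in> elems D. f x \<in> V}"
      have "f ` X \<inter> V \<noteq> {}"
        using R V X directed_image[of D X f E] mono unfolding scott_open_def by blast
      then show "X \<inter> {x \<in> elems D. f x \<in> V} \<noteq> {}"
        using X unfolding directed_in_def by blast
    qed
  qed
qed

definition compact_in :: "'a ordset \<Rightarrow> 'a \<Rightarrow> bool" where
  "compact_in D c \<longleftrightarrow> c \<in> elems D \<and>
     (\<forall>X s. directed_in D X \<longrightarrow> is_lub_in D X s \<longrightarrow> below D c s \<longrightarrow> (\<exists>x\<in>X. below D c x))"

definition omega_basis :: "'a ordset \<Rightarrow> 'a set \<Rightarrow> bool" where
  "omega_basis D B \<longleftrightarrow> countable B \<and> (\<forall>b\<in>B. compact_in D b) \<and>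
     (\<forall>x\<in>elems D. directed_in D {b\<in>B. below D b x} \<and> is_lub_in D {b\<in>B. below D b x} x)"

definition omega_algebraic :: "'a ordset \<Rightarrow> bool" where
  "omega_algebraic D \<longleftrightarrow> porder_on D \<and> (\<forall>X. directed_in D X \<longrightarrow> (\<exists>s. is_lub_in D X s)) \<and>
     (\<exists>B. omega_basis D B)"

lemma omega_basis_subset: "omega_basis D B \<Longrightarrow> B \<subseteq> elems D"
  unfolding omega_basis_def compact_in_def by blast

lemma directed_finite_ub:
  assumes "directed_in D X" "porder_on D" "finite Y" "Y \<subseteq> X"
  shows "\<exists>z\<in>X. \<forall>y\<in>Y. below D y z"
  using assms(3,4)
proof (induction Y rule: finite_induct)
  case empty
  then show ?case using assms(1) unfolding directed_in_def by blast
next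
  case (insert a Y)
  then obtain z where z: "z \<in> X" "\<forall>y\<in>Y. below D y z" by blast
  obtain w where w: "w \<in> X" "below D a w" "below D z w"
    using assms(1) insert.prems z unfolding directed_in_def by blast
  have "X \<subseteq> elems D" using assms(1) unfolding directed_in_def by blast
  then have "\<forall>y\<in>insert a Y. below D y w"
    using w z insert.prems porder_trans[OF assms(2)] by blast
  then show ?case using w by blast
qed

lemma ordset_iso_image:
  assumes bij: "bij_betw h (elems G) (elems H)"
    and iso: "\<And>x y. x \<in> elems G \<Longrightarrow> y \<in> elems G \<Longrightarrow> below H (h x) (h y) \<longleftrightarrow> below G x y"
    and X: "X \<subseteq> elems G"
  shows "directed_in H (h ` X) \<longleftrightarrow> directed_in G X"
    and "s \<in> elems G \<Longrightarrow> is_lub_in H (h ` X) (h s) \<longleftrightarrow> is_lub_in G X s"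
proof -
  have img: "h ` elems G = elems H" using bij by (simp add: bij_betw_def)
  have "(\<forall>x\<in>X. \<forall>y\<in>X. \<exists>z\<in>X. below H (h x) (h z) \<and> below H (h y) (h z)) \<longleftrightarrow>
        (\<forall>x\<in>X. \<forall>y\<in>X. \<exists>z\<in>X. below G x z \<and> below G y z)"
    using iso X by (meson subsetD)
  then show "directed_in H (h ` X) \<longleftrightarrow> directed_in G X"
    using X img unfolding directed_in_def by auto
  assume s: "s \<in> elems G"
  have 1: "(\<forall>u\<in>elems H. (\<forall>x\<in>h ` X. below H x u) \<longrightarrow> below H (h s) u) \<longleftrightarrow>
        (\<forall>u\<in>elems G. (\<forall>x\<in>X. below G x u) \<longrightarrow> below G s u)"
    unfolding img[symmetric] using iso X s by (simp add: subset_iff)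
  have 2: "(\<forall>x\<in>h ` X. below H x (h s)) \<longleftrightarrow> (\<forall>x\<in>X. below G x s)"
    using iso X s by (simp add: subset_iff)
  show "is_lub_in H (h ` X) (h s) \<longleftrightarrow> is_lub_in G X s"
    unfolding is_lub_in_def 1 2 using s img by auto
qed

lemma omega_algebraic_iso:
  assumes bij: "bij_betw h (elems G) (elems H)"
    and iso: "\<And>x y. x \<in> elems G \<Longrightarrow> y \<in> elems G \<Longrightarrow> below H (h x) (h y) \<longleftrightarrow> below G x y"
    and G: "omega_algebraic G"
  shows "omega_algebraic H"
proof -
  have img: "elems H = h ` elems G" using bij by (simp add: bij_betw_def)
  have inj: "inj_on h (elems G)" using bij by (simp add: bij_betw_def)
  have po: "porder_on G" using G by (simp add: omega_algebraic_def)
  obtain B where B: "omega_basis G B" using G by (auto simp: omega_algebraic_def)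
  have BG: "B \<subseteq> elems G" using B by (rule omega_basis_subset)
  have di: "directed_in H (h ` X) \<longleftrightarrow> directed_in G X" if "X \<subseteq> elems G" for X
    by (rule ordset_iso_image(1)[OF bij _ that]) (rule iso)
  have lu: "is_lub_in H (h ` X) (h s) \<longleftrightarrow> is_lub_in G X s" if "X \<subseteq> elems G" "s \<in> elems G" for X s
    by (rule ordset_iso_image(2)[OF bij _ that]) (rule iso)
  have "porder_on H"
    unfolding porder_on_def img
  proof (intro conjI ballI impI; elim imageE)
    fix x' x assume "x' = h x" "x \<in> elems G"
    then show "below H x' x'" using iso porder_refl[OF po] by simp
  next
    fix x' y' z' x y z
    assume "x' = h x" "x \<in> elems G" "y' = h y" "y \<in> elems G" "z' = h z" "z \<in> elems G"
      "below H x' y'" "below H y' z'"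
    then show "below H x' z'" using iso po porder_trans[of G x y z] by simp
  next
    fix x' y' x y
    assume "x' = h x" "x \<in> elems G" "y' = h y" "y \<in> elems G" "below H x' y'" "below H y' x'"
    then show "x' = y'" using iso po porder_antisym[of G x y] by simp
  qed
  moreover have "\<exists>s. is_lub_in H X s" if X: "directed_in H X" for X
  proof -
    obtain Y where Y: "Y \<subseteq> elems G" "X = h ` Y"
      using X unfolding directed_in_def img by (meson subset_imageE)
    then obtain s where s: "is_lub_in G Y s"
      using X di G unfolding omega_algebraic_def by blast
    then have "s \<in> elems G" by (simp add: is_lub_in_def)
    then have "is_lub_in H X (h s)" using lu[OF Y(1)] s Y(2) by simp
    then show ?thesis ..
  qed
  moreover have "omega_basis H (h ` B)"
    unfolding omega_basis_def
  proof (intro conjI ballI)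
    show "countable (h ` B)" using B by (auto simp: omega_basis_def)
    fix c assume "c \<in> h ` B"
    then obtain b where b: "b \<in> B" "c = h b" by blast
    then have bc: "compact_in G b" and bG: "b \<in> elems G" using B BG by (auto simp: omega_basis_def)
    show "compact_in H c"
      unfolding compact_in_def
    proof (intro conjI allI impI)
      show "c \<in> elems H" using b bG img by blast
      fix X t assume X: "directed_in H X" "is_lub_in H X t" "below H c t"
      obtain Y where Y: "Y \<subseteq> elems G" "X = h ` Y"
        using X unfolding directed_in_def img by (meson subset_imageE)
      obtain s where s: "s \<in> elems G" "t = h s" using X(2) unfolding is_lub_in_def img by blast
      have "directed_in G Y" "is_lub_in G Y s" "below G b s"
        using X Y s di lu iso b bG by auto
      then obtain y where y: "y \<in> Y" "below G b y" using bc unfolding compact_in_def by blast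
      then have "h y \<in> X" "below H c (h y)" using Y b bG iso by auto
      then show "\<exists>x\<in>X. below H c x" by blast
    qed
  next
    fix x' assume "x' \<in> elems H"
    then obtain x where x: "x \<in> elems G" "x' = h x" using img by blast
    have eq: "{b \<in> h ` B. below H b x'} = h ` {b \<in> B. below G b x}"
      using iso x BG by (auto simp: subset_iff)
    have sub: "{b \<in> B. below G b x} \<subseteq> elems G" using BG by blast
    have "directed_in G {b \<in> B. below G b x}" "is_lub_in G {b \<in> B. below G b x} x"
      using B x unfolding omega_basis_def by auto
    then show "directed_in H {b \<in> h ` B. below H b x'}" "is_lub_in H {b \<in> h ` B. below H b x'} x'"
      unfolding eq using di[OF sub] lu[OF sub] x by auto
  qed
  ultimately show ?thesis unfolding omega_algebraic_def by blast
qed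

text \<open>Trees: domains with a least element in which bounded pairs are comparable.\<close>

definition tree_like :: "'a ordset \<Rightarrow> bool" where
  "tree_like E \<longleftrightarrow> (\<exists>b\<in>elems E. \<forall>x\<in>elems E. below E b x) \<and>
     (\<forall>x\<in>elems E. \<forall>y\<in>elems E. \<forall>z\<in>elems E. below E x z \<longrightarrow> below E y z \<longrightarrow> below E x y \<or> below E y x)"

definition raw_fun_ordset ::
    "'a ordset \<Rightarrow> 'b ordset \<Rightarrow> ('a \<Rightarrow> 'b) set \<Rightarrow> ('a \<Rightarrow> 'b) ordset" where
  "raw_fun_ordset D E F = \<lparr>elems = F, below = (\<lambda>f g. \<forall>x\<in>elems D. below E (f x) (g x))\<rparr>"

lemma raw_fun_simps [simp]:
  "elems (raw_fun_ordset D E F) = F"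
  "below (raw_fun_ordset D E F) f g \<longleftrightarrow> (\<forall>x\<in>elems D. below E (f x) (g x))"
  by (simp_all add: raw_fun_ordset_def)

lemma scott_maps_iff:
  assumes "porder_on D" "porder_on E"
  shows "f \<in> scott_maps D E \<longleftrightarrow> f \<in> extensional (elems D) \<and> f ` elems D \<subseteq> elems E \<and>
    (\<forall>X s. directed_in D X \<longrightarrow> is_lub_in D X s \<longrightarrow> is_lub_in E (f ` X) (f s))"
  unfolding scott_maps_def by (simp add: continuous_map_scott_iff[OF assms])

lemma countable_injection:
  assumes D: "omega_algebraic D" and E: "omega_algebraic E" and F: "F \<subseteq> scott_maps D E"
  shows "\<exists>c :: ('a \<Rightarrow> 'b) \<Rightarrow> nat set. inj_on c F"
proof -
  obtain B C where B: "omega_basis D B" and C: "omega_basis E C"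
    using D E unfolding omega_algebraic_def by blast
  have pD: "porder_on D" and pE: "porder_on E" using D E by (auto simp: omega_algebraic_def)
  note iff = scott_maps_iff[OF pD pE]
  define T where "T f = {p \<in> B \<times> C. below E (snd p) (f (fst p))}" for f
  have cnt: "countable (B \<times> C)" using B C unfolding omega_basis_def by auto
  have "inj_on (\<lambda>f. to_nat_on (B \<times> C) ` T f) F"
  proof (rule inj_onI)
    fix f g assume f: "f \<in> F" and g: "g \<in> F"
      and eq: "to_nat_on (B \<times> C) ` T f = to_nat_on (B \<times> C) ` T g"
    have TT: "T f = T g"
      using eq inj_on_image_eq_iff[OF inj_on_to_nat_on[OF cnt], of "T f" "T g"]
      by (auto simp: T_def)
    have fs: "f \<in> scott_maps D E" "g \<in> scott_maps D E" using f g F by auto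
    have onB: "f b = g b" if b: "b \<in> B" for b
    proof -
      have bD: "b \<in> elems D" using b omega_basis_subset[OF B] by blast
      have "{c \<in> C. below E c (f b)} = {c \<in> C. below E c (g b)}"
      proof -
        have "(b, c) \<in> T f \<longleftrightarrow> (b, c) \<in> T g" for c using TT by simp
        then show ?thesis using b by (auto simp: T_def)
      qed
      moreover have "is_lub_in E {c \<in> C. below E c (f b)} (f b)"
        "is_lub_in E {c \<in> C. below E c (g b)} (g b)"
        using C bD fs unfolding omega_basis_def iff by blast+
      ultimately show ?thesis using lub_unique[OF pE] by metis
    qed
    show "f = g"
    proof
      fix x show "f x = g x"
      proof (cases "x \<in> elems D")
        case True
        let ?X = "{b \<in> B. below D b x}"
        have "directed_in D ?X" "is_lub_in D ?X x" using B True unfolding omega_basis_def by auto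
        then have "is_lub_in E (f ` ?X) (f x)" "is_lub_in E (g ` ?X) (g x)"
          using fs unfolding iff by auto
        moreover have "f ` ?X = g ` ?X" using onB by auto
        ultimately show ?thesis using lub_unique[OF pE] by metis
      next
        case False
        then show ?thesis using fs unfolding iff by (auto simp: extensional_def)
      qed
    qed
  qed
  then show ?thesis by blast
qed

lemma finite_chain_max:
  assumes E: "porder_on E" and t: "tree_like E"
    and "finite A" "A \<noteq> {}" "A \<subseteq> elems E" "z \<in> elems E" "\<forall>a\<in>A. below E a z"
  shows "\<exists>m\<in>A. \<forall>a\<in>A. below E a m"
  using assms(3,4,5,7)
proof (induction A rule: finite_ne_induct)
  case (singleton x)
  then show ?case using porder_refl[OF E] by simp
next
  case (insert x A)
  then obtain m where m: "m \<in> A" "\<forall>a\<in>A. below E a m" by auto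
  have "below E x m \<or> below E m x"
    using t assms(6) insert.prems m unfolding tree_like_def by blast
  then show ?case
  proof
    assume "below E x m" then show ?thesis using m by blast
  next
    assume xm: "below E m x"
    have "\<forall>a\<in>insert x A. below E a x"
      using xm m insert.prems porder_trans[OF E] porder_refl[OF E] by blast
    then show ?thesis by blast
  qed
qed

lemma omega_algebraic_raw_fun:
  assumes D: "omega_algebraic D" and E: "omega_algebraic E" and t: "tree_like E"
    and F: "F \<subseteq> scott_maps D E"
    and down: "\<And>f g. f \<in> F \<Longrightarrow> g \<in> scott_maps D E \<Longrightarrow>
                 (\<And>x. x \<in> elems D \<Longrightarrow> below E (g x) (f x)) \<Longrightarrow> g \<in> F"
    and sup: "\<And>H h. directed_in (raw_fun_ordset D E F) H \<Longrightarrow> h \<in> scott_maps D E \<Longrightarrow>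
                 (\<And>x. x \<in> elems D \<Longrightarrow> is_lub_in E ((\<lambda>f. f x) ` H) (h x)) \<Longrightarrow> h \<in> F"
  shows "omega_algebraic (raw_fun_ordset D E F)"
proof -
  let ?G = "raw_fun_ordset D E F"
  obtain B C where B: "omega_basis D B" and C: "omega_basis E C"
    using D E unfolding omega_algebraic_def by blast
  have pD: "porder_on D" and pE: "porder_on E" using D E by (auto simp: omega_algebraic_def)
  have BD: "B \<subseteq> elems D" and CE: "C \<subseteq> elems E" using B C omega_basis_subset by auto
  note iff = scott_maps_iff[OF pD pE]
  have Fext: "f \<in> extensional (elems D)" if "f \<in> F" for f using that F iff by blast
  have FE: "f x \<in> elems E" if "f \<in> F" "x \<in> elems D" for f x using that F iff by blast
  have Flub: "is_lub_in E (f ` X) (f s)" if "f \<in> F" "directed_in D X" "is_lub_in D X s" for f X s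
    using that F iff by blast
  have Fmono: "below E (f x) (f y)" if "f \<in> F" "x \<in> elems D" "y \<in> elems D" "below D x y" for f x y
    using lub_image_mono[OF pD pE Flub[OF that(1)]] that by blast
  have pG: "porder_on ?G"
    unfolding porder_on_def raw_fun_simps
  proof (intro conjI ballI impI)
    fix f x assume "f \<in> F" "x \<in> elems D" then show "below E (f x) (f x)"
      using FE porder_refl[OF pE] by blast
  next
    fix f g h x assume "f \<in> F" "g \<in> F" "h \<in> F" "\<forall>x\<in>elems D. below E (f x) (g x)"
      "\<forall>x\<in>elems D. below E (g x) (h x)" "x \<in> elems D"
    then show "below E (f x) (h x)" using FE porder_trans[OF pE] by blast
  next
    fix f g assume fg: "f \<in> F" "g \<in> F" "\<forall>x\<in>elems D. below E (f x) (g x)"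
      "\<forall>x\<in>elems D. below E (g x) (f x)"
    have "f x = g x" if "x \<in> elems D" for x
      using that fg FE porder_antisym[OF pE] by blast
    then show "f = g" using extensionalityI[OF Fext[OF fg(1)] Fext[OF fg(2)]] by blast
  qed
  have ptw: "\<exists>h. h \<in> F \<and> (\<forall>x\<in>elems D. is_lub_in E ((\<lambda>f. f x) ` H) (h x)) \<and> is_lub_in ?G H h"
    if H: "directed_in ?G H" for H
  proof -
    have HF: "H \<subseteq> F" using H unfolding directed_in_def by simp
    have dir: "directed_in E ((\<lambda>f. f x) ` H)" if "x \<in> elems D" for x
      by (rule directed_image[OF H]) (use that FE in auto)
    define h where "h = restrict (\<lambda>x. SOME s. is_lub_in E ((\<lambda>f. f x) ` H) s) (elems D)"
    have h: "is_lub_in E ((\<lambda>f. f x) ` H) (h x)" if "x \<in> elems D" for x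
    proof -
      have "\<exists>s. is_lub_in E ((\<lambda>f. f x) ` H) s"
        using dir[OF that] E unfolding omega_algebraic_def by blast
      then show ?thesis unfolding h_def using that by (simp add: someI_ex)
    qed
    have hE: "h x \<in> elems E" if "x \<in> elems D" for x
      using h[OF that] unfolding is_lub_in_def by blast
    have hub: "below E (f x) (h x)" if "f \<in> H" "x \<in> elems D" for f x
      using h[OF that(2)] that unfolding is_lub_in_def by blast
    have hle: "below E (h x) u" if "x \<in> elems D" "u \<in> elems E" "\<And>f. f \<in> H \<Longrightarrow> below E (f x) u" for x u
      using h[OF that(1)] that unfolding is_lub_in_def by blast
    have "h \<in> scott_maps D E"
      unfolding iff
    proof (intro conjI allI impI)
      show "h \<in> extensional (elems D)" unfolding h_def by simp
      show "h ` elems D \<subseteq> elems E" using hE by blast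
      fix X s assume X: "directed_in D X" "is_lub_in D X s"
      have sD: "s \<in> elems D" and XD: "X \<subseteq> elems D" and Xs: "\<And>x. x \<in> X \<Longrightarrow> below D x s"
        using X unfolding is_lub_in_def directed_in_def by auto
      show "is_lub_in E (h ` X) (h s)"
        unfolding is_lub_in_def
      proof (intro conjI ballI impI)
        show "h s \<in> elems E" using hE sD by blast
        fix y assume "y \<in> h ` X"
        then obtain x where x: "x \<in> X" "y = h x" by blast
        have xD: "x \<in> elems D" using x XD by blast
        show "below E y (h s)"
          unfolding x(2)
        proof (rule hle[OF xD hE[OF sD]])
          fix f assume f: "f \<in> H"
          then have "f \<in> F" using HF by blast
          then show "below E (f x) (h s)"
            using porder_trans[OF pE Fmono[of f x s] hub[OF f sD]] FE hE xD sD Xs x by blast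
        qed
      next
        fix u assume u: "u \<in> elems E" "\<forall>y\<in>h ` X. below E y u"
        show "below E (h s) u"
        proof (rule hle[OF sD u(1)])
          fix f assume f: "f \<in> H"
          then have fF: "f \<in> F" using HF by blast
          have "below E (f x) u" if "x \<in> X" for x
          proof -
            have xD: "x \<in> elems D" using that XD by blast
            then show ?thesis
              using porder_trans[OF pE hub[OF f xD], of u] u that FE[OF fF xD] hE[OF xD] by blast
          qed
          then show "below E (f s) u"
            using Flub[OF fF X] u unfolding is_lub_in_def by blast
        qed
      qed
    qed
    then have hF: "h \<in> F" using sup[OF H] h by blast
    have "is_lub_in ?G H h"
      unfolding is_lub_in_def raw_fun_simps using hF hub hle FE by blast
    then show ?thesis using hF h by blast
  qed
  have lubG: "is_lub_in E ((\<lambda>f. f x) ` H) (h x)"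
    if "directed_in ?G H" "is_lub_in ?G H h" "x \<in> elems D" for H h x
    using ptw[OF that(1)] lub_unique[OF pG that(2)] that(3) by blast

  obtain bt where bt: "bt \<in> elems E" "\<And>x. x \<in> elems E \<Longrightarrow> below E bt x"
    using t unfolding tree_like_def by blast
  define A where "A P x = insert bt {e. \<exists>b. (b, e) \<in> P \<and> below D b x}" for P x
  define st where "st P = restrict (\<lambda>x. SOME m. m \<in> A P x \<and> (\<forall>a\<in>A P x. below E a m)) (elems D)"
    for P
  define under where "under P f \<longleftrightarrow> finite P \<and> P \<subseteq> B \<times> C \<and> (\<forall>(b, e)\<in>P. below E e (f b))" for P f
  have Afin: "finite (A P x)" if "finite P" for P x
  proof -
    have "A P x \<subseteq> insert bt (snd ` P)" unfolding A_def by force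
    then show ?thesis using that by (meson finite_imageI finite_insert finite_subset)
  qed
  have AE: "A P x \<subseteq> elems E" if "under P f" for P f x
    using that bt CE unfolding A_def under_def by blast
  have Abd: "below E a (f x)" if P: "under P f" and f: "f \<in> F" and x: "x \<in> elems D" and a: "a \<in> A P x"
    for P f x a
  proof (cases "a = bt")
    case True then show ?thesis using bt FE f x by blast
  next
    case False
    then obtain b where b: "(b, a) \<in> P" "below D b x" using a unfolding A_def by blast
    have bB: "b \<in> B" "a \<in> C" "below E a (f b)" using b P unfolding under_def by auto
    show ?thesis
      using porder_trans[OF pE bB(3) Fmono[OF f _ x b(2)]] bB BD CE FE f x by blast
  qed
  have st: "st P x \<in> A P x \<and> (\<forall>a\<in>A P x. below E a (st P x))"
    if P: "under P f" and f: "f \<in> F" and x: "x \<in> elems D" for P f x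
  proof -
    have "A P x \<noteq> {}" unfolding A_def by blast
    moreover have "finite P" using P unfolding under_def by blast
    ultimately have "\<exists>m\<in>A P x. \<forall>a\<in>A P x. below E a m"
      using finite_chain_max[OF pE t Afin[of P x] _ AE[OF P] FE[OF f x]] Abd[OF P f x] by blast
    then show ?thesis unfolding st_def using x
      by (simp, intro someI_ex[of "\<lambda>m. m \<in> A P x \<and> (\<forall>a\<in>A P x. below E a m)"]) blast
  qed
  have stbelow: "below E (st P x) (f x)" if "under P f" "f \<in> F" "x \<in> elems D" for P f x
    using st[OF that] Abd[OF that] by blast
  have stE: "st P x \<in> elems E" if "under P f" "f \<in> F" "x \<in> elems D" for P f x
    using st[OF that] AE[OF that(1)] by blast
  have Amono: "A P x \<subseteq> A P y" if P: "under P f" and "x \<in> elems D" "y \<in> elems D" "below D x y" for P f x y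
  proof -
    have "b \<in> elems D" if "(b, e) \<in> P" for b e using that P BD unfolding under_def by blast
    then show ?thesis unfolding A_def using that porder_trans[OF pD] by blast
  qed
  have stmono: "below E (st P x) (st P y)"
    if P: "under P f" "f \<in> F" and xy: "x \<in> elems D" "y \<in> elems D" "below D x y" for P f x y
    using st[OF P xy(1)] st[OF P xy(2)] Amono[OF P(1) xy] by blast
  have stF: "st P \<in> F" if P: "under P f" and f: "f \<in> F" for P f
  proof (rule down[OF f])
    show "below E (st P x) (f x)" if "x \<in> elems D" for x using stbelow[OF P f that] .
    show "st P \<in> scott_maps D E"
      unfolding iff
    proof (intro conjI allI impI)
      show "st P \<in> extensional (elems D)" unfolding st_def by simp
      show "st P ` elems D \<subseteq> elems E" using stE[OF P f] by blast
      fix X s assume X: "directed_in D X" "is_lub_in D X s"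
      have sD: "s \<in> elems D" and XD: "X \<subseteq> elems D" and Xs: "\<And>x. x \<in> X \<Longrightarrow> below D x s"
        using X unfolding is_lub_in_def directed_in_def by auto
      define Q where "Q = {b \<in> fst ` P. below D b s}"
      have Qfin: "finite Q" using P unfolding Q_def under_def by simp
      have "\<forall>b\<in>Q. \<exists>x\<in>X. below D b x"
      proof
        fix b assume b: "b \<in> Q"
        then have "b \<in> B" using P unfolding Q_def under_def by auto
        then have "compact_in D b" using B unfolding omega_basis_def by blast
        then show "\<exists>x\<in>X. below D b x" using X b unfolding compact_in_def Q_def by blast
      qed
      then obtain w where w: "\<And>b. b \<in> Q \<Longrightarrow> w b \<in> X \<and> below D b (w b)" by metis
      obtain z where z: "z \<in> X" "\<forall>y\<in>w ` Q. below D y z"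
        using directed_finite_ub[OF X(1) pD, of "w ` Q"] Qfin w by blast
      have zD: "z \<in> elems D" using z XD by blast
      have Qz: "below D b z" if "b \<in> Q" for b
      proof -
        have "b \<in> elems D" using that P BD unfolding Q_def under_def by auto
        then show ?thesis using porder_trans[OF pD, of b "w b" z] w[OF that] z that zD XD by blast
      qed
      have "A P s \<subseteq> A P z"
        unfolding A_def using Qz unfolding Q_def by force
      then have sz: "below E (st P s) (st P z)"
        using st[OF P f sD] st[OF P f zD] by blast
      show "is_lub_in E (st P ` X) (st P s)"
        unfolding is_lub_in_def
      proof (intro conjI ballI impI)
        show "st P s \<in> elems E" using stE[OF P f sD] .
        show "below E y (st P s)" if "y \<in> st P ` X" for y
          using that stmono[OF P f _ sD] XD Xs by blast
        show "below E (st P s) u" if "u \<in> elems E" "\<forall>x\<in>st P ` X. below E x u" for u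
          using porder_trans[OF pE sz, of u] that z stE[OF P f] sD zD by blast
      qed
    qed
  qed
  have stval: "below E e (st P b)" if P: "under P f" and f: "f \<in> F" and be: "(b, e) \<in> P" for P f b e
  proof -
    have "b \<in> elems D" using P be BD unfolding under_def by blast
    moreover from this have "e \<in> A P b" unfolding A_def using be porder_refl[OF pD] by blast
    ultimately show ?thesis using st[OF P f] by blast
  qed
  define K where "K = {st P | P. \<exists>f\<in>F. under P f}"
  have underI: "under P g" if P: "under P f" "f \<in> F" and g: "g \<in> F" "\<forall>x\<in>elems D. below E (st P x) (g x)"
    for P f g
  proof -
    have "below E e (g b)" if be: "(b, e) \<in> P" for b e
    proof -
      have bD: "b \<in> elems D" "e \<in> elems E" using P be BD CE unfolding under_def by blast+
      then show ?thesis
        using porder_trans[OF pE stval[OF P be], of "g b"] g stE[OF P] FE by blast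
    qed
    then show ?thesis using P unfolding under_def by blast
  qed
  have Kbelow: "{k \<in> K. below ?G k f} = st ` {P. under P f}" if f: "f \<in> F" for f
  proof
    show "{k \<in> K. below ?G k f} \<subseteq> st ` {P. under P f}"
      unfolding K_def using underI f by auto
    show "st ` {P. under P f} \<subseteq> {k \<in> K. below ?G k f}"
      unfolding K_def using stbelow f by auto
  qed
  have "omega_basis ?G K"
    unfolding omega_basis_def
  proof (intro conjI ballI)
    have "countable {P. finite P \<and> P \<subseteq> B \<times> C}"
      using B C unfolding omega_basis_def by (intro countable_Collect_finite_subset) auto
    moreover have "K \<subseteq> st ` {P. finite P \<and> P \<subseteq> B \<times> C}" unfolding K_def under_def by blast
    ultimately show "countable K" by (meson countable_image countable_subset)
  next
    fix k assume "k \<in> K"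
    then obtain P f where k: "k = st P" and P: "under P f" "f \<in> F" unfolding K_def by blast
    show "compact_in ?G k"
      unfolding compact_in_def
    proof (intro conjI allI impI)
      show "k \<in> elems ?G" using stF[OF P] k by simp
      fix H h assume H: "directed_in ?G H" "is_lub_in ?G H h" "below ?G k h"
      have hF: "h \<in> F" using H(2) unfolding is_lub_in_def by simp
      have HF: "H \<subseteq> F" using H(1) unfolding directed_in_def by simp
      have uh: "under P h" using underI[OF P hF] H(3) k by simp
      have "\<forall>p\<in>P. \<exists>g\<in>H. below E (snd p) (g (fst p))"
      proof
        fix p assume p: "p \<in> P"
        have "p \<in> B \<times> C" and le: "below E (snd p) (h (fst p))"
          using uh p unfolding under_def by auto
        then have bD: "fst p \<in> elems D" and eC: "snd p \<in> C" using BD by auto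
        have "directed_in E ((\<lambda>f. f (fst p)) ` H)"
          by (rule directed_image[OF H(1)]) (use bD FE in auto)
        moreover have "is_lub_in E ((\<lambda>f. f (fst p)) ` H) (h (fst p))" using lubG[OF H(1,2) bD] .
        moreover have "compact_in E (snd p)" using C eC unfolding omega_basis_def by blast
        ultimately show "\<exists>g\<in>H. below E (snd p) (g (fst p))" using le unfolding compact_in_def by blast
      qed
      then obtain w where w: "\<And>p. p \<in> P \<Longrightarrow> w p \<in> H \<and> below E (snd p) (w p (fst p))" by metis
      have "finite P" using P unfolding under_def by blast
      then obtain g where g: "g \<in> H" "\<forall>q\<in>w ` P. below ?G q g"
        using directed_finite_ub[OF H(1) pG, of "w ` P"] w by blast
      have gF: "g \<in> F" using g HF by blast
      have "below E e (g b)" if be: "(b, e) \<in> P" for b e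
      proof -
        have "b \<in> elems D" "e \<in> elems E" using P be BD CE unfolding under_def by blast+
        moreover have "below E e (w (b, e) b)" "w (b, e) \<in> F" using w[OF be] HF by auto
        moreover have "below ?G (w (b, e)) g" using g be by blast
        ultimately show ?thesis
          using porder_trans[OF pE, of e "w (b, e) b" "g b"] FE gF by simp
      qed
      then have "under P g" using P unfolding under_def by blast
      then have "below ?G k g" using stbelow gF k by simp
      then show "\<exists>g\<in>H. below ?G k g" using g by blast
    qed
  next
    fix f assume "f \<in> elems ?G"
    then have f: "f \<in> F" by simp
    show "directed_in ?G {k \<in> K. below ?G k f}"
      unfolding directed_in_def
    proof (intro conjI ballI)
      show "{k \<in> K. below ?G k f} \<subseteq> elems ?G" using stF f unfolding Kbelow[OF f] by auto
      have "under {} f" unfolding under_def by simp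
      then show "{k \<in> K. below ?G k f} \<noteq> {}" unfolding Kbelow[OF f] by blast
      fix k l assume "k \<in> {k \<in> K. below ?G k f}" "l \<in> {k \<in> K. below ?G k f}"
      then obtain P Q where PQ: "under P f" "k = st P" "under Q f" "l = st Q"
        unfolding Kbelow[OF f] by blast
      have u: "under (P \<union> Q) f" using PQ unfolding under_def by auto
      have sub: "A P x \<subseteq> A (P \<union> Q) x" "A Q x \<subseteq> A (P \<union> Q) x" for x unfolding A_def by auto
      have "below ?G k (st (P \<union> Q))" "below ?G l (st (P \<union> Q))"
        using st[OF u f] st[OF PQ(1) f] st[OF PQ(3) f] sub PQ by (simp_all add: subset_iff)
      moreover have "st (P \<union> Q) \<in> {k \<in> K. below ?G k f}" unfolding Kbelow[OF f] using u by blast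
      ultimately show "\<exists>z\<in>{k \<in> K. below ?G k f}. below ?G k z \<and> below ?G l z" by blast
    qed
    show "is_lub_in ?G {k \<in> K. below ?G k f} f"
      unfolding is_lub_in_def
    proof (intro conjI ballI impI)
      show "f \<in> elems ?G" using f by simp
      show "below ?G x f" if "x \<in> {k \<in> K. below ?G k f}" for x using that by blast
      fix u assume "u \<in> elems ?G" and ub: "\<forall>x\<in>{k \<in> K. below ?G k f}. below ?G x u"
      then have u: "u \<in> F" by simp
      have "below E (f x) (u x)" if x: "x \<in> elems D" for x
      proof -
        have "below E e (u x)" if e: "e \<in> C" "below E e (f x)" for e
        proof -
          let ?X = "{b \<in> B. below D b x}"
          have X: "directed_in D ?X" "is_lub_in D ?X x" using B x unfolding omega_basis_def by auto
          have "directed_in E (f ` ?X)"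
            by (rule directed_image[OF X(1)]) (use f FE Fmono in auto)
          moreover have "is_lub_in E (f ` ?X) (f x)" using Flub[OF f X] .
          moreover have "compact_in E e" using C e unfolding omega_basis_def by blast
          ultimately obtain b where b: "b \<in> B" "below D b x" "below E e (f b)"
            using e(2) unfolding compact_in_def by blast
          have un: "under {(b, e)} f" using b e unfolding under_def by simp
          then have "below ?G (st {(b, e)}) u" using ub unfolding Kbelow[OF f] by blast
          then have 1: "below E (st {(b, e)} x) (u x)" using x by simp
          have "e \<in> A {(b, e)} x" unfolding A_def using b by blast
          then have 2: "below E e (st {(b, e)} x)" using st[OF un f x] by blast
          show ?thesis
            using porder_trans[OF pE 2 1] CE e stE[OF un f x] FE[OF u x] by blast
        qed
        moreover have "is_lub_in E {e \<in> C. below E e (f x)} (f x)"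
          using C FE[OF f x] unfolding omega_basis_def by blast
        ultimately show ?thesis using FE[OF u x] unfolding is_lub_in_def by blast
      qed
      then show "below ?G f u" by simp
    qed
  qed
  then show ?thesis using pG ptw unfolding omega_algebraic_def by blast
qed

lemma encode_inj:
  assumes "\<exists>c :: _ \<Rightarrow> nat set. inj_on c F"
  shows "inj_on (encode F) F"
  using someI_ex[OF assms] unfolding encode_def inj_on_def by simp

lemma fun_ordset_coding:
  assumes D: "omega_algebraic D" and E: "omega_algebraic E" and F: "F \<subseteq> scott_maps D E"
  shows "bij_betw (encode F) F (elems (fun_ordset D E F))"
    and "bij_betw (decode F) (elems (fun_ordset D E F)) F"
    and "\<And>f. f \<in> F \<Longrightarrow> decode F (encode F f) = f"
proof -
  have inj: "inj_on (encode F) F" using encode_inj countable_injection[OF assms] by blast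
  then show 1: "bij_betw (encode F) F (elems (fun_ordset D E F))"
    by (simp add: bij_betw_def fun_ordset_def)
  show "bij_betw (decode F) (elems (fun_ordset D E F)) F"
    unfolding decode_def using bij_betw_inv_into[OF 1] .
  show "decode F (encode F f) = f" if "f \<in> F" for f
    unfolding decode_def using inj that by (rule inv_into_f_f)
qed

lemma omega_algebraic_fun_ordset:
  assumes D: "omega_algebraic D" and E: "omega_algebraic E" and F: "F \<subseteq> scott_maps D E"
    and raw: "omega_algebraic (raw_fun_ordset D E F)"
  shows "omega_algebraic (fun_ordset D E F)"
proof (rule omega_algebraic_iso[OF _ _ raw])
  show "bij_betw (encode F) (elems (raw_fun_ordset D E F)) (elems (fun_ordset D E F))"
    using fun_ordset_coding(1)[OF D E F] by simp
  fix f g assume "f \<in> elems (raw_fun_ordset D E F)" "g \<in> elems (raw_fun_ordset D E F)"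
  then show "below (fun_ordset D E F) (encode F f) (encode F g) = below (raw_fun_ordset D E F) f g"
    using fun_ordset_coding(3)[OF D E F] by (simp add: fun_ordset_def)
qed

subsection \<open>The natural numbers\<close>

lemma N_ground_directed:
  assumes X: "directed_in N_ground X"
  shows "\<exists>s\<in>X. \<forall>x\<in>X. below N_ground x s"
proof (cases "X = {Ground None}")
  case True
  then show ?thesis by (simp add: N_ground_def)
next
  case False
  then obtain s where s: "s \<in> X" "s \<noteq> Ground None" using X unfolding directed_in_def by blast
  have "below N_ground x s" if "x \<in> X" for x
    using X s that unfolding directed_in_def N_ground_def by auto
  then show ?thesis using s by blast
qed

lemma omega_algebraic_N_ground: "omega_algebraic N_ground"
proof -
  have po: "porder_on N_ground" unfolding porder_on_def N_ground_def by auto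
  have lub: "is_lub_in N_ground X s" if "directed_in N_ground X" "s \<in> X" "\<forall>x\<in>X. below N_ground x s"
    for X s using that unfolding is_lub_in_def directed_in_def by blast
  have "compact_in N_ground c" if "c \<in> elems N_ground" for c
    unfolding compact_in_def
  proof (intro conjI allI impI)
    show "c \<in> elems N_ground" by fact
    fix X s assume X: "directed_in N_ground X" "is_lub_in N_ground X s" "below N_ground c s"
    obtain m where "m \<in> X" "\<forall>x\<in>X. below N_ground x m" using N_ground_directed[OF X(1)] by blast
    then have "s \<in> X" using lub[OF X(1)] lub_unique[OF po X(2)] by blast
    then show "\<exists>x\<in>X. below N_ground c x" using X(3) by blast
  qed
  moreover have "countable (elems N_ground)" by (simp add: N_ground_def)
  moreover have "directed_in N_ground {b \<in> elems N_ground. below N_ground b x} \<and>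
      is_lub_in N_ground {b \<in> elems N_ground. below N_ground b x} x" if "x \<in> elems N_ground" for x
    using that po unfolding directed_in_def is_lub_in_def by (auto simp: N_ground_def)
  ultimately have "omega_basis N_ground (elems N_ground)" unfolding omega_basis_def by blast
  then show ?thesis
    unfolding omega_algebraic_def using po N_ground_directed lub by blast
qed

lemma tree_like_N_ground: "tree_like N_ground"
  unfolding tree_like_def N_ground_def by auto

lemma omega_algebraic_N_dom: "omega_algebraic (N_dom k)"
proof (induction k)
  case 0
  then show ?case by (simp add: omega_algebraic_N_ground)
next
  case (Suc k)
  have "omega_algebraic (raw_fun_ordset (N_dom k) N_ground (scott_maps (N_dom k) N_ground))"
    by (rule omega_algebraic_raw_fun[OF Suc omega_algebraic_N_ground tree_like_N_ground]) auto
  then show ?case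
    using omega_algebraic_fun_ordset[OF Suc omega_algebraic_N_ground subset_refl] by simp
qed

theorem bij_betw_N_app:
  "bij_betw (N_app k) (elems (N_dom (Suc k))) (scott_maps (N_dom k) (N_dom 0))"
  using fun_ordset_coding(2)[OF omega_algebraic_N_dom omega_algebraic_N_ground subset_refl]
  by (simp add: N_app_def)

subsection \<open>The signed digit sequences\<close>

definition seq_ordset :: "(nat \<rightharpoonup> int) ordset" where
  "seq_ordset = \<lparr>elems = digit_seqs, below = (\<subseteq>\<^sub>m)\<rparr>"

lemma seq_ordset_simps [simp]: "elems seq_ordset = digit_seqs" "below seq_ordset = (\<subseteq>\<^sub>m)"
  by (simp_all add: seq_ordset_def)

lemma map_le_SomeD: "s \<subseteq>\<^sub>m t \<Longrightarrow> s n = Some v \<Longrightarrow> t n = Some v"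
  unfolding map_le_def by (metis domI)

lemma map_leI: "(\<And>n v. s n = Some v \<Longrightarrow> t n = Some v) \<Longrightarrow> s \<subseteq>\<^sub>m t"
  unfolding map_le_def by auto

lemma porder_seq: "porder_on seq_ordset"
  unfolding porder_on_def by (auto intro: map_le_trans map_le_antisym)

lemma digit_seqs_None: "s \<in> digit_seqs \<Longrightarrow> s n = None \<Longrightarrow> n \<le> m \<Longrightarrow> s m = None"
proof (induction m)
  case (Suc m)
  then show ?case by (cases "n = Suc m") (auto simp: digit_seqs_def)
qed auto

definition seq_sup :: "(nat \<rightharpoonup> int) set \<Rightarrow> (nat \<rightharpoonup> int)" where
  "seq_sup X n = (if \<exists>v. \<exists>s\<in>X. s n = Some v then Some (SOME v. \<exists>s\<in>X. s n = Some v) else None)"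

lemma seq_sup_Some:
  assumes X: "directed_in seq_ordset X"
  shows "seq_sup X n = Some v \<longleftrightarrow> (\<exists>s\<in>X. s n = Some v)"
proof -
  have un: "v = w" if vw: "s \<in> X" "s n = Some v" "t \<in> X" "t n = Some w" for s t v w
  proof -
    obtain z where "s \<subseteq>\<^sub>m z" "t \<subseteq>\<^sub>m z" 
      using X vw(1,3) unfolding directed_in_def seq_ordset_simps by blast
    then have "z n = Some v" "z n = Some w" using vw map_le_SomeD by metis+
    then show ?thesis by simp
  qed
  show ?thesis
  proof
    assume a: "seq_sup X n = Some v"
    then have e: "\<exists>v. \<exists>s\<in>X. s n = Some v" unfolding seq_sup_def by (auto split: if_splits)
    have "\<exists>s\<in>X. s n = Some (SOME v. \<exists>s\<in>X. s n = Some v)" using someI_ex[OF e] .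
    then show "\<exists>s\<in>X. s n = Some v" using a e unfolding seq_sup_def by (simp add: if_splits)
  next
    assume a: "\<exists>s\<in>X. s n = Some v"
    then have e: "\<exists>v. \<exists>s\<in>X. s n = Some v" by blast
    have "\<exists>s\<in>X. s n = Some (SOME v. \<exists>s\<in>X. s n = Some v)" using someI_ex[OF e] .
    then have "(SOME v. \<exists>s\<in>X. s n = Some v) = v" using a un by blast
    then show "seq_sup X n = Some v" unfolding seq_sup_def using e by simp
  qed
qed

lemma seq_sup_lub:
  assumes X: "directed_in seq_ordset X"
  shows "is_lub_in seq_ordset X (seq_sup X)"
proof -
  have Xd: "X \<subseteq> digit_seqs" using X unfolding directed_in_def by simp
  have "seq_sup X \<in> digit_seqs"
    unfolding digit_seqs_def
  proof (intro CollectI conjI allI impI)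
    fix n assume a: "seq_sup X n = None"
    show "seq_sup X (Suc n) = None"
    proof (rule ccontr)
      assume "seq_sup X (Suc n) \<noteq> None"
      then obtain v s where s: "s \<in> X" "s (Suc n) = Some v"
        using seq_sup_Some[OF X] by blast
      then have "s n \<noteq> None" using Xd digit_seqs_None[of s n "Suc n"] by auto
      then obtain w where "s n = Some w" by blast
      then have "seq_sup X n = Some w" using s seq_sup_Some[OF X] by blast
      then show False using a by simp
    qed
  next
    fix n b assume "seq_sup X (Suc n) = Some b"
    then obtain s where "s \<in> X" "s (Suc n) = Some b" using seq_sup_Some[OF X] by blast
    then show "b \<in> {-1, 0, 1}" using Xd unfolding digit_seqs_def by blast
  qed
  moreover have "s \<subseteq>\<^sub>m seq_sup X" if "s \<in> X" for s
    using that seq_sup_Some[OF X] by (intro map_leI) blast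
  moreover have "seq_sup X \<subseteq>\<^sub>m u" if u: "\<forall>x\<in>X. x \<subseteq>\<^sub>m u" for u
  proof (rule map_leI)
    fix n v assume "seq_sup X n = Some v"
    then obtain s where "s \<in> X" "s n = Some v" using seq_sup_Some[OF X] by blast
    then show "u n = Some v" using u map_le_SomeD[of s u] by simp
  qed
  ultimately show ?thesis unfolding is_lub_in_def by simp
qed

lemma seq_tree:
  assumes s: "s \<in> digit_seqs" "s \<subseteq>\<^sub>m u" and t: "t \<in> digit_seqs" "t \<subseteq>\<^sub>m u"
  shows "s \<subseteq>\<^sub>m t \<or> t \<subseteq>\<^sub>m s"
proof (cases "\<exists>n. s n \<noteq> None \<and> t n = None")
  case True
  then obtain n where n: "s n \<noteq> None" "t n = None" by blast
  have "t \<subseteq>\<^sub>m s"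
  proof (rule map_leI)
    fix m v assume m: "t m = Some v"
    then have "m < n" using digit_seqs_None[OF t(1) n(2), of m] by (cases "n \<le> m") auto
    then have "s m \<noteq> None" using n(1) digit_seqs_None[OF s(1) _ less_imp_le, of m n] by metis
    then obtain w where w: "s m = Some w" by blast
    then show "s m = Some v" using m map_le_SomeD[OF s(2) w] map_le_SomeD[OF t(2) m] by simp
  qed
  then show ?thesis ..
next
  case False
  have "s \<subseteq>\<^sub>m t"
  proof (rule map_leI)
    fix m v assume m: "s m = Some v"
    then obtain w where w: "t m = Some w" using False by fastforce
    then show "t m = Some v" using map_le_SomeD[OF s(2) m] map_le_SomeD[OF t(2) w] by simp
  qed
  then show ?thesis ..
qed

definition list_seq :: "int list \<Rightarrow> (nat \<rightharpoonup> int)" where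
  "list_seq l n = (if n < length l then Some (l ! n) else None)"

lemma restrict_list_seq:
  assumes "\<And>m. m < n \<Longrightarrow> s m \<noteq> None"
  shows "s |` {..<n} = list_seq (map (\<lambda>m. the (s m)) [0..<n])"
proof
  fix m show "(s |` {..<n}) m = list_seq (map (\<lambda>m. the (s m)) [0..<n]) m"
    using assms[of m] by (cases "m < n") (auto simp: list_seq_def restrict_map_def)
qed

lemma restrict_digit_seqs: "s \<in> digit_seqs \<Longrightarrow> s |` {..<n} \<in> digit_seqs"
  by (auto simp: digit_seqs_def restrict_map_def split: if_splits)

lemma restrict_map_le: "s |` A \<subseteq>\<^sub>m s"
  by (auto simp: map_le_def restrict_map_def split: if_splits)

lemma compact_finite_seq:
  assumes c: "c \<in> digit_seqs" "finite (dom c)"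
  shows "compact_in seq_ordset c"
  unfolding compact_in_def
proof (intro conjI allI impI)
  show "c \<in> elems seq_ordset" using c by simp
  fix X s assume X: "directed_in seq_ordset X" "is_lub_in seq_ordset X s" "below seq_ordset c s"
  have s: "s = seq_sup X" using lub_unique[OF porder_seq X(2) seq_sup_lub[OF X(1)]] .
  have "\<forall>n\<in>dom c. \<exists>x\<in>X. x n = c n"
  proof
    fix n assume "n \<in> dom c"
    then obtain v where v: "c n = Some v" by blast
    moreover have "c \<subseteq>\<^sub>m seq_sup X" using X(3) s by simp
    ultimately have "seq_sup X n = Some v" using map_le_SomeD by metis
    then show "\<exists>x\<in>X. x n = c n" using v seq_sup_Some[OF X(1)] by auto
  qed
  then obtain w where w: "\<And>n. n \<in> dom c \<Longrightarrow> w n \<in> X \<and> w n n = c n" by metis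
  obtain z where z: "z \<in> X" "\<forall>y\<in>w ` dom c. below seq_ordset y z"
    using directed_finite_ub[OF X(1) porder_seq, of "w ` dom c"] c w by blast
  have "c \<subseteq>\<^sub>m z"
  proof (rule map_leI)
    fix n v assume v: "c n = Some v"
    then have "w n \<subseteq>\<^sub>m z" "w n n = Some v" using z w[of n] by auto
    then show "z n = Some v" by (rule map_le_SomeD)
  qed
  then show "\<exists>x\<in>X. below seq_ordset c x" using z by auto
qed

lemma omega_algebraic_seq: "omega_algebraic seq_ordset"
proof -
  define B where "B = {c \<in> digit_seqs. c \<in> range list_seq}"
  have fin: "finite (dom (list_seq l))" for l
    by (rule finite_subset[of _ "{..<length l}"]) (auto simp: list_seq_def split: if_splits)
  have "omega_basis seq_ordset B"
    unfolding omega_basis_def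
  proof (intro conjI ballI)
    have "B \<subseteq> range list_seq" unfolding B_def by blast
    then show "countable B" by (rule countable_subset) simp
    show "compact_in seq_ordset b" if "b \<in> B" for b
      using that compact_finite_seq fin unfolding B_def by blast
    fix x assume "x \<in> elems seq_ordset"
    then have x: "x \<in> digit_seqs" by simp
    let ?X = "{b \<in> B. below seq_ordset b x}"
    have pre: "x |` {..<n} \<in> ?X" if "\<And>m. m < n \<Longrightarrow> x m \<noteq> None" for n
    proof -
      have "x |` {..<n} \<in> range list_seq" using restrict_list_seq[of n x] that by blast
      then show ?thesis
        using restrict_digit_seqs[OF x] restrict_map_le unfolding B_def by simp
    qed
    show "directed_in seq_ordset ?X"
      unfolding directed_in_def
    proof (intro conjI ballI)
      show "?X \<subseteq> elems seq_ordset" unfolding B_def by auto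
      show "?X \<noteq> {}" using pre[of 0] by blast
      fix s t assume st: "s \<in> ?X" "t \<in> ?X"
      then have "s \<subseteq>\<^sub>m t \<or> t \<subseteq>\<^sub>m s" using seq_tree[of s x t] unfolding B_def by auto
      then show "\<exists>z\<in>?X. below seq_ordset s z \<and> below seq_ordset t z" using st by auto
    qed
    show "is_lub_in seq_ordset ?X x"
      unfolding is_lub_in_def
    proof (intro conjI ballI impI)
      show "x \<in> elems seq_ordset" using x by simp
      show "below seq_ordset y x" if "y \<in> ?X" for y using that by blast
      fix u assume u: "\<forall>y\<in>?X. below seq_ordset y u"
      have "x \<subseteq>\<^sub>m u"
      proof (rule map_leI)
        fix n v assume v: "x n = Some v"
        then have "x m \<noteq> None" if "m < Suc n" for m
          using digit_seqs_None[OF x, of m n] that by auto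
        then have "x |` {..<Suc n} \<subseteq>\<^sub>m u" using pre u by simp
        moreover have "(x |` {..<Suc n}) n = Some v" using v by (simp add: restrict_map_def)
        ultimately show "u n = Some v" by (rule map_le_SomeD)
      qed
      then show "below seq_ordset x u" by simp
    qed
  qed
  then show ?thesis unfolding omega_algebraic_def using porder_seq seq_sup_lub by blast
qed

lemma S_ground_simps:
  "elems S_ground = Ground ` digit_seqs"
  "below S_ground (Ground s) (Ground t) \<longleftrightarrow> s \<subseteq>\<^sub>m t"
  by (auto simp: S_ground_def)

lemma Ground_iso:
  "bij_betw Ground (elems seq_ordset) (elems S_ground)"
  "below S_ground (Ground s) (Ground t) \<longleftrightarrow> below seq_ordset s t"
  by (auto simp: S_ground_simps bij_betw_def inj_on_def)

lemma omega_algebraic_S_ground: "omega_algebraic S_ground"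
  by (rule omega_algebraic_iso[OF Ground_iso omega_algebraic_seq])

lemma tree_like_S_ground: "tree_like S_ground"
  unfolding tree_like_def S_ground_simps
proof (intro conjI)
  have "Map.empty \<in> digit_seqs" by (simp add: digit_seqs_def)
  then show "\<exists>b\<in>Ground ` digit_seqs. \<forall>x\<in>Ground ` digit_seqs. below S_ground b x"
    by (intro bexI[of _ "Ground Map.empty"]) (auto simp: S_ground_simps)
  show "\<forall>x\<in>Ground ` digit_seqs. \<forall>y\<in>Ground ` digit_seqs. \<forall>z\<in>Ground ` digit_seqs.
     below S_ground x z \<longrightarrow> below S_ground y z \<longrightarrow> below S_ground x y \<or> below S_ground y x"
    using seq_tree by (auto simp: S_ground_simps)
qed

lemma maximal_S_ground_iff:
  "maximal_in S_ground x \<longleftrightarrow> (\<exists>s\<in>digit_seqs. x = Ground s \<and> (\<forall>n. s n \<noteq> None))"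
proof
  assume x: "maximal_in S_ground x"
  then obtain s where s: "s \<in> digit_seqs" "x = Ground s"
    unfolding maximal_in_def S_ground_simps by blast
  define t where "t n = (case s n of None \<Rightarrow> Some 0 | Some v \<Rightarrow> Some v)" for n
  have "t \<in> digit_seqs" using s(1) unfolding digit_seqs_def t_def by (auto split: option.splits)
  moreover have "s \<subseteq>\<^sub>m t" by (rule map_leI) (simp add: t_def)
  ultimately have "t = s" using x s unfolding maximal_in_def by (auto simp: S_ground_simps)
  moreover have "t n \<noteq> None" for n unfolding t_def by (auto split: option.splits)
  ultimately show "\<exists>s\<in>digit_seqs. x = Ground s \<and> (\<forall>n. s n \<noteq> None)" using s by blast
next
  assume "\<exists>s\<in>digit_seqs. x = Ground s \<and> (\<forall>n. s n \<noteq> None)"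
  then obtain s where s: "s \<in> digit_seqs" "x = Ground s" "\<And>n. s n \<noteq> None" by blast
  have "t = s" if "s \<subseteq>\<^sub>m t" for t
  proof
    fix n show "t n = s n" using s(3)[of n] that unfolding map_le_def by (metis domIff)
  qed
  then show "maximal_in S_ground x" using s unfolding maximal_in_def by (auto simp: S_ground_simps)
qed

lemma rho_S_Ground [simp]: "rho_S (Ground s) = seq_val s"
  by (simp add: rho_S_def)

definition seq_sim :: "(nat \<rightharpoonup> int) \<Rightarrow> (nat \<rightharpoonup> int) \<Rightarrow> bool" where
  "seq_sim s t \<longleftrightarrow> (\<exists>m1\<in>digit_seqs. \<exists>m2\<in>digit_seqs. (\<forall>n. m1 n \<noteq> None) \<and> (\<forall>n. m2 n \<noteq> None) \<and>
     s \<subseteq>\<^sub>m m1 \<and> t \<subseteq>\<^sub>m m2 \<and> seq_val m1 = seq_val m2)"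

lemma S_sim0_Ground: "S_sim0 (Ground s) (Ground t) \<longleftrightarrow> s \<in> digit_seqs \<and> t \<in> digit_seqs \<and> seq_sim s t"
  unfolding S_sim0_def seq_sim_def maximal_S_ground_iff
  by (auto simp: S_ground_simps) (metis S_ground_simps(2) rho_S_Ground)+

lemma seq_sim_down: "seq_sim s t \<Longrightarrow> s' \<subseteq>\<^sub>m s \<Longrightarrow> t' \<subseteq>\<^sub>m t \<Longrightarrow> seq_sim s' t'"
  unfolding seq_sim_def by (meson map_le_trans)

lemma digit_abs_le: "m \<in> digit_seqs \<Longrightarrow> m n \<noteq> None \<Longrightarrow> n > 0 \<Longrightarrow> \<bar>real_of_int (the (m n))\<bar> \<le> 1"
  by (cases n) (auto simp: digit_seqs_def, fastforce)

definition seq_part :: "nat \<Rightarrow> (nat \<rightharpoonup> int) \<Rightarrow> real" where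
  "seq_part L m = of_int (the (m 0)) + (\<Sum>n<L. of_int (the (m (Suc n))) / 2 ^ Suc n)"

lemma geo_sums: "(\<lambda>n. 1 / 2 ^ Suc (n + L) :: real) sums (1 / 2 ^ L)"
proof -
  have "(\<lambda>n. (1/2)^L * (1/2) ^ Suc n :: real) sums ((1/2)^L * 1)"
    by (intro sums_mult power_half_series)
  then show ?thesis by (simp add: power_add power_one_over mult_ac)
qed

lemma seq_val_bound:
  assumes m: "m \<in> digit_seqs" "\<And>n. m n \<noteq> None"
  shows "summable (\<lambda>n. real_of_int (the (m (Suc n))) / 2 ^ Suc n)"
    and "\<bar>seq_val m - seq_part L m\<bar> \<le> 1 / 2 ^ L"
proof -
  let ?d = "\<lambda>n. real_of_int (the (m (Suc n))) / 2 ^ Suc n"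
  have le: "norm (?d n) \<le> 1 / 2 ^ Suc n" for n
    using digit_abs_le[OF m(1) m(2), of "Suc n"] by (simp add: divide_right_mono del: power_Suc)
  have g: "summable (\<lambda>n. 1 / 2 ^ Suc (n + K) :: real)" for K using geo_sums sums_summable by blast
  show sm: "summable ?d"
    by (rule summable_comparison_test'[OF g[of 0], of 0]) (use le in simp)
  have sm2: "summable (\<lambda>n. norm (?d (n + L)))"
    by (rule summable_comparison_test'[OF g[of L], of 0]) (use le in simp)
  have "seq_val m - seq_part L m = (\<Sum>n. ?d (n + L))"
    unfolding seq_val_def seq_part_def using suminf_split_initial_segment[OF sm, of L] by simp
  also have "norm \<dots> \<le> (\<Sum>n. norm (?d (n + L)))" by (rule summable_norm[OF sm2])
  also have "\<dots> \<le> (\<Sum>n. 1 / 2 ^ Suc (n + L))" by (rule suminf_le[OF _ sm2 g]) (rule le)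
  also have "\<dots> = 1 / 2 ^ L" using geo_sums sums_unique by metis
  finally show "\<bar>seq_val m - seq_part L m\<bar> \<le> 1 / 2 ^ L" by simp
qed

lemma seq_part_cong: "(\<And>n. n \<le> L \<Longrightarrow> m n = m' n) \<Longrightarrow> seq_part L m = seq_part L m'"
  unfolding seq_part_def by simp

lemma signed_digit_expansion:
  fixes r :: real
  assumes "\<bar>r\<bar> \<le> 1"
  shows "\<exists>b :: nat \<Rightarrow> int. (\<forall>n. b n \<in> {-1, 0, 1}) \<and> (\<lambda>n. of_int (b n) / 2 ^ Suc n) sums r"
proof -
  define dg where "dg x = (if x > 0 then 1 else if x < 0 then -1 else 0 :: int)" for x :: real
  define q where "q = rec_nat r (\<lambda>n x. 2 * x - of_int (dg x))"
  have q0: "q 0 = r" and qS: "q (Suc n) = 2 * q n - of_int (dg (q n))" for n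
    unfolding q_def by simp_all
  have qb: "\<bar>q n\<bar> \<le> 1" for n
  proof (induction n)
    case (Suc n) then show ?case unfolding qS dg_def by auto
  qed (use assms q0 in simp)
  have part: "(\<Sum>i<n. of_int (dg (q i)) / 2 ^ Suc i) = r - q n / 2 ^ n" for n
    by (induction n) (simp_all add: q0 qS field_simps)
  have "(\<lambda>n. q n / 2 ^ n) \<longlonglongrightarrow> 0"
  proof (rule Lim_null_comparison)
    show "\<forall>\<^sub>F n in sequentially. norm (q n / 2 ^ n) \<le> (1/2) ^ n"
      using qb by (intro always_eventually allI) (simp add: power_one_over divide_right_mono)
    show "(\<lambda>n. (1/2) ^ n :: real) \<longlonglongrightarrow> 0" by (rule LIMSEQ_power_zero) simp
  qed
  then have "(\<lambda>n. r - q n / 2 ^ n) \<longlonglongrightarrow> r - 0" by (rule tendsto_diff[OF tendsto_const])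
  then have "(\<lambda>n. of_int (dg (q n)) / 2 ^ Suc n) sums r" unfolding sums_def part by simp
  moreover have "\<forall>n. dg (q n) \<in> {-1, 0, 1}" unfolding dg_def by simp
  ultimately show ?thesis by (intro exI[of _ "\<lambda>n. dg (q n)"] conjI)
qed

lemma extend_to_value:
  assumes t: "t \<in> digit_seqs" and L: "\<And>n. n \<le> L \<Longrightarrow> t n \<noteq> None" "t (Suc L) = None"
    and r: "\<bar>r - seq_part L t\<bar> \<le> 1 / 2 ^ L"
  shows "\<exists>m\<in>digit_seqs. (\<forall>n. m n \<noteq> None) \<and> t \<subseteq>\<^sub>m m \<and> seq_val m = r"
proof -
  have "\<bar>(r - seq_part L t) * 2 ^ L\<bar> \<le> 1" 
    using mult_right_mono[OF r, of "2 ^ L"] by (simp add: abs_mult)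
  then obtain b :: "nat \<Rightarrow> int" where b: "\<And>n. b n \<in> {-1, 0, 1}"
    and bs: "(\<lambda>n. of_int (b n) / 2 ^ Suc n) sums ((r - seq_part L t) * 2 ^ L)"
    using signed_digit_expansion by blast
  define m where "m n = (if n \<le> L then t n else Some (b (n - Suc L)))" for n
  have mt: "\<forall>n. m n \<noteq> None" using L unfolding m_def by auto
  have md: "m \<in> digit_seqs"
    unfolding digit_seqs_def
  proof (intro CollectI conjI allI impI)
    show "m (Suc n) = None" if "m n = None" for n using mt that by blast
    show "v \<in> {-1, 0, 1}" if "m (Suc n) = Some v" for n v
      using that t b[of "Suc n - Suc L"] unfolding m_def digit_seqs_def by (auto split: if_splits)
  qed
  have "t \<subseteq>\<^sub>m m"
  proof (rule map_leI)
    fix n v assume v: "t n = Some v"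
    then have "n \<le> L" using digit_seqs_None[OF t L(2), of n] by (cases "Suc L \<le> n") auto
    then show "m n = Some v" using v unfolding m_def by simp
  qed
  moreover have "seq_val m = r"
  proof -
    let ?d = "\<lambda>n. real_of_int (the (m (Suc n))) / 2 ^ Suc n"
    have "(\<lambda>n. ?d (n + L)) = (\<lambda>n. (of_int (b n) / 2 ^ Suc n) * (1 / 2 ^ L))"
      by (auto simp: m_def power_add)
    then have "(\<lambda>n. ?d (n + L)) sums ((r - seq_part L t) * 2 ^ L * (1 / 2 ^ L))"
      using sums_mult2[OF bs, of "1 / 2 ^ L"] by (simp only:)
    then have "(\<Sum>n. ?d (n + L)) = r - seq_part L t" using sums_unique by fastforce
    moreover have "seq_val m = seq_part L m + (\<Sum>n. ?d (n + L))"
      unfolding seq_val_def seq_part_def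
      using suminf_split_initial_segment[OF seq_val_bound(1)[OF md], of L] mt by simp
    moreover have "seq_part L m = seq_part L t" by (rule seq_part_cong) (simp add: m_def)
    ultimately show ?thesis by simp
  qed
  ultimately show ?thesis using md mt by blast
qed

lemma seq_sim_sym: "seq_sim s t \<Longrightarrow> seq_sim t s"
  unfolding seq_sim_def by metis

lemma seq_last:
  assumes s: "s \<in> digit_seqs" and n: "s n = None" and "s 0 \<noteq> None"
  obtains L where "\<And>k. k \<le> L \<Longrightarrow> s k \<noteq> None" "s (Suc L) = None"
proof -
  define l where "l = (LEAST k. s k = None)"
  have l: "s l = None" "\<And>k. k < l \<Longrightarrow> s k \<noteq> None"
    unfolding l_def using LeastI[of "\<lambda>k. s k = None", OF n] not_less_Least by auto
  then obtain L where "l = Suc L" using assms(3) by (cases l) auto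
  then show thesis using l that[of L] by auto
qed

lemma part_limit:
  fixes a b :: real
  assumes "\<And>n. n \<ge> N \<Longrightarrow> a \<le> b + c / 2 ^ n"
  shows "a \<le> b"
proof (rule LIMSEQ_le_const)
  have "(\<lambda>n. b + c * (1/2) ^ n) \<longlonglongrightarrow> b + c * 0"
    by (intro tendsto_add tendsto_mult tendsto_const LIMSEQ_power_zero) simp
  then show "(\<lambda>n. b + c / 2 ^ n) \<longlonglongrightarrow> b" by (simp add: power_one_over)
  show "\<exists>N. \<forall>n\<ge>N. a \<le> b + c / 2 ^ n" using assms by blast
qed

lemma seq_sim_closed:
  assumes s: "s \<in> digit_seqs" and t: "t \<in> digit_seqs"
    and pre: "\<And>n. seq_sim (s |` {..<n}) (t |` {..<n})"
  shows "seq_sim s t"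
proof -
  have agree: "seq_part L m = seq_part L u"
    if le: "u |` {..<Suc L} \<subseteq>\<^sub>m m" and def: "\<And>k. k \<le> L \<Longrightarrow> u k \<noteq> None" for u m L
  proof (rule seq_part_cong)
    fix k assume k: "k \<le> L"
    then obtain v where v: "u k = Some v" using def by blast
    then have "(u |` {..<Suc L}) k = Some v" using k by (simp add: restrict_map_def)
    then show "m k = u k" using map_le_SomeD[OF le] v by simp
  qed
  have mixed: "seq_sim u w"
    if u: "u \<in> digit_seqs" "\<And>n. u n \<noteq> None" and w: "w \<in> digit_seqs" "w k = None"
      and p: "\<And>n. seq_sim (u |` {..<n}) (w |` {..<n})" for u w k
  proof (cases "w 0 = None")
    case True
    then have "w \<subseteq>\<^sub>m u" using digit_seqs_None[OF w(1) True] by (intro map_leI) simp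
    then show ?thesis using u unfolding seq_sim_def by (intro bexI[of _ u] conjI) auto
  next
    case False
    then obtain L where L: "\<And>k. k \<le> L \<Longrightarrow> w k \<noteq> None" "w (Suc L) = None"
      using seq_last[OF w] by blast
    have "\<bar>seq_val u - seq_part L w\<bar> \<le> 1 / 2 ^ L"
    proof (rule part_limit[of L _ _ 2])
      fix n assume n: "L \<le> n"
      obtain m1 m2 where m: "m1 \<in> digit_seqs" "m2 \<in> digit_seqs" "\<And>n. m1 n \<noteq> None" "\<And>n. m2 n \<noteq> None"
        "u |` {..<Suc n} \<subseteq>\<^sub>m m1" "w |` {..<Suc n} \<subseteq>\<^sub>m m2" "seq_val m1 = seq_val m2"
        using p[of "Suc n"] unfolding seq_sim_def by blast
      have "w |` {..<Suc L} \<subseteq>\<^sub>m w |` {..<Suc n}"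
        using n by (intro map_leI) (auto simp: restrict_map_def split: if_splits)
      then have "w |` {..<Suc L} \<subseteq>\<^sub>m m2" using m(6) map_le_trans by blast
      then have "seq_part L m2 = seq_part L w" using agree L by blast
      moreover have "seq_part n m1 = seq_part n u" using agree[OF m(5)] u by blast
      moreover have "\<bar>seq_val m1 - seq_part n m1\<bar> \<le> 1 / 2 ^ n"
        using seq_val_bound(2)[OF m(1)] m(3) by blast
      moreover have "\<bar>seq_val u - seq_part n u\<bar> \<le> 1 / 2 ^ n" using seq_val_bound(2)[OF u] by blast
      moreover have "\<bar>seq_val m2 - seq_part L m2\<bar> \<le> 1 / 2 ^ L"
        using seq_val_bound(2)[OF m(2)] m(4) by blast
      ultimately show "\<bar>seq_val u - seq_part L w\<bar> \<le> 1 / 2 ^ L + 2 / 2 ^ n"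
        using m(7) by linarith
    qed
    then obtain m where "m \<in> digit_seqs" "\<forall>n. m n \<noteq> None" "w \<subseteq>\<^sub>m m" "seq_val m = seq_val u"
      using extend_to_value[OF w(1) L] by blast
    then show ?thesis using u unfolding seq_sim_def
      by (intro bexI[of _ u] bexI[of _ m] conjI) auto
  qed
  show ?thesis
  proof (cases "\<forall>n. s n \<noteq> None")
    case sT: True
    show ?thesis
    proof (cases "\<forall>n. t n \<noteq> None")
      case True
      have "\<bar>seq_val s - seq_val t\<bar> \<le> 0"
      proof (rule part_limit[of 0 _ _ 4])
        fix n
        obtain m1 m2 where m: "m1 \<in> digit_seqs" "m2 \<in> digit_seqs" "\<And>n. m1 n \<noteq> None" "\<And>n. m2 n \<noteq> None"
          "s |` {..<Suc n} \<subseteq>\<^sub>m m1" "t |` {..<Suc n} \<subseteq>\<^sub>m m2" "seq_val m1 = seq_val m2"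
          using pre[of "Suc n"] unfolding seq_sim_def by blast
        have "seq_part n m1 = seq_part n s" using agree[OF m(5)] sT by blast
        moreover have "seq_part n m2 = seq_part n t" using agree[OF m(6)] True by blast
        moreover have "\<bar>seq_val m1 - seq_part n m1\<bar> \<le> 1 / 2 ^ n"
          using seq_val_bound(2)[OF m(1)] m(3) by blast
        moreover have "\<bar>seq_val m2 - seq_part n m2\<bar> \<le> 1 / 2 ^ n"
          using seq_val_bound(2)[OF m(2)] m(4) by blast
        moreover have "\<bar>seq_val s - seq_part n s\<bar> \<le> 1 / 2 ^ n" using seq_val_bound(2)[OF s] sT by blast
        moreover have "\<bar>seq_val t - seq_part n t\<bar> \<le> 1 / 2 ^ n" using seq_val_bound(2)[OF t] True by blast
        ultimately show "\<bar>seq_val s - seq_val t\<bar> \<le> 0 + 4 / 2 ^ n" using m(7) by linarith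
      qed
      then show ?thesis using s t sT True unfolding seq_sim_def
        by (intro bexI[of _ s] bexI[of _ t] conjI) auto
    next
      case False
      then show ?thesis using mixed[OF s _ t] sT pre by blast
    qed
  next
    case False
    then obtain k where k: "s k = None" by blast
    show ?thesis
    proof (cases "\<forall>n. t n \<noteq> None")
      case True
      then have "seq_sim t s" using mixed[OF t _ s k] pre seq_sim_sym by blast
      then show ?thesis by (rule seq_sim_sym)
    next
      case False
      then obtain l where l: "t l = None" by blast
      have "s |` {..<k + l} = s" "t |` {..<k + l} = t"
        using digit_seqs_None[OF s k] digit_seqs_None[OF t l] by (auto simp: restrict_map_def fun_eq_iff)
      then show ?thesis using pre[of "k + l"] by simp
    qed
  qed
qed

lemma S_sim0_downD:
  assumes "S_sim0 x y" "below S_ground x' x" "below S_ground y' y" "x' \<in> elems S_ground" "y' \<in> elems S_ground"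
  shows "S_sim0 x' y'"
proof -
  obtain s t s' t' where "x = Ground s" "y = Ground t" "x' = Ground s'" "y' = Ground t'"
    "s' \<in> digit_seqs" "t' \<in> digit_seqs"
    using assms unfolding S_sim0_def S_ground_simps by blast
  then show ?thesis using assms seq_sim_down by (auto simp: S_sim0_Ground S_ground_simps)
qed

lemma S_sim0_lub:
  assumes X: "directed_in S_ground X" "is_lub_in S_ground X x"
    and Y: "directed_in S_ground Y" "is_lub_in S_ground Y y"
    and XY: "\<And>a b. a \<in> X \<Longrightarrow> b \<in> Y \<Longrightarrow> \<exists>a' b'. S_sim0 a' b' \<and> below S_ground a a' \<and> below S_ground b b'"
  shows "S_sim0 x y"
proof -
  obtain s t where st: "x = Ground s" "s \<in> digit_seqs" "y = Ground t" "t \<in> digit_seqs"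
    using X Y unfolding is_lub_in_def S_ground_simps by blast
  have comp: "\<exists>a\<in>Z. below S_ground (Ground (u |` {..<n})) a"
    if Z: "directed_in S_ground Z" "is_lub_in S_ground Z (Ground u)" and u: "u \<in> digit_seqs" for Z u n
  proof -
    obtain W where W: "W \<subseteq> digit_seqs" "Z = Ground ` W"
      using Z(1) unfolding directed_in_def S_ground_simps by (meson subset_imageE)
    have W2: "W \<subseteq> elems seq_ordset" "u \<in> elems seq_ordset" using W u by auto
    have "directed_in seq_ordset W" "is_lub_in seq_ordset W u"
      using Z ordset_iso_image[OF Ground_iso W2(1)] W2(2) unfolding W(2) by auto
    moreover have "compact_in seq_ordset (u |` {..<n})"
      by (rule compact_finite_seq[OF restrict_digit_seqs[OF u]]) simp
    moreover have "below seq_ordset (u |` {..<n}) u" using restrict_map_le by simp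
    ultimately obtain w where "w \<in> W" "(u |` {..<n}) \<subseteq>\<^sub>m w" unfolding compact_in_def by auto
    then show ?thesis unfolding W(2) by (intro bexI[of _ "Ground w"]) (auto simp: S_ground_simps)
  qed
  have "seq_sim (s |` {..<n}) (t |` {..<n})" for n
  proof -
    obtain a b where ab: "a \<in> X" "below S_ground (Ground (s |` {..<n})) a"
      "b \<in> Y" "below S_ground (Ground (t |` {..<n})) b"
      using comp[OF X(1) _ st(2)] comp[OF Y(1) _ st(4)] X(2) Y(2) st by metis
    obtain a' b' where ab': "S_sim0 a' b'" "below S_ground a a'" "below S_ground b b'"
      using XY[OF ab(1,3)] by blast
    have el: "a \<in> elems S_ground" "b \<in> elems S_ground"
      using ab X Y unfolding directed_in_def by auto
    have "S_sim0 a b" using S_sim0_downD[OF ab' el] .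
    moreover have "Ground (s |` {..<n}) \<in> elems S_ground" "Ground (t |` {..<n}) \<in> elems S_ground"
      using st restrict_digit_seqs by (auto simp: S_ground_simps)
    ultimately show ?thesis using S_sim0_downD ab S_sim0_Ground by blast
  qed
  then show ?thesis using seq_sim_closed[OF st(2,4)] st S_sim0_Ground by blast
qed

lemma sim_maps_subset: "sim_maps D R \<subseteq> scott_maps D S_ground"
  unfolding sim_maps_def by blast

lemma omega_algebraic_S_dom: "omega_algebraic (S_dom k)"
proof (induction k)
  case 0
  then show ?case by (simp add: omega_algebraic_S_ground S_dom_0)
next
  case (Suc k)
  let ?D = "S_dom k" and ?R = "S_sim k"
  let ?F = "sim_maps ?D ?R"
  let ?G = "raw_fun_ordset ?D S_ground ?F"
  have pD: "porder_on ?D" and pE: "porder_on S_ground"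
    using Suc omega_algebraic_S_ground by (auto simp: omega_algebraic_def)
  note iff = scott_maps_iff[OF pD pE]
  have "omega_algebraic ?G"
  proof (rule omega_algebraic_raw_fun[OF Suc omega_algebraic_S_ground tree_like_S_ground sim_maps_subset])
    fix f g assume f: "f \<in> ?F" and g: "g \<in> scott_maps ?D S_ground"
      and le: "\<And>x. x \<in> elems ?D \<Longrightarrow> below S_ground (g x) (f x)"
    have "g x \<in> elems S_ground" if "x \<in> elems ?D" for x using g that unfolding iff by blast
    then show "g \<in> ?F" using f g le S_sim0_downD unfolding sim_maps_def by blast
  next
    fix H h assume H: "directed_in ?G H" and h: "h \<in> scott_maps ?D S_ground"
      and lub: "\<And>x. x \<in> elems ?D \<Longrightarrow> is_lub_in S_ground ((\<lambda>f. f x) ` H) (h x)"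
    have HF: "H \<subseteq> ?F" using H unfolding directed_in_def by simp
    have Hd: "directed_in S_ground ((\<lambda>f. f x) ` H)" if x: "x \<in> elems ?D" for x
    proof (rule directed_image[OF H])
      show "(\<lambda>f. f x) ` elems ?G \<subseteq> elems S_ground"
        using x sim_maps_subset[of ?D ?R] unfolding raw_fun_simps by (auto simp: iff subset_iff)
    qed (use x in simp)
    have "S_sim0 (h x1) (h x2)" if x: "x1 \<in> elems ?D" "x2 \<in> elems ?D" "?R x1 x2" for x1 x2
    proof (rule S_sim0_lub[OF Hd[OF x(1)] lub[OF x(1)] Hd[OF x(2)] lub[OF x(2)]])
      fix a b assume "a \<in> (\<lambda>f. f x1) ` H" "b \<in> (\<lambda>f. f x2) ` H"
      then obtain f g where fg: "f \<in> H" "g \<in> H" "a = f x1" "b = g x2" by blast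
      then obtain e where e: "e \<in> H" "below ?G f e" "below ?G g e"
        using H unfolding directed_in_def by blast
      have "S_sim0 (e x1) (e x2)" using e HF x unfolding sim_maps_def by blast
      then show "\<exists>a' b'. S_sim0 a' b' \<and> below S_ground a a' \<and> below S_ground b b'"
        using e fg x by auto
    qed
    then show "h \<in> ?F" using h unfolding sim_maps_def by blast
  qed
  then show ?case
    using omega_algebraic_fun_ordset[OF Suc omega_algebraic_S_ground sim_maps_subset]
    by (simp add: S_dom_Suc)
qed

theorem bij_betw_S_app:
  "bij_betw (S_app k) (elems (S_dom (Suc k)))
     {f \<in> scott_maps (S_dom k) (S_dom 0).
        \<forall>x1\<in>elems (S_dom k). \<forall>x2\<in>elems (S_dom k). S_sim k x1 x2 \<longrightarrow> S_sim0 (f x1) (f x2)}"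
  using fun_ordset_coding(2)[OF omega_algebraic_S_dom omega_algebraic_S_ground sim_maps_subset, of k "S_sim k"]
  by (simp add: S_app_def S_dom_Suc S_dom_0 sim_maps_def)

end

theory Submission
  imports Defs
begin

text \<open>
  An element \<open>z\<close> of \<open>S(k+1)\<close> is observed through the reals \<open>z(\<pi>\<^sub>k(c))\<close>, where \<open>c\<close> ranges over
  finite sets of tables \<open>grid k n\<close> of total elements of \<open>N(k)\<close>.  Rounding these reals at random to
  neighbouring natural numbers gives a random table in \<open>N(k+1)\<close>, and \<open>g\<^sub>n(z)\<close> is the mean of the
  values of \<open>x \<in> N(k+2)\<close> on it.  If all the observed reals are natural numbers, then by density \<open>z\<close>
  agrees on the image of \<open>\<pi>\<^sub>k\<close> with a total element \<open>y\<close> of \<open>N(k+1)\<close>, and \<open>g\<^sub>n(z) = x(y)\<close> for all large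
  \<open>n\<close>.  Otherwise some observed real has positive distance from the natural numbers, and the steps
  from \<open>g\<^sub>n\<close> to \<open>g\<^sub>n\<^sub>+\<^sub>1\<close> are damped by factors that vanish for large \<open>n\<close>.  In both cases the damped
  sequence becomes constant, and this is witnessed on a neighbourhood of \<open>(x, z)\<close>; its limit is
  \<open>\<pi>\<^sub>k\<^sub>+\<^sub>2(x)(z)\<close>.

  A signed digit name of the limit must depend continuously on \<open>x\<close> and \<open>z\<close> although the witness may
  appear at different times.  Therefore it is decided for each \<open>n\<close>, from prefixes of length \<open>n\<close> of
  the observed digit sequences alone, whether step \<open>n\<close> is the identity; the name used is the one
  computed for the term after the last step that is not.
\<close>

section \<open>The values of a digit sequence\<close>

text \<open>Rounding \<open>z\<close> to a single element of \<open>N(k+1)\<close> and applying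
  \<open>x\<close> to it cannot work: the reals are connected, so no map from them to the natural
  numbers that fixes the natural numbers is continuous. This is why the mean over all plausible
  roundings is taken. If some observed real is not natural, these means need not converge as the
  grids grow, since different tables can have unrelated values under \<open>x\<close>. The damping
  forces a limit there and leaves the natural case alone, where all factors are \<open>1\<close>.

  The limit must depend on the observed reals and not on their names, and it must respect \<sim> on
  partial elements as well. Therefore the terms are functions of real coordinates. That the stage is
  selected by looking at names does no harm: from that stage on, all terms have the same value at
  every point compatible with the names.

  Only \<pi> of index \<open>k\<close> enters the construction for \<open>k + 2\<close>. The map of
  index \<open>k + 1\<close> enters through the claim that the image of \<open>y\<close>, observed
  along the first map, has the values of \<open>y\<close> as its coordinates.\<close>

definition vals :: "(nat \<rightharpoonup> int) \<Rightarrow> real set" where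
  "vals s = {seq_val m | m. m \<in> digit_seqs \<and> (\<forall>n. m n \<noteq> None) \<and> s \<subseteq>\<^sub>m m}"

lemma vals_antimono: "s \<subseteq>\<^sub>m t \<Longrightarrow> vals t \<subseteq> vals s"
  unfolding vals_def by (blast intro: map_le_trans)

lemma vals_restrict_antimono: "m \<le> n \<Longrightarrow> vals (s |` {..<n}) \<subseteq> vals (s |` {..<m})"
  by (rule vals_antimono, rule map_leI) (auto simp: restrict_map_def split: if_splits)

lemma vals_subset_restrict: "vals s \<subseteq> vals (s |` A)"
  by (rule vals_antimono) (rule restrict_map_le)

lemma seq_sim_iff_vals: "seq_sim s t \<longleftrightarrow> vals s \<inter> vals t \<noteq> {}"
  unfolding seq_sim_def vals_def by (auto; metis)

lemma S_sim0_iff_vals: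
  "S_sim0 (Ground s) (Ground t) \<longleftrightarrow> s \<in> digit_seqs \<and> t \<in> digit_seqs \<and> vals s \<inter> vals t \<noteq> {}"
  by (simp add: S_sim0_Ground seq_sim_iff_vals)

lemma vals_total:
  assumes "s \<in> digit_seqs" "\<And>n. s n \<noteq> None"
  shows "vals s = {seq_val s}"
proof -
  have "m = s" if "s \<subseteq>\<^sub>m m" for m
  proof
    fix n show "m n = s n" using that assms(2)[of n] map_le_SomeD[OF that] by fastforce
  qed
  then show ?thesis using assms unfolding vals_def by auto
qed

text \<open>The tail bound gives one inclusion; the other holds because the remaining signed digits
  reach every point of the interval.\<close>

lemma vals_finite_seq:
  assumes s: "s \<in> digit_seqs" and L: "\<And>n. n \<le> L \<Longrightarrow> s n \<noteq> None" "s (Suc L) = None"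
  shows "vals s = {r. \<bar>r - seq_part L s\<bar> \<le> 1 / 2 ^ L}"
proof (intro set_eqI iffI)
  fix r assume "r \<in> vals s"
  then obtain m where m: "m \<in> digit_seqs" "\<And>n. m n \<noteq> None" "s \<subseteq>\<^sub>m m" "r = seq_val m"
    unfolding vals_def by blast
  have "seq_part L m = seq_part L s"
  proof (rule seq_part_cong)
    fix n assume "n \<le> L" then show "m n = s n" using L(1)[of n] map_le_SomeD[OF m(3)] by fastforce
  qed
  then show "r \<in> {r. \<bar>r - seq_part L s\<bar> \<le> 1 / 2 ^ L}" using seq_val_bound(2)[OF m(1,2), of L] m(4) by simp
next
  fix r assume "r \<in> {r. \<bar>r - seq_part L s\<bar> \<le> 1 / 2 ^ L}"
  then obtain m where "m \<in> digit_seqs" "\<forall>n. m n \<noteq> None" "s \<subseteq>\<^sub>m m" "seq_val m = r"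
    using extend_to_value[OF s L] by blast
  then show "r \<in> vals s" unfolding vals_def by blast
qed

lemma vals_empty: "vals Map.empty = UNIV"
proof (intro set_eqI iffI UNIV_I)
  fix r :: real
  let ?t = "list_seq [\<lfloor>r\<rfloor>]"
  have "?t \<in> digit_seqs" by (auto simp: digit_seqs_def list_seq_def)
  moreover have "\<bar>r - seq_part 0 ?t\<bar> \<le> 1 / 2 ^ 0" by (simp add: seq_part_def list_seq_def) linarith
  ultimately have "r \<in> vals ?t" using vals_finite_seq[of ?t 0] by (simp add: list_seq_def)
  then show "r \<in> vals Map.empty" using vals_antimono[of Map.empty ?t] by auto
qed

text \<open>A total name \<open>u\<close> of \<open>r\<close> has \<open>vals u = {r}\<close>, so
  membership of \<open>r\<close> is similarity to \<open>u\<close>, which is closed by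
  \<open>seq_sim_closed\<close>.\<close>

lemma vals_closed:
  assumes s: "s \<in> digit_seqs" and r: "\<And>n. r \<in> vals (s |` {..<n})"
  shows "r \<in> vals s"
proof -
  obtain u where u: "u \<in> digit_seqs" "\<And>n. u n \<noteq> None" "seq_val u = r"
    using r[of 0] unfolding vals_def by blast
  have vu: "vals u = {r}" using vals_total[OF u(1,2)] u(3) by simp
  have "seq_sim (u |` {..<n}) (s |` {..<n})" for n
    using r[of n] vu vals_subset_restrict[of u] by (fastforce simp: seq_sim_iff_vals)
  then have "seq_sim u s" by (rule seq_sim_closed[OF u(1) s])
  then show ?thesis using vu by (simp add: seq_sim_iff_vals)
qed

lemma vals_nonempty: "s \<in> digit_seqs \<Longrightarrow> vals s \<noteq> {}"
proof -
  assume s: "s \<in> digit_seqs"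
  define t where "t n = (case s n of None \<Rightarrow> Some 0 | Some v \<Rightarrow> Some v)" for n
  have "t \<in> digit_seqs" using s unfolding digit_seqs_def t_def by (auto split: option.splits)
  moreover have "s \<subseteq>\<^sub>m t" by (rule map_leI) (simp add: t_def)
  moreover have "\<forall>n. t n \<noteq> None" unfolding t_def by (auto split: option.splits)
  ultimately show ?thesis unfolding vals_def by blast
qed

lemma vals_prefix_dist:
  assumes s: "s \<in> digit_seqs" "\<And>n. s n \<noteq> None" and r: "r \<in> vals (s |` {..<Suc L})"
  shows "\<bar>r - seq_val s\<bar> \<le> 2 / 2 ^ L"
proof -
  let ?t = "s |` {..<Suc L}"
  have "vals ?t = {r. \<bar>r - seq_part L ?t\<bar> \<le> 1 / 2 ^ L}"
    by (rule vals_finite_seq[OF restrict_digit_seqs[OF s(1)]]) (use s(2) in \<open>auto simp: restrict_map_def\<close>)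
  moreover have "seq_val s \<in> vals ?t" using vals_subset_restrict vals_total[OF s] by blast
  ultimately show ?thesis using r by auto
qed

lemma vals_prefix_tendsto:
  assumes s: "s \<in> digit_seqs" "\<And>n. s n \<noteq> None" and r: "\<And>j. r j \<in> vals (s |` {..<j})"
  shows "r \<longlonglongrightarrow> seq_val s"
proof -
  have "(\<lambda>L. r (Suc L) - seq_val s) \<longlonglongrightarrow> 0"
  proof (rule Lim_null_comparison)
    show "\<forall>\<^sub>F L in sequentially. norm (r (Suc L) - seq_val s) \<le> 2 * (1/2) ^ L"
      using vals_prefix_dist[OF s r] by (simp add: power_one_over)
    have "(\<lambda>L. 2 * (1/2) ^ L :: real) \<longlonglongrightarrow> 2 * 0" by (intro tendsto_mult tendsto_const LIMSEQ_power_zero) simp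
    then show "(\<lambda>L. 2 * (1/2) ^ L :: real) \<longlonglongrightarrow> 0" by simp
  qed
  then show ?thesis by (simp add: LIM_zero_iff filterlim_sequentially_Suc)
qed

lemma open_vals_prefix:
  assumes s: "s \<in> digit_seqs" "\<And>n. s n \<noteq> None" and A: "open A" "seq_val s \<in> A"
  shows "\<exists>j. vals (s |` {..<j}) \<subseteq> A"
proof (rule ccontr)
  assume "\<not> ?thesis"
  then have "\<forall>j. \<exists>r. r \<in> vals (s |` {..<j}) \<and> r \<notin> A" by blast
  then obtain r where r: "\<And>j. r j \<in> vals (s |` {..<j})" "\<And>j. r j \<notin> A" by metis
  show False using topological_tendstoD[OF vals_prefix_tendsto[OF s r(1)] A] r(2) by simp
qed

section \<open>Prolonging a name by one digit\<close>

lemma list_seq_snoc_digit: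
  assumes "list_seq l \<in> digit_seqs" "l = [] \<or> b \<in> {-1, 0, 1}"
  shows "list_seq (l @ [b]) \<in> digit_seqs"
  using assms by (auto simp: digit_seqs_def list_seq_def nth_append split: if_splits)

text \<open>The three subintervals that a further digit can select have half the radius, and
  neighbouring ones overlap. A set that is small compared with the overlap therefore fits into one
  of them.\<close>

lemma refine_digit:
  assumes l: "list_seq l \<in> digit_seqs" and K: "K \<subseteq> vals (list_seq l)"
    and small: "\<And>u v. u \<in> K \<Longrightarrow> v \<in> K \<Longrightarrow> \<bar>u - v\<bar> \<le> 1 / 2 ^ Suc (length l)"
  shows "\<exists>b. list_seq (l @ [b]) \<in> digit_seqs \<and> K \<subseteq> vals (list_seq (l @ [b]))"
proof (cases "K = {}")
  case True
  then show ?thesis using list_seq_snoc_digit[OF l, of 0] by auto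
next
  case False
  then obtain u where u: "u \<in> K" by blast
  have vs: "vals (list_seq (l @ [b])) = {r. \<bar>r - seq_part (length l) (list_seq (l @ [b]))\<bar> \<le> 1 / 2 ^ length l}"
    if "list_seq (l @ [b]) \<in> digit_seqs" for b
    by (rule vals_finite_seq[OF that]) (auto simp: list_seq_def)
  show ?thesis
  proof (cases l rule: rev_cases)
    case Nil
    have d: "list_seq (l @ [round u]) \<in> digit_seqs" using list_seq_snoc_digit[OF l] Nil by simp
    have "seq_part 0 (list_seq [round u]) = of_int (round u)" by (simp add: seq_part_def list_seq_def)
    moreover have "\<bar>of_int (round u) - u\<bar> \<le> 1/2" by (rule of_int_round_abs_le)
    ultimately have "\<bar>v - seq_part 0 (list_seq [round u])\<bar> \<le> 1" if "v \<in> K" for v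
      using small[OF that u] Nil by (simp add: abs_if split: if_splits)
    then have "K \<subseteq> vals (list_seq (l @ [round u]))" unfolding vs[OF d] using Nil by auto
    then show ?thesis using d by blast
  next
    case (snoc l' a)
    define L where "L = length l'"
    define p where "p = seq_part L (list_seq l)"
    have Kp: "\<bar>v - p\<bar> \<le> 1 / 2 ^ L" if "v \<in> K" for v
    proof -
      have "vals (list_seq l) = {r. \<bar>r - p\<bar> \<le> 1 / 2 ^ L}"
        unfolding p_def by (rule vals_finite_seq[OF l]) (auto simp: list_seq_def snoc L_def)
      then show ?thesis using K that by blast
    qed
    have Ku: "\<bar>v - u\<bar> \<le> 1 / 2 ^ L / 4" if "v \<in> K" for v using small[OF that u] by (simp add: snoc L_def)
    have part: "seq_part (Suc L) (list_seq (l @ [b])) = p + of_int b / 2 ^ L / 2" for b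
    proof -
      have "seq_part L (list_seq (l @ [b])) = p"
        unfolding p_def by (rule seq_part_cong) (simp add: list_seq_def snoc L_def nth_append)
      moreover have "the (list_seq (l @ [b]) (Suc L)) = b"
        by (simp add: list_seq_def snoc L_def nth_append)
      ultimately show ?thesis by (simp add: seq_part_def)
    qed
    \<comment> \<open>If \<open>u\<close> is within a quarter radius of the centre, all of
      \<open>K\<close> is within half a radius of it. Otherwise the distance of \<open>u\<close>
      from \<open>p\<close> exceeds the bound on the diameter, so \<open>K\<close> lies entirely on
      the side of \<open>u\<close>.\<close>
    define b :: int where "b = (if \<bar>u - p\<bar> \<le> 1 / 2 ^ L / 4 then 0 else if u > p then 1 else -1)"
    have d: "list_seq (l @ [b]) \<in> digit_seqs" using list_seq_snoc_digit[OF l] by (simp add: b_def)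
    have "\<bar>v - (p + of_int b / 2 ^ L / 2)\<bar> \<le> 1 / 2 ^ L / 2" if "v \<in> K" for v
    proof -
      define \<epsilon> :: real where "\<epsilon> = 1 / 2 ^ L"
      have "of_int b / 2 ^ L / 2 = of_int b * \<epsilon> / 2" by (simp add: \<epsilon>_def)
      moreover have "\<bar>v - (p + of_int b * \<epsilon> / 2)\<bar> \<le> \<epsilon> / 2"
        using Kp[OF that] Ku[OF that] Kp[OF u] unfolding b_def \<epsilon>_def[symmetric] by (auto simp: abs_if split: if_splits)
      ultimately show ?thesis by (simp only: \<epsilon>_def[symmetric])
    qed
    moreover have "length l = Suc L" by (simp add: snoc L_def)
    ultimately have "K \<subseteq> vals (list_seq (l @ [b]))" unfolding vs[OF d] by (auto simp: part mult.commute)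
    then show ?thesis using d by blast
  qed
qed

section \<open>Naming the value of a continuous function\<close>

text \<open>As nothing is required of the coordinates outside \<open>C\<close>, constant sequences show that \<open>\<Gamma>\<close> ignores them.\<close>

definition coord_cont :: "'i set \<Rightarrow> (('i \<Rightarrow> real) \<Rightarrow> real) \<Rightarrow> bool" where
  "coord_cont C \<Gamma> \<longleftrightarrow>
     (\<forall>R r. (\<forall>c\<in>C. (\<lambda>j. R j c) \<longlonglongrightarrow> r c) \<longrightarrow> (\<lambda>j::nat. \<Gamma> (R j)) \<longlonglongrightarrow> \<Gamma> r)"

definition prefix_box :: "'i set \<Rightarrow> nat \<Rightarrow> ('i \<Rightarrow> (nat \<rightharpoonup> int)) \<Rightarrow> ('i \<Rightarrow> real) set" where
  "prefix_box C j s = {r. \<forall>c\<in>C. r c \<in> vals (s c |` {..<j})}"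

definition digit_ok :: "'i set \<Rightarrow> (('i \<Rightarrow> real) \<Rightarrow> real) \<Rightarrow> ('i \<Rightarrow> (nat \<rightharpoonup> int)) \<Rightarrow> nat \<Rightarrow> int list \<Rightarrow> int \<Rightarrow> bool"
  where "digit_ok C \<Gamma> s j l b \<longleftrightarrow>
    list_seq (l @ [b]) \<in> digit_seqs \<and> \<Gamma> ` prefix_box C j s \<subseteq> vals (list_seq (l @ [b]))"

primrec emit :: "'i set \<Rightarrow> (('i \<Rightarrow> real) \<Rightarrow> real) \<Rightarrow> ('i \<Rightarrow> (nat \<rightharpoonup> int)) \<Rightarrow> nat \<Rightarrow> int list" where
  "emit C \<Gamma> s 0 = []"
| "emit C \<Gamma> s (Suc j) = emit C \<Gamma> s j @
     (if \<exists>b. digit_ok C \<Gamma> s j (emit C \<Gamma> s j) b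
      then [SOME b. digit_ok C \<Gamma> s j (emit C \<Gamma> s j) b] else [])"

text \<open>Guards the output. While a digit is missing, the box of a stage can still shrink, and
  the stage may then emit a digit where it emitted none, or a different one. Once these digits are
  present, the output up to stage \<open>j\<close> is frozen.\<close>

definition avail :: "'i set \<Rightarrow> ('i \<Rightarrow> (nat \<rightharpoonup> int)) \<Rightarrow> nat \<Rightarrow> bool" where
  "avail C s j \<longleftrightarrow> (\<forall>c\<in>C. \<forall>i<j. s c i \<noteq> None)"

text \<open>
  The digits are read off the nested sets \<open>\<Gamma> ` prefix_box C j s\<close> in a fixed order, one stage \<open>j\<close> after
  the other, so that more information on \<open>s\<close> only prolongs the output.
\<close>

definition name_of :: "'i set \<Rightarrow> (('i \<Rightarrow> real) \<Rightarrow> real) \<Rightarrow> ('i \<Rightarrow> (nat \<rightharpoonup> int)) \<Rightarrow> (nat \<rightharpoonup> int)" where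
  "name_of C \<Gamma> s p =
     (if \<exists>j. avail C s j \<and> p < length (emit C \<Gamma> s j)
      then Some (emit C \<Gamma> s (LEAST j. p < length (emit C \<Gamma> s j)) ! p) else None)"

lemma prefix_box_antimono: "i \<le> j \<Longrightarrow> prefix_box C j s \<subseteq> prefix_box C i s"
  unfolding prefix_box_def using vals_restrict_antimono by blast

lemma emit_prefix: "i \<le> j \<Longrightarrow> \<exists>l. emit C \<Gamma> s j = emit C \<Gamma> s i @ l"
proof (induction j)
  case (Suc j)
  then show ?case by (cases "i = Suc j") (auto simp: le_Suc_eq)
qed simp

lemma emit_nth:
  assumes "p < length (emit C \<Gamma> s i)" "p < length (emit C \<Gamma> s j)"
  shows "emit C \<Gamma> s i ! p = emit C \<Gamma> s j ! p"
proof -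
  have "emit C \<Gamma> s i ! p = emit C \<Gamma> s j ! p"
    if "i \<le> j" "p < length (emit C \<Gamma> s i)" for i j
    using emit_prefix[OF that(1), of C \<Gamma> s] that(2) by (auto simp: nth_append)
  then show ?thesis using assms by (metis nat_le_linear)
qed

text \<open>By \<open>emit_nth\<close> the digit is the same at every stage that supplies it, so any
  witness can replace the \<open>LEAST\<close> of the definition.\<close>

lemma name_of_Some_iff:
  "name_of C \<Gamma> s p = Some v \<longleftrightarrow>
     (\<exists>j. avail C s j \<and> p < length (emit C \<Gamma> s j) \<and> emit C \<Gamma> s j ! p = v)" (is "?L \<longleftrightarrow> ?R")
proof -
  have *: "emit C \<Gamma> s (LEAST j. p < length (emit C \<Gamma> s j)) ! p = emit C \<Gamma> s j ! p"
    if "p < length (emit C \<Gamma> s j)" for j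
    by (rule emit_nth[OF LeastI[of "\<lambda>j. p < length (emit C \<Gamma> s j)", OF that] that])
  then show ?thesis unfolding name_of_def by (auto split: if_splits)
qed

lemma emit_correct:
  "list_seq (emit C \<Gamma> s j) \<in> digit_seqs \<and> \<Gamma> ` prefix_box C j s \<subseteq> vals (list_seq (emit C \<Gamma> s j))"
proof (induction j)
  case 0
  have "list_seq [] = Map.empty" by (auto simp: list_seq_def)
  then show ?case by (simp add: vals_empty digit_seqs_def)
next
  case (Suc j)
  let ?l = "emit C \<Gamma> s j"
  have sub: "\<Gamma> ` prefix_box C (Suc j) s \<subseteq> \<Gamma> ` prefix_box C j s" using prefix_box_antimono[of j "Suc j" C s] by auto
  show ?case
  proof (cases "\<exists>b. digit_ok C \<Gamma> s j ?l b")
    case True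
    then have "digit_ok C \<Gamma> s j ?l (SOME b. digit_ok C \<Gamma> s j ?l b)" by (rule someI_ex)
    then have "list_seq (emit C \<Gamma> s (Suc j)) \<in> digit_seqs"
      "\<Gamma> ` prefix_box C j s \<subseteq> vals (list_seq (emit C \<Gamma> s (Suc j)))"
      using True unfolding digit_ok_def[of C \<Gamma> s j ?l "SOME b. digit_ok C \<Gamma> s j ?l b"] by simp_all
    then show ?thesis using sub by blast
  next
    case False
    then show ?thesis using Suc sub by auto
  qed
qed

lemma name_of_in_digit_seqs: "name_of C \<Gamma> s \<in> digit_seqs"
  unfolding digit_seqs_def
proof (intro CollectI conjI allI impI)
  fix n assume n: "name_of C \<Gamma> s n = None"
  show "name_of C \<Gamma> s (Suc n) = None"
  proof (rule ccontr)
    assume "name_of C \<Gamma> s (Suc n) \<noteq> None"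
    then obtain j where "avail C s j" "Suc n < length (emit C \<Gamma> s j)" using name_of_Some_iff by blast
    then have "name_of C \<Gamma> s n = Some (emit C \<Gamma> s j ! n)"
      unfolding name_of_Some_iff by (intro exI[of _ j]) simp
    then show False using n by simp
  qed
next
  fix n b assume "name_of C \<Gamma> s (Suc n) = Some b"
  then obtain j where "Suc n < length (emit C \<Gamma> s j)" "emit C \<Gamma> s j ! Suc n = b"
    unfolding name_of_Some_iff by blast
  then have "list_seq (emit C \<Gamma> s j) (Suc n) = Some b" by (simp add: list_seq_def)
  then show "b \<in> {-1, 0, 1}" using emit_correct[of C \<Gamma> s j] unfolding digit_seqs_def by blast
qed

lemma emit_local:
  assumes "\<And>c i. c \<in> C \<Longrightarrow> i < j \<Longrightarrow> s c i = s' c i"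
  shows "emit C \<Gamma> s j = emit C \<Gamma> s' j"
  using assms
proof (induction j)
  case (Suc j)
  have "s c |` {..<j} = s' c |` {..<j}" if "c \<in> C" for c
    using Suc.prems[OF that] by (auto simp: restrict_map_def fun_eq_iff)
  then have "prefix_box C j s = prefix_box C j s'" by (simp add: prefix_box_def)
  then have "digit_ok C \<Gamma> s j = digit_ok C \<Gamma> s' j" by (simp add: digit_ok_def fun_eq_iff)
  then show ?case using Suc by simp
qed simp

lemma name_of_local:
  assumes "avail C s j" "p < length (emit C \<Gamma> s j)" "\<And>c i. c \<in> C \<Longrightarrow> i < j \<Longrightarrow> s' c i = s c i"
  shows "name_of C \<Gamma> s' p = name_of C \<Gamma> s p"
proof -
  have "emit C \<Gamma> s' j = emit C \<Gamma> s j" by (rule emit_local) (rule assms(3))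
  moreover have "avail C s' j" using assms(1,3) by (simp add: avail_def)
  ultimately have "name_of C \<Gamma> s' p = Some (emit C \<Gamma> s j ! p)" "name_of C \<Gamma> s p = Some (emit C \<Gamma> s j ! p)"
    using assms(1,2) unfolding name_of_Some_iff by auto
  then show ?thesis by simp
qed

text \<open>Every finite part of the name is contained in the output of a single stage, whose
  interval covers the image of the whole box; \<open>vals_closed\<close> does the rest. The
  sequences may be partial, as compatibility with \<open>S_sim\<close> demands.\<close>

lemma name_of_vals:
  assumes r: "\<And>c. c \<in> C \<Longrightarrow> r c \<in> vals (s c)"
  shows "\<Gamma> r \<in> vals (name_of C \<Gamma> s)"
proof (rule vals_closed[OF name_of_in_digit_seqs])
  fix p
  have rb: "r \<in> prefix_box C j s" for j using r vals_subset_restrict unfolding prefix_box_def by blast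
  have "\<exists>j. avail C s j \<and> name_of C \<Gamma> s |` {..<p} \<subseteq>\<^sub>m list_seq (emit C \<Gamma> s j)"
  proof (induction p)
    case 0
    then show ?case by (intro exI[of _ 0]) (simp add: avail_def)
  next
    case (Suc p)
    then obtain i where i: "avail C s i" "name_of C \<Gamma> s |` {..<p} \<subseteq>\<^sub>m list_seq (emit C \<Gamma> s i)" by blast
    show ?case
    proof (cases "name_of C \<Gamma> s p")
      case None
      then have "name_of C \<Gamma> s |` {..<Suc p} = name_of C \<Gamma> s |` {..<p}"
        by (auto simp: restrict_map_def fun_eq_iff less_Suc_eq)
      then show ?thesis using i by auto
    next
      case (Some v)
      then obtain j where j: "avail C s j" "p < length (emit C \<Gamma> s j)" "emit C \<Gamma> s j ! p = v"
        unfolding name_of_Some_iff by blast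
      have "list_seq (emit C \<Gamma> s j) q = Some w" if q: "(name_of C \<Gamma> s |` {..<Suc p}) q = Some w" for q w
      proof -
        have "q \<le> p" "name_of C \<Gamma> s q = Some w" using q by (auto simp: restrict_map_def split: if_splits)
        moreover from this obtain j' where "q < length (emit C \<Gamma> s j')" "emit C \<Gamma> s j' ! q = w"
          unfolding name_of_Some_iff by blast
        ultimately show ?thesis using emit_nth[of q C \<Gamma> s j j'] j(2) by (simp add: list_seq_def)
      qed
      then show ?thesis using j(1) by (blast intro: map_leI)
    qed
  qed
  then obtain j where j: "name_of C \<Gamma> s |` {..<p} \<subseteq>\<^sub>m list_seq (emit C \<Gamma> s j)" by blast
  then show "\<Gamma> r \<in> vals (name_of C \<Gamma> s |` {..<p})"
    using emit_correct[of C \<Gamma> s j] rb[of j] vals_antimono[OF j] by blast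
qed

text \<open>Points chosen from the shrinking boxes converge to the point named by \<open>s\<close>,
  so a lasting oscillation would contradict sequential continuity. The bound \<open>i\<close> allows
  the caller to go on from a stage already reached.\<close>

lemma coord_cont_box_small:
  assumes \<Gamma>: "coord_cont C \<Gamma>" and s: "\<And>c. c \<in> C \<Longrightarrow> s c \<in> digit_seqs" "\<And>c n. c \<in> C \<Longrightarrow> s c n \<noteq> None"
    and d: "d > 0"
  shows "\<exists>j\<ge>i. \<forall>u\<in>prefix_box C j s. \<forall>v\<in>prefix_box C j s. \<bar>\<Gamma> u - \<Gamma> v\<bar> \<le> d"
proof (rule ccontr)
  assume n: "\<not> ?thesis"
  have "\<forall>j. \<exists>u v. u \<in> prefix_box C j s \<and> v \<in> prefix_box C j s \<and> \<bar>\<Gamma> u - \<Gamma> v\<bar> > d"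
  proof
    fix j
    have "\<exists>u\<in>prefix_box C (max i j) s. \<exists>v\<in>prefix_box C (max i j) s. \<bar>\<Gamma> u - \<Gamma> v\<bar> > d"
      using n by (meson max.cobounded1 not_le)
    then show "\<exists>u v. u \<in> prefix_box C j s \<and> v \<in> prefix_box C j s \<and> \<bar>\<Gamma> u - \<Gamma> v\<bar> > d"
      using prefix_box_antimono[of j "max i j" C s] by auto
  qed
  then obtain U V where UV: "\<And>j. U j \<in> prefix_box C j s" "\<And>j. V j \<in> prefix_box C j s" "\<And>j. \<bar>\<Gamma> (U j) - \<Gamma> (V j)\<bar> > d"
    by metis
  have lim: "(\<lambda>j. \<Gamma> (R j)) \<longlonglongrightarrow> \<Gamma> (\<lambda>c. seq_val (s c))" if "\<And>j. R j \<in> prefix_box C j s" for R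
  proof -
    have "(\<lambda>j. R j c) \<longlonglongrightarrow> seq_val (s c)" if c: "c \<in> C" for c
      by (rule vals_prefix_tendsto) (use s c \<open>\<And>j. R j \<in> prefix_box C j s\<close> in \<open>auto simp: prefix_box_def\<close>)
    then show ?thesis using \<Gamma>[unfolded coord_cont_def, rule_format, of R "\<lambda>c. seq_val (s c)"] by blast
  qed
  have "(\<lambda>j. \<bar>\<Gamma> (U j) - \<Gamma> (V j)\<bar>) \<longlonglongrightarrow> 0"
    using tendsto_rabs[OF tendsto_diff[OF lim[OF UV(1)] lim[OF UV(2)]]] by simp
  then have "\<forall>\<^sub>F j in sequentially. \<bar>\<Gamma> (U j) - \<Gamma> (V j)\<bar> < d" using d order_tendstoD(2) by blast
  then obtain j where "\<bar>\<Gamma> (U j) - \<Gamma> (V j)\<bar> < d" by (auto simp: eventually_sequentially)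
  then show False using UV(3)[of j] by simp
qed

text \<open>The output cannot stop at length \<open>n\<close>: at a stage where the oscillation is
  at most \<open>1 / 2 ^ Suc n\<close>, \<open>refine_digit\<close> supplies another digit.\<close>

lemma name_of_total:
  assumes \<Gamma>: "coord_cont C \<Gamma>" and s: "\<And>c. c \<in> C \<Longrightarrow> s c \<in> digit_seqs" "\<And>c n. c \<in> C \<Longrightarrow> s c n \<noteq> None"
  shows "name_of C \<Gamma> s p \<noteq> None"
proof -
  have "\<exists>j. n \<le> length (emit C \<Gamma> s j)" for n
  proof (induction n)
    case (Suc n)
    then obtain i where i: "n \<le> length (emit C \<Gamma> s i)" by blast
    obtain j where j: "j \<ge> i" and small: "\<forall>u\<in>prefix_box C j s. \<forall>v\<in>prefix_box C j s. \<bar>\<Gamma> u - \<Gamma> v\<bar> \<le> 1 / 2 ^ Suc n"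
      using coord_cont_box_small[of C \<Gamma> s "1 / 2 ^ Suc n" i] \<Gamma> s by auto
    have len: "n \<le> length (emit C \<Gamma> s j)" using emit_prefix[OF j, of C \<Gamma> s] i by auto
    show ?case
    proof (cases "length (emit C \<Gamma> s j) = n")
      case True
      have "\<exists>b. digit_ok C \<Gamma> s j (emit C \<Gamma> s j) b"
        unfolding digit_ok_def by (rule refine_digit) (use emit_correct[of C \<Gamma> s j] small True in auto)
      then have "Suc n \<le> length (emit C \<Gamma> s (Suc j))" using True by simp
      then show ?thesis by blast
    next
      case False
      then show ?thesis using len by (intro exI[of _ j]) simp
    qed
  qed simp
  then obtain j where "Suc p \<le> length (emit C \<Gamma> s j)" by blast
  moreover have "avail C s j" using s(2) by (simp add: avail_def)
  ultimately have "name_of C \<Gamma> s p = Some (emit C \<Gamma> s j ! p)" unfolding name_of_Some_iff by auto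
  then show ?thesis by simp
qed

section \<open>Interpolation of functions on tables\<close>

text \<open>A tent around \<open>v\<close>, evaluated at the real clamped to the range of the
  tables. Its half-width exceeds \<open>1/2\<close>, so some natural number always has positive
  weight. A real within \<open>1/4\<close> of \<open>v\<close> gives weight to \<open>v\<close>
  only, because \<open>1/4 + 3/4 = 1\<close>.\<close>

definition hat :: "nat \<Rightarrow> real \<Rightarrow> nat \<Rightarrow> real" where
  "hat n r v = max 0 (3/4 - \<bar>min (max r 0) (real n) - real v\<bar>)"

lemma hat_nonneg: "hat n r v \<ge> 0"
  by (simp add: hat_def)

lemma hat_pos_exists: "\<exists>v\<le>n. hat n r v > 0"
proof -
  define u where "u = min (max r 0) (real n)"
  have u: "0 \<le> u" "u \<le> real n" by (auto simp: u_def)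
  have "\<bar>of_int (round u) - u\<bar> \<le> 1/2" by (rule of_int_round_abs_le)
  moreover have "0 \<le> round u" "round u \<le> int n"
    using round_mono[OF u(1)] round_mono[OF u(2)] by simp_all
  ultimately have "nat (round u) \<le> n \<and> hat n r (nat (round u)) > 0"
    unfolding hat_def u_def[symmetric] by (auto simp: abs_if split: if_splits)
  then show ?thesis by blast
qed

lemma hat_pos_unique:
  assumes "\<bar>r - real v\<bar> \<le> 1/4" "v \<le> n" "hat n r w > 0"
  shows "w = v"
proof -
  have "\<bar>min (max r 0) (real n) - real v\<bar> \<le> 1/4"
    using assms(1,2) by (simp add: abs_if min_def max_def split: if_splits)
  moreover have "\<bar>min (max r 0) (real n) - real w\<bar> < 3/4" using assms(3) by (auto simp: hat_def less_max_iff_disj)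
  ultimately have "\<bar>real w - real v\<bar> < 1" by linarith
  then show ?thesis by linarith
qed

definition tables :: "'i set \<Rightarrow> nat \<Rightarrow> ('i \<Rightarrow> nat) set" where
  "tables C n = Pi\<^sub>E C (\<lambda>_. {..n})"

lemma finite_tables: "finite C \<Longrightarrow> finite (tables C n)"
  unfolding tables_def by (rule finite_PiE) auto

text \<open>Up to normalisation, the probability of \<open>t\<close> when the coordinates are
  rounded independently.\<close>

definition weight :: "'i set \<Rightarrow> nat \<Rightarrow> ('i \<Rightarrow> real) \<Rightarrow> ('i \<Rightarrow> nat) \<Rightarrow> real" where
  "weight C n r t = (\<Prod>c\<in>C. hat n (r c) (t c))"

definition avg :: "'i set \<Rightarrow> nat \<Rightarrow> (('i \<Rightarrow> nat) \<Rightarrow> real) \<Rightarrow> ('i \<Rightarrow> real) \<Rightarrow> real" where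
  "avg C n X r = (\<Sum>t\<in>tables C n. weight C n r t * X t) / (\<Sum>t\<in>tables C n. weight C n r t)"

lemma sum_weight_pos:
  assumes "finite C"
  shows "(\<Sum>t\<in>tables C n. weight C n r t) > 0"
proof -
  have "\<forall>c. \<exists>v. v \<le> n \<and> hat n (r c) v > 0" using hat_pos_exists by blast
  then obtain v where v: "\<And>c. v c \<le> n \<and> hat n (r c) (v c) > 0" by metis
  have "restrict v C \<in> tables C n" using v by (auto simp: tables_def)
  moreover have "weight C n r (restrict v C) > 0" using v by (auto simp: weight_def intro!: prod_pos)
  moreover have "weight C n r t \<ge> 0" for t by (auto simp: weight_def hat_nonneg intro!: prod_nonneg)
  ultimately show ?thesis using finite_tables[OF assms] by (meson sum_pos2)
qed

lemma avg_const:
  assumes C: "finite C"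
    and X: "\<And>t. t \<in> tables C n \<Longrightarrow> (\<And>c. c \<in> C \<Longrightarrow> hat n (r c) (t c) > 0) \<Longrightarrow> X t = m"
  shows "avg C n X r = m"
proof -
  have "weight C n r t * X t = weight C n r t * m" if t: "t \<in> tables C n" for t
  proof (cases "\<forall>c\<in>C. hat n (r c) (t c) > 0")
    case True
    then show ?thesis using X[OF t] by simp
  next
    case False
    then have "weight C n r t = 0"
      unfolding weight_def using C hat_nonneg by (metis not_less order_antisym prod_zero)
    then show ?thesis by simp
  qed
  then have "(\<Sum>t\<in>tables C n. weight C n r t * X t) = (\<Sum>t\<in>tables C n. weight C n r t) * m"
    unfolding sum_distrib_right by (rule sum.cong[OF refl])
  then show ?thesis using sum_weight_pos[OF C, of n r] by (simp add: avg_def)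
qed

lemma avg_coord_cont: "finite C \<Longrightarrow> coord_cont C (avg C n X)"
  unfolding coord_cont_def
proof (intro allI impI)
  fix R :: "nat \<Rightarrow> 'a \<Rightarrow> real" and r
  assume C: "finite C" and R: "\<forall>c\<in>C. (\<lambda>j. R j c) \<longlonglongrightarrow> r c"
  have w: "(\<lambda>j. weight C n (R j) t) \<longlonglongrightarrow> weight C n r t" for t
    unfolding weight_def hat_def using R by (intro tendsto_intros) blast
  show "(\<lambda>j. avg C n X (R j)) \<longlonglongrightarrow> avg C n X r"
    unfolding avg_def using sum_weight_pos[OF C, of n r] by (intro tendsto_intros w) simp
qed

text \<open>Summing over all stages up to \<open>n\<close> lets one non-natural coordinate bound all
  later defects from below, so that the factor \<open>2 ^ n\<close> eventually wins.\<close>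

definition defect :: "(nat \<Rightarrow> 'i set) \<Rightarrow> nat \<Rightarrow> ('i \<Rightarrow> real) \<Rightarrow> real" where
  "defect C n r = (\<Sum>i\<le>n. \<Sum>c\<in>C i. infdist (r c) \<nat>)"

text \<open>
  The correction from \<open>avg (C n)\<close> to \<open>avg (C (Suc n))\<close> is damped by a factor that is \<open>1\<close> as long as
  all coordinates are natural numbers, and \<open>0\<close> from some \<open>n\<close> on if one of them is not.
\<close>

primrec interp :: "(nat \<Rightarrow> 'i set) \<Rightarrow> (nat \<Rightarrow> ('i \<Rightarrow> nat) \<Rightarrow> real) \<Rightarrow> nat \<Rightarrow> ('i \<Rightarrow> real) \<Rightarrow> real" where
  "interp C X 0 r = avg (C 0) 0 (X 0) r"
| "interp C X (Suc n) r = interp C X n r +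
     max 0 (1 - 2 ^ n * defect C n r) * (avg (C (Suc n)) (Suc n) (X (Suc n)) r - avg (C n) n (X n) r)"

lemma coord_cont_mono: "coord_cont C \<Gamma> \<Longrightarrow> C \<subseteq> C' \<Longrightarrow> coord_cont C' \<Gamma>"
  unfolding coord_cont_def by blast

lemma interp_coord_cont:
  assumes "\<And>n. finite (C n)"
  shows "coord_cont (\<Union>i\<le>n. C i) (interp C X n)"
proof (induction n)
  case 0
  then show ?case using avg_coord_cont[OF assms[of 0]] by (simp add: coord_cont_def)
next
  case (Suc n)
  let ?U = "\<Union>i\<le>Suc n. C i"
  have 1: "coord_cont ?U (interp C X n)" by (rule coord_cont_mono[OF Suc UN_mono]) auto
  have 2: "coord_cont ?U (avg (C m) m (X m))" if "m \<le> Suc n" for m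
    by (rule coord_cont_mono[OF avg_coord_cont[OF assms]]) (use that in auto)
  show ?case
    unfolding coord_cont_def interp.simps
  proof (intro allI impI tendsto_intros)
    fix R :: "nat \<Rightarrow> 'a \<Rightarrow> real" and r assume R: "\<forall>c\<in>?U. (\<lambda>j. R j c) \<longlonglongrightarrow> r c"
    show "(\<lambda>j. interp C X n (R j)) \<longlonglongrightarrow> interp C X n r"
      "(\<lambda>j. avg (C (Suc n)) (Suc n) (X (Suc n)) (R j)) \<longlonglongrightarrow> avg (C (Suc n)) (Suc n) (X (Suc n)) r"
      "(\<lambda>j. avg (C n) n (X n) (R j)) \<longlonglongrightarrow> avg (C n) n (X n) r"
      using R 1 2[of n] 2[of "Suc n"] unfolding coord_cont_def by auto
    show "(\<lambda>j. defect C n (R j)) \<longlonglongrightarrow> defect C n r"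
      unfolding defect_def
    proof (intro tendsto_sum tendsto_infdist)
      fix i c assume "i \<in> {..n}" "c \<in> C i"
      then show "(\<lambda>j. R j c) \<longlonglongrightarrow> r c" using R by (metis UN_I atMost_iff le_SucI)
    qed
  qed
qed

lemma interp_cong:
  assumes "\<And>i t. i \<le> n \<Longrightarrow> t \<in> tables (C i) i \<Longrightarrow> X i t = Y i t"
  shows "interp C X n = interp C Y n"
  using assms
proof (induction n)
  case 0
  then show ?case by (auto simp: avg_def fun_eq_iff intro!: arg_cong2[where f = "(/)"] sum.cong)
next
  case (Suc n)
  have "avg (C m) m (X m) = avg (C m) m (Y m)" if "m \<le> Suc n" for m
    using Suc.prems that by (auto simp: avg_def fun_eq_iff intro!: arg_cong2[where f = "(/)"] sum.cong)
  then show ?case using Suc by (simp add: fun_eq_iff)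
qed

text \<open>All damping factors are \<open>1\<close>, so the corrections telescope.\<close>

lemma interp_nat_coords:
  assumes "\<And>i c. i < n \<Longrightarrow> c \<in> C i \<Longrightarrow> r c \<in> \<nat>"
  shows "interp C X n r = avg (C n) n (X n) r"
proof (cases n)
  case (Suc m)
  have "interp C X i r = avg (C i) i (X i) r" if "i \<le> n" for i
    using that
  proof (induction i)
    case (Suc i)
    have "r c \<in> \<nat>" if "j \<le> i" "c \<in> C j" for j c using assms[of j c] Suc.prems that by simp
    then have "defect C i r = 0" unfolding defect_def by (auto intro!: sum.neutral infdist_zero)
    then show ?case using Suc by simp
  qed simp
  then show ?thesis by simp
qed simp

lemma interp_Suc_eq_of_avg:
  assumes "avg (C (Suc n)) (Suc n) (X (Suc n)) r = avg (C n) n (X n) r"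
  shows "interp C X (Suc n) r = interp C X n r"
  using assms by simp

lemma interp_Suc_eq_of_defect:
  assumes C: "\<And>i. finite (C i)" and c: "c \<in> C i" "i \<le> n" and d: "2 ^ n * infdist (r c) \<nat> \<ge> 1"
  shows "interp C X (Suc n) r = interp C X n r"
proof -
  have "infdist (r c) \<nat> \<le> (\<Sum>c\<in>C i. infdist (r c) \<nat>)"
    by (rule member_le_sum[OF c(1) _ C]) (auto simp: infdist_nonneg)
  also have "\<dots> \<le> defect C n r"
    unfolding defect_def by (rule member_le_sum) (use c in \<open>auto intro!: sum_nonneg simp: infdist_nonneg\<close>)
  finally have "2 ^ n * infdist (r c) \<nat> \<le> 2 ^ n * defect C n r" by simp
  then have "max 0 (1 - 2 ^ n * defect C n r) = 0" using d by linarith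
  then show ?thesis by simp
qed

section \<open>Scott continuity into the ground domains and the function spaces\<close>

lemma scott_continuous_mono:
  assumes "porder_on D" "porder_on E" "continuous_map (scott_topology D) (scott_topology E) f"
    "x \<in> elems D" "y \<in> elems D" "below D x y"
  shows "below E (f x) (f y)"
  by (rule lub_image_mono[OF assms(1,2) _ assms(4-6)]) (use assms(1-3) continuous_map_scott_iff in blast)

lemma open_upward:
  assumes "openin (scott_topology D) U" "x \<in> U" "y \<in> elems D" "below D x y"
  shows "y \<in> U"
  using assms unfolding openin_scott_topology scott_open_def by blast

lemmas porder_N_ground = omega_algebraic_N_ground[unfolded omega_algebraic_def, THEN conjunct1]
lemmas porder_S_ground = omega_algebraic_S_ground[unfolded omega_algebraic_def, THEN conjunct1]
lemmas porder_N_dom = omega_algebraic_N_dom[unfolded omega_algebraic_def, THEN conjunct1]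
lemmas porder_S_dom = omega_algebraic_S_dom[unfolded omega_algebraic_def, THEN conjunct1]

lemma N_ground_simps:
  "elems N_ground = range Ground" "below N_ground x y \<longleftrightarrow> x = Ground None \<or> x = y"
  by (simp_all add: N_ground_def)

lemma openin_N_ground: "openin (scott_topology N_ground) {Ground (Some v)}"
  unfolding openin_scott_topology scott_open_def
proof (intro conjI allI impI)
  fix X s assume X: "directed_in N_ground X" "is_lub_in N_ground X s" "s \<in> {Ground (Some v)}"
  obtain m where m: "m \<in> X" "\<forall>x\<in>X. below N_ground x m" using N_ground_directed[OF X(1)] by blast
  then have "below N_ground s m" using X unfolding is_lub_in_def directed_in_def by blast
  then show "X \<inter> {Ground (Some v)} \<noteq> {}" using X(3) m(1) by (auto simp: N_ground_simps)
qed (auto simp: N_ground_simps)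

text \<open>A Scott-open set that contains the bottom element is the whole domain; any other one is
  a union of singletons.\<close>

lemma continuous_map_N_ground_iff:
  "continuous_map (scott_topology D) (scott_topology N_ground) f \<longleftrightarrow>
     f ` elems D \<subseteq> elems N_ground \<and> (\<forall>v. openin (scott_topology D) {a \<in> elems D. f a = Ground (Some v)})"
    (is "?L \<longleftrightarrow> ?R")
proof
  assume L: ?L
  then have "f ` elems D \<subseteq> elems N_ground" by (auto simp: continuous_map_def topspace_scott_topology)
  then show ?R
    using openin_continuous_map_preimage[OF L openin_N_ground] by (simp add: topspace_scott_topology)
next
  assume R: ?R
  show ?L
    unfolding continuous_map_def topspace_scott_topology
  proof (intro conjI allI impI)
    show "f \<in> elems D \<rightarrow> elems N_ground" using R by auto
    fix U assume U: "openin (scott_topology N_ground) U"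
    show "openin (scott_topology D) {x \<in> elems D. f x \<in> U}"
    proof (cases "Ground None \<in> U")
      case True
      have "y \<in> U" if "y \<in> elems N_ground" for y
        by (rule open_upward[OF U True that]) (simp add: N_ground_simps)
      then have "{x \<in> elems D. f x \<in> U} = topspace (scott_topology D)"
        using R by (auto simp: topspace_scott_topology)
      then show ?thesis by (simp only: openin_topspace)
    next
      case False
      have "{x \<in> elems D. f x \<in> U} = (\<Union>v\<in>{v. Ground (Some v) \<in> U}. {a \<in> elems D. f a = Ground (Some v)})"
      proof (intro set_eqI iffI)
        fix x assume x: "x \<in> {x \<in> elems D. f x \<in> U}"
        then obtain w where "f x = Ground w" using R by (auto simp: N_ground_simps)
        then show "x \<in> (\<Union>v\<in>{v. Ground (Some v) \<in> U}. {a \<in> elems D. f a = Ground (Some v)})"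
          using x False by (cases w) auto
      qed auto
      moreover have "openin (scott_topology D) \<dots>" by (rule openin_Union) (use R in auto)
      ultimately show ?thesis by simp
    qed
  qed
qed

definition gval :: "'b obj \<Rightarrow> 'b" where
  "gval x = (case x of Ground b \<Rightarrow> b | Code _ \<Rightarrow> undefined)"

lemma gval_Ground [simp]: "gval (Ground b) = b"
  by (simp add: gval_def)

lemma S_ground_elemD: "x \<in> elems S_ground \<Longrightarrow> x = Ground (gval x) \<and> gval x \<in> digit_seqs"
  by (auto simp: S_ground_simps)

lemma S_ground_below_iff:
  "x \<in> elems S_ground \<Longrightarrow> y \<in> elems S_ground \<Longrightarrow> below S_ground x y \<longleftrightarrow> gval x \<subseteq>\<^sub>m gval y"
  by (auto simp: S_ground_simps)

lemma openin_S_ground: "openin (scott_topology S_ground) {x \<in> elems S_ground. gval x p = Some v}"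
  unfolding openin_scott_topology scott_open_def
proof (intro conjI allI impI)
  show "\<forall>x\<in>{x \<in> elems S_ground. gval x p = Some v}. \<forall>y\<in>elems S_ground. below S_ground x y
     \<longrightarrow> y \<in> {x \<in> elems S_ground. gval x p = Some v}"
    using S_ground_below_iff map_le_SomeD by auto
  fix X s assume X: "directed_in S_ground X" "is_lub_in S_ground X s" "s \<in> {x \<in> elems S_ground. gval x p = Some v}"
  obtain W where W: "W \<subseteq> digit_seqs" "X = Ground ` W"
    using X(1) unfolding directed_in_def S_ground_simps by (meson subset_imageE)
  obtain u where u: "u \<in> digit_seqs" "s = Ground u" using X(2) unfolding is_lub_in_def S_ground_simps by blast
  have W2: "W \<subseteq> elems seq_ordset" "u \<in> elems seq_ordset" using W u by auto
  have *: "directed_in seq_ordset W" "is_lub_in seq_ordset W u"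
    using X ordset_iso_image[OF Ground_iso W2(1)] W2(2) unfolding W(2) u(2) by auto
  then have "u = seq_sup W" using lub_unique[OF porder_seq _ seq_sup_lub] by blast
  then obtain w where "w \<in> W" "w p = Some v" using seq_sup_Some[OF *(1)] X(3) u(2) by auto
  then have "Ground w \<in> X \<inter> {x \<in> elems S_ground. gval x p = Some v}" using W by (auto simp: S_ground_simps)
  then show "X \<inter> {x \<in> elems S_ground. gval x p = Some v} \<noteq> {}" by blast
qed auto

text \<open>\<open>Ground s\<close> is the directed supremum of its finite prefixes, and a
  Scott-open set cannot be reached at the supremum only.\<close>

lemma prefix_in_open:
  assumes s: "s \<in> digit_seqs" and U: "openin (scott_topology S_ground) U" "Ground s \<in> U"
  shows "\<exists>n. Ground (s |` {..<n}) \<in> U"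
proof -
  let ?X = "range (\<lambda>n. Ground (s |` {..<n}))"
  have le: "s |` {..<m} \<subseteq>\<^sub>m s |` {..<n}" if "m \<le> n" for m n :: nat
    by (rule map_leI) (use that in \<open>auto simp: restrict_map_def split: if_splits\<close>)
  have "directed_in S_ground ?X"
    unfolding directed_in_def
  proof (intro conjI ballI)
    show "?X \<subseteq> elems S_ground" using restrict_digit_seqs[OF s] by (auto simp: S_ground_simps)
    fix x y assume "x \<in> ?X" "y \<in> ?X"
    then obtain m n where "x = Ground (s |` {..<m})" "y = Ground (s |` {..<n})" by blast
    then show "\<exists>z\<in>?X. below S_ground x z \<and> below S_ground y z"
      using le[of m "max m n"] le[of n "max m n"]
      by (intro bexI[of _ "Ground (s |` {..<max m n})"]) (auto simp: S_ground_simps)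
  qed auto
  moreover have "is_lub_in S_ground ?X (Ground s)"
    unfolding is_lub_in_def
  proof (intro conjI ballI impI)
    show "Ground s \<in> elems S_ground" using s by (simp add: S_ground_simps)
    show "below S_ground x (Ground s)" if "x \<in> ?X" for x
      using that restrict_map_le[of s] by (auto simp: S_ground_simps)
    fix u assume "u \<in> elems S_ground" and ub: "\<forall>x\<in>?X. below S_ground x u"
    then obtain t where t: "u = Ground t" by (auto simp: S_ground_simps)
    have "t n = Some v" if "s n = Some v" for n v
    proof (rule map_le_SomeD[of "s |` {..<Suc n}"])
      show "s |` {..<Suc n} \<subseteq>\<^sub>m t" using ub t by (auto simp: S_ground_simps)
      show "(s |` {..<Suc n}) n = Some v" using that by simp
    qed
    then show "below S_ground (Ground s) u" unfolding t by (simp add: S_ground_simps map_leI)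
  qed
  ultimately show ?thesis using U unfolding openin_scott_topology scott_open_def by blast
qed

text \<open>By \<open>prefix_in_open\<close>, membership in an open set is secured by finitely many
  digits, so continuity can be tested one digit at a time.\<close>

lemma continuous_map_S_ground_iff:
  "continuous_map (scott_topology D) (scott_topology S_ground) f \<longleftrightarrow>
     f ` elems D \<subseteq> elems S_ground \<and>
     (\<forall>p v. openin (scott_topology D) {a \<in> elems D. gval (f a) p = Some v})"
    (is "?L \<longleftrightarrow> ?R")
proof
  assume L: ?L
  then have im: "f ` elems D \<subseteq> elems S_ground" by (auto simp: continuous_map_def topspace_scott_topology)
  have "{a \<in> elems D. gval (f a) p = Some v} =
      {a \<in> topspace (scott_topology D). f a \<in> {x \<in> elems S_ground. gval x p = Some v}}" for p v
    using im by (auto simp: topspace_scott_topology)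
  then show ?R using im openin_continuous_map_preimage[OF L openin_S_ground] by simp
next
  assume R: ?R
  show ?L
    unfolding continuous_map_def topspace_scott_topology
  proof (intro conjI allI impI)
    show "f \<in> elems D \<rightarrow> elems S_ground" using R by auto
    fix U assume U: "openin (scott_topology S_ground) U"
    show "openin (scott_topology D) {x \<in> elems D. f x \<in> U}"
    proof (subst openin_subopen, intro ballI)
      fix x assume x: "x \<in> {x \<in> elems D. f x \<in> U}"
      define s where "s = gval (f x)"
      have s: "f x = Ground s" "s \<in> digit_seqs"
        unfolding s_def using S_ground_elemD[of "f x"] x R by auto
      obtain n where n: "Ground (s |` {..<n}) \<in> U" using prefix_in_open[OF s(2) U] s(1) x by auto
      define T where "T = (\<Inter>i\<in>{i. i < n \<and> s i \<noteq> None}. {a \<in> elems D. gval (f a) i = Some (the (s i))})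
        \<inter> topspace (scott_topology D)"
      have "openin (scott_topology D) T" unfolding T_def by (rule openin_INT) (use R in auto)
      moreover have "x \<in> T" using x unfolding T_def by (auto simp: topspace_scott_topology s)
      moreover have "T \<subseteq> {x \<in> elems D. f x \<in> U}"
      proof
        fix y assume y: "y \<in> T"
        then have yD: "y \<in> elems D" by (simp add: T_def topspace_scott_topology)
        have fy: "f y \<in> elems S_ground" using R yD by auto
        have "s |` {..<n} \<subseteq>\<^sub>m gval (f y)"
          by (rule map_leI) (use y in \<open>auto simp: T_def restrict_map_def split: if_splits\<close>)
        then have "below S_ground (Ground (s |` {..<n})) (f y)"
          using S_ground_elemD[OF fy] by (metis S_ground_simps(2))
        then have "f y \<in> U" using open_upward[OF U n fy] by blast
        then show "y \<in> {x \<in> elems D. f x \<in> U}" using yD by simp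
      qed
      ultimately show "\<exists>T. openin (scott_topology D) T \<and> x \<in> T \<and> T \<subseteq> {x \<in> elems D. f x \<in> U}" by blast
    qed
  qed
qed

lemma fun_ordset_simps:
  "elems (fun_ordset D E F) = encode F ` F"
  "below (fun_ordset D E F) u v \<longleftrightarrow> (\<forall>x\<in>elems D. below E (decode F u x) (decode F v x))"
  by (simp_all add: fun_ordset_def)

text \<open>The pointwise supremum \<open>h\<close> of \<open>X\<close> is Scott-continuous and lies
  in \<open>F\<close> by \<open>sup\<close>. Being an upper bound it dominates \<open>s\<close>, so
  evaluating \<open>s\<close> cannot exceed the pointwise supremum.\<close>

lemma fun_ordset_eval_lub:
  assumes D: "omega_algebraic D" and E: "omega_algebraic E" and F: "F \<subseteq> scott_maps D E"
    and sup: "\<And>H h. directed_in (raw_fun_ordset D E F) H \<Longrightarrow> h \<in> scott_maps D E \<Longrightarrow>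
                 (\<And>x. x \<in> elems D \<Longrightarrow> is_lub_in E ((\<lambda>f. f x) ` H) (h x)) \<Longrightarrow> h \<in> F"
    and X: "directed_in (fun_ordset D E F) X" "is_lub_in (fun_ordset D E F) X s" and a: "a \<in> elems D"
  shows "is_lub_in E ((\<lambda>u. decode F u a) ` X) (decode F s a)"
proof -
  have pD: "porder_on D" and pE: "porder_on E" using D E by (auto simp: omega_algebraic_def)
  note iff = scott_maps_iff[OF pD pE]
  note cod = fun_ordset_coding[OF D E F]
  let ?G = "fun_ordset D E F"
  have dF: "decode F u \<in> F" if "u \<in> elems ?G" for u using cod(2) that by (auto simp: bij_betw_def)
  have XG: "X \<subseteq> elems ?G" using X(1) by (simp add: directed_in_def)
  have FE: "f x \<in> elems E" if "f \<in> F" "x \<in> elems D" for f x using that F iff by blast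
  have Flub: "is_lub_in E (f ` Y) (f s)" if "f \<in> F" "directed_in D Y" "is_lub_in D Y s" for f Y s
    using that F iff by blast
  have Fmono: "below E (f x) (f y)" if "f \<in> F" "x \<in> elems D" "y \<in> elems D" "below D x y" for f x y
    using lub_image_mono[OF pD pE Flub[OF that(1)]] that by blast
  let ?H = "decode F ` X"
  have H: "directed_in (raw_fun_ordset D E F) ?H"
    by (rule directed_image[OF X(1)]) (use dF in \<open>auto simp: fun_ordset_simps\<close>)
  have HF: "?H \<subseteq> F" using dF XG by auto
  have dir: "directed_in E ((\<lambda>f. f x) ` ?H)" if "x \<in> elems D" for x
    by (rule directed_image[OF H]) (use that FE in auto)
  define h where "h = restrict (\<lambda>x. SOME l. is_lub_in E ((\<lambda>f. f x) ` ?H) l) (elems D)"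
  have h: "is_lub_in E ((\<lambda>f. f x) ` ?H) (h x)" if "x \<in> elems D" for x
  proof -
    have "\<exists>l. is_lub_in E ((\<lambda>f. f x) ` ?H) l" using dir[OF that] E unfolding omega_algebraic_def by blast
    then show ?thesis unfolding h_def using that by (simp add: someI_ex)
  qed
  have hE: "h x \<in> elems E" if "x \<in> elems D" for x using h[OF that] by (simp add: is_lub_in_def)
  have hub: "below E (f x) (h x)" if "f \<in> ?H" "x \<in> elems D" for f x
    using h[OF that(2)] that(1) unfolding is_lub_in_def by blast
  have hle: "below E (h x) w" if "x \<in> elems D" "w \<in> elems E" "\<And>f. f \<in> ?H \<Longrightarrow> below E (f x) w" for x w
    using h[OF that(1)] that unfolding is_lub_in_def by blast
  have "h \<in> scott_maps D E"
    unfolding iff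
  proof (intro conjI allI impI)
    show "h \<in> extensional (elems D)" by (simp add: h_def)
    show "h ` elems D \<subseteq> elems E" using hE by blast
    fix Y l assume Y: "directed_in D Y" "is_lub_in D Y l"
    have lD: "l \<in> elems D" and YD: "Y \<subseteq> elems D" and Yl: "\<And>y. y \<in> Y \<Longrightarrow> below D y l"
      using Y unfolding is_lub_in_def directed_in_def by auto
    show "is_lub_in E (h ` Y) (h l)"
      unfolding is_lub_in_def
    proof (intro conjI ballI impI)
      show "h l \<in> elems E" using hE lD .
      fix e assume "e \<in> h ` Y"
      then obtain y where y: "y \<in> Y" "e = h y" by blast
      have yD: "y \<in> elems D" using y YD by blast
      show "below E e (h l)"
        unfolding y(2)
      proof (rule hle[OF yD hE[OF lD]])
        fix f assume f: "f \<in> ?H"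
        then have fF: "f \<in> F" using HF by blast
        show "below E (f y) (h l)"
          using porder_trans[OF pE Fmono[OF fF yD lD Yl[OF y(1)]] hub[OF f lD]] FE[OF fF] yD lD hE by blast
      qed
    next
      fix w assume w: "w \<in> elems E" "\<forall>e\<in>h ` Y. below E e w"
      show "below E (h l) w"
      proof (rule hle[OF lD w(1)])
        fix f assume f: "f \<in> ?H"
        then have fF: "f \<in> F" using HF by blast
        have "below E (f y) w" if "y \<in> Y" for y
          using porder_trans[OF pE hub[OF f, of y], of w] w that YD FE[OF fF] hE by blast
        then show "below E (f l) w" using Flub[OF fF Y] w(1) unfolding is_lub_in_def by blast
      qed
    qed
  qed
  then have hF: "h \<in> F" using sup[OF H] h by blast
  have sG: "s \<in> elems ?G" using X(2) by (simp add: is_lub_in_def)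
  have "below ?G s (encode F h)"
    using X(2) hF hub unfolding is_lub_in_def by (auto simp: fun_ordset_simps cod(3))
  then have sh: "below E (decode F s x) (h x)" if "x \<in> elems D" for x
    using that hF by (simp add: fun_ordset_simps cod(3))
  show ?thesis
    unfolding is_lub_in_def
  proof (intro conjI ballI impI)
    show "decode F s a \<in> elems E" using FE[OF dF[OF sG] a] .
    show "below E e (decode F s a)" if "e \<in> (\<lambda>u. decode F u a) ` X" for e
      using that X(2) a by (auto simp: is_lub_in_def fun_ordset_simps)
    fix w assume w: "w \<in> elems E" "\<forall>e\<in>(\<lambda>u. decode F u a) ` X. below E e w"
    have "below E (h a) w" by (rule hle[OF a w(1)]) (use w(2) in auto)
    then show "below E (decode F s a) w"
      using porder_trans[OF pE sh[OF a]] FE[OF dF[OF sG] a] hE[OF a] w(1) by blast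
  qed
qed

lemma scott_maps_continuous: "f \<in> scott_maps D E \<Longrightarrow> continuous_map (scott_topology D) (scott_topology E) f"
  by (simp add: scott_maps_def)

lemma restrict_scott_maps:
  "continuous_map (scott_topology D) (scott_topology E) f \<Longrightarrow> restrict f (elems D) \<in> scott_maps D E"
  unfolding scott_maps_def
  by (auto simp: topspace_scott_topology intro: continuous_map_eq)

subsection \<open>Application and abstraction over the natural numbers\<close>

lemma N_app_scott: "f \<in> elems (N_dom (Suc k)) \<Longrightarrow> N_app k f \<in> scott_maps (N_dom k) N_ground"
  using bij_betw_N_app[of k] by (auto simp: bij_betw_def)

lemma N_app_continuous:
  "f \<in> elems (N_dom (Suc k)) \<Longrightarrow> continuous_map (scott_topology (N_dom k)) (scott_topology N_ground) (N_app k f)"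
  by (rule scott_maps_continuous[OF N_app_scott])

lemma N_app_elems:
  "f \<in> elems (N_dom (Suc k)) \<Longrightarrow> a \<in> elems (N_dom k) \<Longrightarrow> N_app k f a \<in> elems N_ground"
  using N_app_continuous unfolding continuous_map_N_ground_iff by blast

lemma N_below_Suc:
  "below (N_dom (Suc k)) f g \<longleftrightarrow> (\<forall>a\<in>elems (N_dom k). below N_ground (N_app k f a) (N_app k g a))"
  by (simp add: fun_ordset_simps N_app_def)

lemma N_eval_continuous:
  assumes a: "a \<in> elems (N_dom k)"
  shows "continuous_map (scott_topology (N_dom (Suc k))) (scott_topology N_ground) (\<lambda>f. N_app k f a)"
  unfolding continuous_map_scott_iff[OF porder_N_dom porder_N_ground]
proof (intro conjI allI impI)
  show "(\<lambda>f. N_app k f a) ` elems (N_dom (Suc k)) \<subseteq> elems N_ground" using N_app_elems a by blast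
  fix X s assume "directed_in (N_dom (Suc k)) X" "is_lub_in (N_dom (Suc k)) X s"
  then show "is_lub_in N_ground ((\<lambda>f. N_app k f a) ` X) (N_app k s a)"
    using fun_ordset_eval_lub[OF omega_algebraic_N_dom omega_algebraic_N_ground subset_refl] a
    by (simp add: N_app_def)
qed

definition N_lam :: "nat \<Rightarrow> (nat option obj \<Rightarrow> nat option obj) \<Rightarrow> nat option obj" where
  "N_lam k f = encode (scott_maps (N_dom k) N_ground) (restrict f (elems (N_dom k)))"

lemma
  assumes "continuous_map (scott_topology (N_dom k)) (scott_topology N_ground) f"
  shows N_lam_elems: "N_lam k f \<in> elems (N_dom (Suc k))"
    and N_app_lam: "a \<in> elems (N_dom k) \<Longrightarrow> N_app k (N_lam k f) a = f a"
  using restrict_scott_maps[OF assms]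
    fun_ordset_coding(3)[OF omega_algebraic_N_dom omega_algebraic_N_ground subset_refl, of "restrict f (elems (N_dom k))" k]
  by (simp_all add: N_lam_def N_app_def fun_ordset_simps)

subsection \<open>Application and abstraction over the digit sequences\<close>

lemma S_app_sim_maps: "f \<in> elems (S_dom (Suc k)) \<Longrightarrow> S_app k f \<in> sim_maps (S_dom k) (S_sim k)"
  using bij_betw_S_app[of k] by (auto simp: bij_betw_def sim_maps_def S_dom_0)

lemma S_app_continuous:
  "f \<in> elems (S_dom (Suc k)) \<Longrightarrow> continuous_map (scott_topology (S_dom k)) (scott_topology S_ground) (S_app k f)"
  using S_app_sim_maps sim_maps_subset by (blast intro: scott_maps_continuous)

lemma S_app_elems:
  "f \<in> elems (S_dom (Suc k)) \<Longrightarrow> a \<in> elems (S_dom k) \<Longrightarrow> S_app k f a \<in> elems S_ground"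
  using S_app_continuous unfolding continuous_map_S_ground_iff by blast

lemma S_below_Suc:
  "below (S_dom (Suc k)) f g \<longleftrightarrow> (\<forall>a\<in>elems (S_dom k). below S_ground (S_app k f a) (S_app k g a))"
  by (simp add: S_dom_Suc fun_ordset_simps S_app_def)

text \<open>Two members of a directed set have a common bound in it, to which the relation applies;
  \<open>S_sim0_lub\<close> then passes to the supremum.\<close>

lemma sim_maps_lub:
  assumes D: "porder_on D" and H: "directed_in (raw_fun_ordset D S_ground (sim_maps D R)) H"
    and h: "h \<in> scott_maps D S_ground" and lub: "\<And>x. x \<in> elems D \<Longrightarrow> is_lub_in S_ground ((\<lambda>f. f x) ` H) (h x)"
  shows "h \<in> sim_maps D R"
proof -
  have HF: "H \<subseteq> sim_maps D R" using H by (simp add: directed_in_def)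
  have Hd: "directed_in S_ground ((\<lambda>f. f x) ` H)" if x: "x \<in> elems D" for x
    by (rule directed_image[OF H])
      (use x sim_maps_subset[of D R] in \<open>auto simp: scott_maps_iff[OF D porder_S_ground] subset_iff\<close>)
  have "S_sim0 (h x1) (h x2)" if x: "x1 \<in> elems D" "x2 \<in> elems D" "R x1 x2" for x1 x2
  proof (rule S_sim0_lub[OF Hd[OF x(1)] lub[OF x(1)] Hd[OF x(2)] lub[OF x(2)]])
    fix a b assume "a \<in> (\<lambda>f. f x1) ` H" "b \<in> (\<lambda>f. f x2) ` H"
    then obtain f g where fg: "f \<in> H" "g \<in> H" "a = f x1" "b = g x2" by blast
    then obtain e where e: "e \<in> H" "\<forall>x\<in>elems D. below S_ground (f x) (e x)" "\<forall>x\<in>elems D. below S_ground (g x) (e x)"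
      using H unfolding directed_in_def raw_fun_simps by blast
    have "S_sim0 (e x1) (e x2)" using e HF x unfolding sim_maps_def by blast
    then show "\<exists>a' b'. S_sim0 a' b' \<and> below S_ground a a' \<and> below S_ground b b'" using e fg x by blast
  qed
  then show ?thesis using h by (simp add: sim_maps_def)
qed

lemma S_eval_continuous:
  assumes a: "a \<in> elems (S_dom k)"
  shows "continuous_map (scott_topology (S_dom (Suc k))) (scott_topology S_ground) (\<lambda>f. S_app k f a)"
  unfolding continuous_map_scott_iff[OF porder_S_dom porder_S_ground]
proof (intro conjI allI impI)
  show "(\<lambda>f. S_app k f a) ` elems (S_dom (Suc k)) \<subseteq> elems S_ground" using S_app_elems a by blast
  fix X s assume X: "directed_in (S_dom (Suc k)) X" "is_lub_in (S_dom (Suc k)) X s"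
  show "is_lub_in S_ground ((\<lambda>f. S_app k f a) ` X) (S_app k s a)"
    unfolding S_app_def
    by (rule fun_ordset_eval_lub[OF omega_algebraic_S_dom omega_algebraic_S_ground sim_maps_subset
          sim_maps_lub[OF porder_S_dom] X[unfolded S_dom_Suc] a])
qed

definition S_lam :: "nat \<Rightarrow> ((nat \<rightharpoonup> int) obj \<Rightarrow> (nat \<rightharpoonup> int) obj) \<Rightarrow> (nat \<rightharpoonup> int) obj" where
  "S_lam k f = encode (sim_maps (S_dom k) (S_sim k)) (restrict f (elems (S_dom k)))"

lemma
  assumes "continuous_map (scott_topology (S_dom k)) (scott_topology S_ground) f"
    and "\<And>z z'. z \<in> elems (S_dom k) \<Longrightarrow> z' \<in> elems (S_dom k) \<Longrightarrow> S_sim k z z' \<Longrightarrow> S_sim0 (f z) (f z')"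
  shows S_lam_elems: "S_lam k f \<in> elems (S_dom (Suc k))"
    and S_app_lam: "z \<in> elems (S_dom k) \<Longrightarrow> S_app k (S_lam k f) z = f z"
proof -
  have "restrict f (elems (S_dom k)) \<in> sim_maps (S_dom k) (S_sim k)"
    using restrict_scott_maps[OF assms(1)] assms(2) by (simp add: sim_maps_def)
  then show "S_lam k f \<in> elems (S_dom (Suc k))" "z \<in> elems (S_dom k) \<Longrightarrow> S_app k (S_lam k f) z = f z"
    using fun_ordset_coding(3)[OF omega_algebraic_S_dom omega_algebraic_S_ground sim_maps_subset,
        of "restrict f (elems (S_dom k))" k "S_sim k"]
    by (simp_all add: S_lam_def S_app_def S_dom_Suc fun_ordset_simps)
qed

lemma continuous_into_S_Suc:
  assumes D: "porder_on D" and im: "F ` elems D \<subseteq> elems (S_dom (Suc k))"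
    and cont: "\<And>z. z \<in> elems (S_dom k) \<Longrightarrow>
      continuous_map (scott_topology D) (scott_topology S_ground) (\<lambda>x. S_app k (F x) z)"
  shows "continuous_map (scott_topology D) (scott_topology (S_dom (Suc k))) F"
  unfolding continuous_map_scott_iff[OF D porder_S_dom]
proof (intro conjI allI impI)
  show "F ` elems D \<subseteq> elems (S_dom (Suc k))" by (rule im)
  fix X s assume X: "directed_in D X" "is_lub_in D X s"
  have lub: "is_lub_in S_ground ((\<lambda>x. S_app k (F x) z) ` X) (S_app k (F s) z)" if "z \<in> elems (S_dom k)" for z
    using cont[OF that] X continuous_map_scott_iff[OF D porder_S_ground] by blast
  have "s \<in> elems D" using X(2) by (simp add: is_lub_in_def)
  then show "is_lub_in (S_dom (Suc k)) (F ` X) (F s)"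
    using lub im S_app_elems unfolding is_lub_in_def S_below_Suc by (simp add: image_subset_iff)
qed

declare N_dom.simps(2) [simp del]

lemma scott_continuous_elems:
  "continuous_map (scott_topology D) (scott_topology E) f \<Longrightarrow> x \<in> elems D \<Longrightarrow> f x \<in> elems E"
  by (auto simp: continuous_map_def topspace_scott_topology)

lemma openin_scott_subset: "openin (scott_topology D) U \<Longrightarrow> U \<subseteq> elems D"
  using openin_subset topspace_scott_topology by metis

lemma openin_digit:
  "continuous_map (scott_topology D) (scott_topology S_ground) f \<Longrightarrow>
   openin (scott_topology D) {a \<in> elems D. gval (f a) p = Some v}"
  by (simp add: continuous_map_S_ground_iff)

lemma openin_value:
  "continuous_map (scott_topology D) (scott_topology N_ground) f \<Longrightarrow>
   openin (scott_topology D) {a \<in> elems D. f a = Ground (Some v)}"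
  by (simp add: continuous_map_N_ground_iff)

section \<open>Total equivalence\<close>

lemma N_eq0_sym: "N_eq0 x y \<Longrightarrow> N_eq0 y x"
  and N_eq0_trans: "N_eq0 x y \<Longrightarrow> N_eq0 y z \<Longrightarrow> N_eq0 x z"
  by (auto simp: N_eq0_def)

lemma N_eq_elems: "N_eq k x y \<Longrightarrow> x \<in> elems (N_dom k) \<and> y \<in> elems (N_dom k)"
  by (cases k) (auto simp: N_eq0_def N_ground_simps)

text \<open>Transitivity at \<open>Suc k\<close> needs that an argument related to something is
  related to itself, which follows from symmetry and transitivity at \<open>k\<close>. Hence the
  joint induction.\<close>

lemma N_eq_sym_trans: "(N_eq k x y \<longrightarrow> N_eq k y x) \<and> (N_eq k x y \<longrightarrow> N_eq k y z \<longrightarrow> N_eq k x z)"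
proof (induction k arbitrary: x y z)
  case 0
  then show ?case by (auto simp: N_eq0_def)
next
  case (Suc k)
  have sym: "N_eq k a b \<Longrightarrow> N_eq k b a" and refl: "N_eq k a b \<Longrightarrow> N_eq k b b" for a b
    using Suc by blast+
  show ?case
  proof (intro conjI impI)
    assume "N_eq (Suc k) x y"
    then show "N_eq (Suc k) y x" using sym N_eq0_sym unfolding N_eq.simps by meson
    assume "N_eq (Suc k) y z"
    then show "N_eq (Suc k) x z"
      using \<open>N_eq (Suc k) x y\<close> refl N_eq0_trans unfolding N_eq.simps by meson
  qed
qed

lemma N_eq_refl: "N_eq k x y \<Longrightarrow> N_eq k x x \<and> N_eq k y y"
  using N_eq_sym_trans by blast

lemma N_total_iff: "x \<in> N_total k \<longleftrightarrow> N_eq k x x"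
  using N_eq_elems by (auto simp: N_total_def)

lemma S_eq0_iff:
  "S_eq0 x y \<longleftrightarrow> (\<exists>s t. x = Ground s \<and> y = Ground t \<and> s \<in> digit_seqs \<and> t \<in> digit_seqs \<and>
     (\<forall>n. s n \<noteq> None) \<and> (\<forall>n. t n \<noteq> None) \<and> seq_val s = seq_val t)" (is "?L \<longleftrightarrow> ?R")
proof
  assume L: ?L
  then obtain s t where st: "x = Ground s" "y = Ground t" "s \<in> digit_seqs" "t \<in> digit_seqs"
    "\<forall>n. s n \<noteq> None" "\<forall>n. t n \<noteq> None"
    unfolding S_eq0_def maximal_S_ground_iff by blast
  then have "seq_val s = seq_val t" using L by (simp add: S_eq0_def S_sim0_iff_vals vals_total)
  then show ?R using st by blast
next
  assume ?R
  then show ?L unfolding S_eq0_def maximal_S_ground_iff by (auto simp: S_sim0_iff_vals vals_total)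
qed

lemma S_eq0_sym: "S_eq0 x y \<Longrightarrow> S_eq0 y x"
  and S_eq0_trans: "S_eq0 x y \<Longrightarrow> S_eq0 y z \<Longrightarrow> S_eq0 x z"
  by (auto simp: S_eq0_iff)

lemma S_eq_elems: "S_eq k x y \<Longrightarrow> x \<in> elems (S_dom k) \<and> y \<in> elems (S_dom k)"
  by (cases k) (auto simp: S_eq0_iff S_ground_simps S_dom_0)

lemma S_eq_sym_trans: "(S_eq k x y \<longrightarrow> S_eq k y x) \<and> (S_eq k x y \<longrightarrow> S_eq k y z \<longrightarrow> S_eq k x z)"
proof (induction k arbitrary: x y z)
  case 0
  then show ?case using S_eq0_sym S_eq0_trans unfolding S_eq.simps by blast
next
  case (Suc k)
  have sym: "S_eq k a b \<Longrightarrow> S_eq k b a" and refl: "S_eq k a b \<Longrightarrow> S_eq k b b" for a b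
    using Suc by blast+
  show ?case
  proof (intro conjI impI)
    assume "S_eq (Suc k) x y"
    then show "S_eq (Suc k) y x" using sym S_eq0_sym unfolding S_eq.simps by meson
    assume "S_eq (Suc k) y z"
    then show "S_eq (Suc k) x z"
      using \<open>S_eq (Suc k) x y\<close> refl S_eq0_trans unfolding S_eq.simps by meson
  qed
qed

lemma S_eq_refl: "S_eq k x y \<Longrightarrow> S_eq k x x \<and> S_eq k y y"
  using S_eq_sym_trans by blast

lemma S_total_iff: "x \<in> S_total k \<longleftrightarrow> S_eq k x x"
  using S_eq_elems by (auto simp: S_total_def)

section \<open>Extension from tables\<close>

text \<open>
  An element \<open>z\<close> of \<open>S(k)\<close> is observed through its coordinates \<open>q c z\<close>, and \<open>e n\<close> turns a table of
  natural numbers for the coordinates in \<open>C n\<close> into a total element of \<open>N(k)\<close>.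
\<close>

locale coordinates =
  fixes k :: nat and C :: "nat \<Rightarrow> 'i set"
    and q :: "'i \<Rightarrow> (nat \<rightharpoonup> int) obj \<Rightarrow> (nat \<rightharpoonup> int) obj"
    and e :: "nat \<Rightarrow> ('i \<Rightarrow> nat) \<Rightarrow> nat option obj"
  assumes finite_C: "finite (C n)"
    and q_continuous: "c \<in> C n \<Longrightarrow> continuous_map (scott_topology (S_dom k)) (scott_topology S_ground) (q c)"
    and q_sim: "c \<in> C n \<Longrightarrow> z \<in> elems (S_dom k) \<Longrightarrow> z' \<in> elems (S_dom k) \<Longrightarrow> S_sim k z z'
      \<Longrightarrow> S_sim0 (q c z) (q c z')"
    and q_eq: "c \<in> C n \<Longrightarrow> S_eq k z z' \<Longrightarrow> S_eq0 (q c z) (q c z')"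
    and e_total: "t \<in> tables (C n) n \<Longrightarrow> N_eq k (e n t) (e n t)"
begin

definition digits :: "(nat \<rightharpoonup> int) obj \<Rightarrow> 'i \<Rightarrow> (nat \<rightharpoonup> int)" where
  "digits z c = gval (q c z)"

text \<open>The natural case: near \<open>(x, z)\<close> all plausible tables of late stages have
  the value \<open>m\<close>. The prefixes have the fixed length \<open>n0\<close>, so every box of
  stage \<open>n0\<close> or later satisfies the condition.\<close>

definition stable :: "nat option obj \<Rightarrow> (nat \<rightharpoonup> int) obj \<Rightarrow> nat \<Rightarrow> bool" where
  "stable x z m \<longleftrightarrow> (\<exists>n0 U V. openin (scott_topology (N_dom (Suc k))) U \<and> x \<in> U \<and>
     openin (scott_topology (S_dom k)) V \<and> z \<in> V \<and>
     (\<forall>x'\<in>U. \<forall>z'\<in>V. \<forall>n\<ge>n0. \<forall>r. \<forall>t\<in>tables (C n) n.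
        (\<forall>c\<in>C n. r c \<in> vals (digits z' c |` {..<n0}) \<and> hat n (r c) (t c) > 0) \<longrightarrow>
        N_app k x' (e n t) = Ground (Some m)))"

text \<open>For an undefined value this is some unspecified number. \<open>ready\<close> asks for
  defined entries up to stage \<open>n\<close>, and the stages after \<open>n\<close> leave the
  limit as it is.\<close>

definition entry :: "nat option obj \<Rightarrow> nat \<Rightarrow> ('i \<Rightarrow> nat) \<Rightarrow> real" where
  "entry x n t = real (the (gval (N_app k x (e n t))))"

abbreviation G :: "nat option obj \<Rightarrow> nat \<Rightarrow> ('i \<Rightarrow> real) \<Rightarrow> real" where
  "G x \<equiv> interp C (entry x)"

abbreviation Cs :: "nat \<Rightarrow> 'i set" where
  "Cs n \<equiv> \<Union>i\<le>n. C i"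

definition unchanged :: "nat option obj \<Rightarrow> (nat \<rightharpoonup> int) obj \<Rightarrow> nat \<Rightarrow> bool" where
  "unchanged x z i \<longleftrightarrow> (\<forall>r\<in>prefix_box (Cs (Suc i)) i (digits z). G x (Suc i) r = G x i r)"

text \<open>Being unchanged at infinitely many stages is not visibly an open condition; the
  neighbourhoods make it one.\<close>

definition settled :: "nat option obj \<Rightarrow> (nat \<rightharpoonup> int) obj \<Rightarrow> nat \<Rightarrow> bool" where
  "settled x z n \<longleftrightarrow> (\<exists>U V. openin (scott_topology (N_dom (Suc k))) U \<and> x \<in> U \<and>
     openin (scott_topology (S_dom k)) V \<and> z \<in> V \<and>
     (\<forall>x'\<in>U. \<forall>z'\<in>V. \<forall>i\<ge>n. unchanged x' z' i))"

text \<open>The first two conditions freeze the data of the stages up to \<open>n\<close>, the third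
  takes care of all later stages; together they fix \<open>final\<close>.\<close>

definition ready :: "nat option obj \<Rightarrow> (nat \<rightharpoonup> int) obj \<Rightarrow> nat \<Rightarrow> bool" where
  "ready x z n \<longleftrightarrow> (\<forall>i\<le>n. \<forall>t\<in>tables (C i) i. N_app k x (e i t) \<noteq> Ground None) \<and>
     avail (Cs n) (digits z) n \<and> settled x z n"

definition final :: "nat option obj \<Rightarrow> (nat \<rightharpoonup> int) obj \<Rightarrow> nat" where
  "final x z = (LEAST l. \<forall>i\<ge>l. unchanged x z i)"

text \<open>
  Whether stage \<open>i\<close> is unchanged is decided from prefixes of length \<open>i\<close>.  Hence \<open>final x z\<close>, and with
  it the chosen name of the limit, is the same for all better approximations of \<open>x\<close> and \<open>z\<close>.
\<close>

definition ext_val :: "nat option obj \<Rightarrow> (nat \<rightharpoonup> int) obj \<Rightarrow> (nat \<rightharpoonup> int)" where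
  "ext_val x z = (if \<exists>n. ready x z n
     then name_of (Cs (final x z)) (G x (final x z)) (digits z) else Map.empty)"

definition extension :: "nat option obj \<Rightarrow> (nat \<rightharpoonup> int) obj" where
  "extension x = S_lam k (\<lambda>z. Ground (ext_val x z))"

lemma e_elems: "t \<in> tables (C n) n \<Longrightarrow> e n t \<in> elems (N_dom k)"
  using e_total N_eq_elems by blast

lemma q_elems: "c \<in> C n \<Longrightarrow> z \<in> elems (S_dom k) \<Longrightarrow> q c z \<in> elems S_ground"
  by (rule scott_continuous_elems[OF q_continuous])

lemma q_digits: "c \<in> C n \<Longrightarrow> z \<in> elems (S_dom k) \<Longrightarrow> q c z = Ground (digits z c) \<and> digits z c \<in> digit_seqs"
  using S_ground_elemD[OF q_elems] by (simp add: digits_def)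

section \<open>Locality of the final stage, and joint continuity of the extension\<close>

lemma final_le:
  assumes "ready x z n"
  shows "final x z \<le> n" "\<And>i. i \<ge> final x z \<Longrightarrow> unchanged x z i"
proof -
  have n: "\<forall>i\<ge>n. unchanged x z i" using assms unfolding ready_def settled_def by blast
  show "final x z \<le> n" unfolding final_def by (rule Least_le) (rule n)
  have "\<forall>i\<ge>final x z. unchanged x z i" unfolding final_def by (rule LeastI) (rule n)
  then show "\<And>i. i \<ge> final x z \<Longrightarrow> unchanged x z i" by blast
qed

text \<open>For \<open>i < n\<close>, whether stage \<open>i\<close> is unchanged depends on entries
  of stages up to \<open>Suc i \<le> n\<close> and on digits below \<open>i\<close>, where both
  pairs agree. From \<open>n\<close> on both pairs are unchanged by readiness.\<close>

lemma final_agree: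
  assumes r: "ready x z n" and r': "ready x' z' n"
    and x: "\<And>i t. i \<le> n \<Longrightarrow> t \<in> tables (C i) i \<Longrightarrow> N_app k x' (e i t) = N_app k x (e i t)"
    and z: "\<And>c i. c \<in> Cs n \<Longrightarrow> i < n \<Longrightarrow> digits z' c i = digits z c i"
  shows "final x' z' = final x z" "l \<le> n \<Longrightarrow> G x' l = G x l"
proof -
  show G: "G x' l = G x l" if "l \<le> n" for l
    by (rule interp_cong) (use x that in \<open>simp add: entry_def\<close>)
  have "unchanged x' z' i = unchanged x z i" for i
  proof (cases "i < n")
    case True
    have "digits z' c |` {..<i} = digits z c |` {..<i}" if "c \<in> Cs (Suc i)" for c
    proof -
      have "c \<in> Cs n" using that True by (auto dest: order_trans[OF _ Suc_leI])
      then show ?thesis using z True by (auto simp: restrict_map_def fun_eq_iff)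
    qed
    then have "prefix_box (Cs (Suc i)) i (digits z') = prefix_box (Cs (Suc i)) i (digits z)"
      unfolding prefix_box_def by (metis (no_types, lifting))
    then show ?thesis unfolding unchanged_def using G[of i] G[of "Suc i"] True by simp
  next
    case False
    then show ?thesis using final_le[OF r] final_le[OF r'] by (meson le_trans not_less)
  qed
  then show "final x' z' = final x z" by (simp add: final_def)
qed

lemma open_digits_agree:
  assumes z: "z \<in> elems (S_dom k)" and av: "avail (Cs n) (digits z) j"
  shows "openin (scott_topology (S_dom k))
    {z' \<in> elems (S_dom k). \<forall>c\<in>Cs n. \<forall>i<j. digits z' c i = digits z c i}" (is "openin ?T ?A")
proof -
  let ?I = "Cs n \<times> {..<j}"
  let ?U = "\<lambda>ci. {z' \<in> elems (S_dom k). digits z' (fst ci) (snd ci) = digits z (fst ci) (snd ci)}"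
  have "openin ?T ((\<Inter>ci\<in>?I. ?U ci) \<inter> topspace ?T)"
  proof (rule openin_INT)
    show "finite ?I" using finite_C by auto
    fix ci assume ci: "ci \<in> ?I"
    then obtain v where v: "digits z (fst ci) (snd ci) = Some v" using av unfolding avail_def by fastforce
    obtain m where "fst ci \<in> C m" using ci by auto
    then show "openin ?T (?U ci)" unfolding v
      unfolding digits_def by (rule openin_digit[OF q_continuous])
  qed
  moreover have "(\<Inter>ci\<in>?I. ?U ci) \<inter> topspace ?T = ?A" by (auto simp: topspace_scott_topology)
  ultimately show ?thesis by simp
qed

lemma open_entries_agree:
  assumes x: "x \<in> elems (N_dom (Suc k))"
    and d: "\<And>i t. i \<le> n \<Longrightarrow> t \<in> tables (C i) i \<Longrightarrow> N_app k x (e i t) \<noteq> Ground None"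
  shows "openin (scott_topology (N_dom (Suc k)))
    {x' \<in> elems (N_dom (Suc k)). \<forall>i\<le>n. \<forall>t\<in>tables (C i) i. N_app k x' (e i t) = N_app k x (e i t)}"
    (is "openin ?T ?A")
proof -
  let ?I = "SIGMA i:{..n}. tables (C i) i"
  let ?U = "\<lambda>it. {x' \<in> elems (N_dom (Suc k)).
    N_app k x' (e (fst it) (snd it)) = N_app k x (e (fst it) (snd it))}"
  have "openin ?T ((\<Inter>it\<in>?I. ?U it) \<inter> topspace ?T)"
  proof (rule openin_INT)
    show "finite ?I" using finite_C finite_tables by auto
    fix it assume it: "it \<in> ?I"
    then have el: "e (fst it) (snd it) \<in> elems (N_dom k)" using e_elems by auto
    then have "N_app k x (e (fst it) (snd it)) \<in> range Ground"
      using N_app_elems[OF x] by (simp add: N_ground_simps)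
    moreover have "N_app k x (e (fst it) (snd it)) \<noteq> Ground None" using d it by auto
    ultimately obtain v where v: "N_app k x (e (fst it) (snd it)) = Ground (Some v)" by auto
    show "openin ?T (?U it)" unfolding v
      by (rule openin_value[OF N_eval_continuous[OF el]])
  qed
  moreover have "(\<Inter>it\<in>?I. ?U it) \<inter> topspace ?T = ?A" by (auto simp: topspace_scott_topology)
  ultimately show ?thesis by simp
qed

text \<open>Nearby points stay ready at the same \<open>n\<close> and hence have the same final
  stage \<open>l\<close>. They also share the entries that determine \<open>G x l\<close> and the
  digits from which position \<open>p\<close> of the name was computed.\<close>

lemma ext_val_open:
  assumes x: "x \<in> elems (N_dom (Suc k))" and z: "z \<in> elems (S_dom k)" and v: "ext_val x z p = Some v"
  shows "\<exists>U V. openin (scott_topology (N_dom (Suc k))) U \<and> x \<in> U \<and>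
     openin (scott_topology (S_dom k)) V \<and> z \<in> V \<and> (\<forall>x'\<in>U. \<forall>z'\<in>V. ext_val x' z' p = Some v)"
proof -
  obtain n where n: "ready x z n" using v by (auto simp: ext_val_def split: if_splits)
  define l where "l = final x z"
  have l: "l \<le> n" using final_le(1)[OF n] by (simp add: l_def)
  have "name_of (Cs l) (G x l) (digits z) p = Some v"
    using v n unfolding ext_val_def l_def[symmetric] by (auto split: if_splits)
  then obtain j where j: "avail (Cs l) (digits z) j" "p < length (emit (Cs l) (G x l) (digits z) j)"
    and nm: "name_of (Cs l) (G x l) (digits z) p = Some v"
    unfolding name_of_Some_iff by blast
  obtain U V where UV: "openin (scott_topology (N_dom (Suc k))) U" "x \<in> U"
    "openin (scott_topology (S_dom k)) V" "z \<in> V" "\<forall>x'\<in>U. \<forall>z'\<in>V. \<forall>i\<ge>n. unchanged x' z' i"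
    using n unfolding ready_def settled_def by blast
  define U1 where "U1 = {x' \<in> elems (N_dom (Suc k)). \<forall>i\<le>n. \<forall>t\<in>tables (C i) i. N_app k x' (e i t) = N_app k x (e i t)}"
  define V1 where "V1 = {z' \<in> elems (S_dom k). \<forall>c\<in>Cs n. \<forall>i<n. digits z' c i = digits z c i}"
  \<comment> \<open>The name may have read digits beyond position \<open>n\<close>, so these are
    fixed separately.\<close>
  define V2 where "V2 = {z' \<in> elems (S_dom k). \<forall>c\<in>Cs l. \<forall>i<j. digits z' c i = digits z c i}"
  have "openin (scott_topology (N_dom (Suc k))) U1"
    unfolding U1_def by (rule open_entries_agree[OF x]) (use n in \<open>simp add: ready_def\<close>)
  then have oU: "openin (scott_topology (N_dom (Suc k))) (U \<inter> U1)" using UV(1) by (rule openin_Int[rotated])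
  have "openin (scott_topology (S_dom k)) V1" "openin (scott_topology (S_dom k)) V2"
    unfolding V1_def V2_def using open_digits_agree[OF z] n j(1) by (simp_all add: ready_def)
  then have oV: "openin (scott_topology (S_dom k)) (V \<inter> V1 \<inter> V2)" using UV(3) by auto
  have "ext_val x' z' p = Some v" if x': "x' \<in> U \<inter> U1" and z': "z' \<in> V \<inter> V1 \<inter> V2" for x' z'
  proof -
    have n': "ready x' z' n"
      unfolding ready_def settled_def
    proof (intro conjI exI)
      show "\<forall>i\<le>n. \<forall>t\<in>tables (C i) i. N_app k x' (e i t) \<noteq> Ground None"
        using n x' by (simp add: ready_def U1_def)
      show "avail (Cs n) (digits z') n" using n z' by (simp add: ready_def avail_def V1_def)
    qed (use UV x' z' in auto)
    have ax: "N_app k x' (e i t) = N_app k x (e i t)" if "i \<le> n" "t \<in> tables (C i) i" for i t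
      using x' that unfolding U1_def by blast
    have az: "digits z' c i = digits z c i" if "c \<in> Cs n" "i < n" for c i
      using z' that unfolding V1_def by blast
    have "final x' z' = l" "G x' l = G x l"
      using final_agree[OF n n' ax az] l by (simp_all add: l_def)
    moreover have "name_of (Cs l) (G x l) (digits z') p = Some v"
      using name_of_local[OF j, of "digits z'"] z' nm unfolding V2_def by auto
    ultimately show ?thesis using n' by (auto simp: ext_val_def)
  qed
  moreover have "x \<in> U \<inter> U1" "z \<in> V \<inter> V1 \<inter> V2" using UV x z by (auto simp: U1_def V1_def V2_def)
  ultimately show ?thesis using oU oV by blast
qed

lemma ext_val_in_digit_seqs: "ext_val x z \<in> digit_seqs"
proof -
  have "Map.empty \<in> digit_seqs" by (simp add: digit_seqs_def)
  then show ?thesis by (simp add: ext_val_def name_of_in_digit_seqs)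
qed

lemma ext_val_continuous_right:
  assumes x: "x \<in> elems (N_dom (Suc k))"
  shows "continuous_map (scott_topology (S_dom k)) (scott_topology S_ground) (\<lambda>z. Ground (ext_val x z))"
  unfolding continuous_map_S_ground_iff
proof (intro conjI allI)
  show "(\<lambda>z. Ground (ext_val x z)) ` elems (S_dom k) \<subseteq> elems S_ground"
    using ext_val_in_digit_seqs by (auto simp: S_ground_simps)
  fix p v
  show "openin (scott_topology (S_dom k)) {z \<in> elems (S_dom k). gval (Ground (ext_val x z)) p = Some v}"
  proof (subst openin_subopen, intro ballI)
    fix z assume "z \<in> {z \<in> elems (S_dom k). gval (Ground (ext_val x z)) p = Some v}"
    then have z: "z \<in> elems (S_dom k)" "ext_val x z p = Some v" by auto
    obtain U V where "x \<in> U" "openin (scott_topology (S_dom k)) V" "z \<in> V"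
      "\<forall>x'\<in>U. \<forall>z'\<in>V. ext_val x' z' p = Some v"
      using ext_val_open[OF x z] by blast
    moreover from this(2) have "V \<subseteq> elems (S_dom k)" by (rule openin_scott_subset)
    ultimately show "\<exists>T. openin (scott_topology (S_dom k)) T \<and> z \<in> T \<and>
        T \<subseteq> {z \<in> elems (S_dom k). gval (Ground (ext_val x z)) p = Some v}"
      by (intro exI[of _ V]) auto
  qed
qed

lemma ext_val_continuous_left:
  assumes z: "z \<in> elems (S_dom k)"
  shows "continuous_map (scott_topology (N_dom (Suc k))) (scott_topology S_ground) (\<lambda>x. Ground (ext_val x z))"
  unfolding continuous_map_S_ground_iff
proof (intro conjI allI)
  show "(\<lambda>x. Ground (ext_val x z)) ` elems (N_dom (Suc k)) \<subseteq> elems S_ground"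
    using ext_val_in_digit_seqs by (auto simp: S_ground_simps)
  fix p v
  show "openin (scott_topology (N_dom (Suc k))) {x \<in> elems (N_dom (Suc k)). gval (Ground (ext_val x z)) p = Some v}"
  proof (subst openin_subopen, intro ballI)
    fix x assume "x \<in> {x \<in> elems (N_dom (Suc k)). gval (Ground (ext_val x z)) p = Some v}"
    then have x: "x \<in> elems (N_dom (Suc k))" "ext_val x z p = Some v" by auto
    obtain U V where "openin (scott_topology (N_dom (Suc k))) U" "x \<in> U" "z \<in> V"
      "\<forall>x'\<in>U. \<forall>z'\<in>V. ext_val x' z' p = Some v"
      using ext_val_open[OF x(1) z x(2)] by blast
    moreover from this(1) have "U \<subseteq> elems (N_dom (Suc k))" by (rule openin_scott_subset)
    ultimately show "\<exists>T. openin (scott_topology (N_dom (Suc k))) T \<and> x \<in> T \<and>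
        T \<subseteq> {x \<in> elems (N_dom (Suc k)). gval (Ground (ext_val x z)) p = Some v}"
      by (intro exI[of _ U]) auto
  qed
qed

section \<open>The limit value and compatibility with similarity\<close>

lemma ext_val_limit:
  assumes n: "ready x z n" and r: "\<And>n c. c \<in> C n \<Longrightarrow> r c \<in> vals (digits z c)"
  shows "G x (final x z) r \<in> vals (ext_val x z)" "i \<ge> final x z \<Longrightarrow> G x i r = G x (final x z) r"
proof -
  have "G x (final x z) r \<in> vals (name_of (Cs (final x z)) (G x (final x z)) (digits z))"
    by (rule name_of_vals) (use r in blast)
  then show "G x (final x z) r \<in> vals (ext_val x z)" using n by (auto simp: ext_val_def)
  have box: "r \<in> prefix_box (Cs m) j (digits z)" for m j
    using r vals_subset_restrict unfolding prefix_box_def by blast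
  show "G x i r = G x (final x z) r" if "i \<ge> final x z"
    using that
  proof (induction i rule: dec_induct)
    case (step i)
    then show ?case using final_le(2)[OF n, of i] box unfolding unchanged_def by metis
  qed simp
qed

text \<open>Similar coordinates have a common point \<open>r\<close>. The two final stages may
  differ, but beyond the larger one all terms agree at \<open>r\<close>, so both names admit the
  same real. If one side is not ready, its value is the empty sequence, which admits every
  real.\<close>

lemma ext_val_sim:
  assumes G: "G x = G x'" and z: "z \<in> elems (S_dom k)" "z' \<in> elems (S_dom k)"
    and sim: "\<And>n c. c \<in> C n \<Longrightarrow> S_sim0 (q c z) (q c z')"
  shows "S_sim0 (Ground (ext_val x z)) (Ground (ext_val x' z'))"
proof -
  have "\<forall>c\<in>\<Union>(range C). \<exists>r. r \<in> vals (digits z c) \<and> r \<in> vals (digits z' c)"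
    using sim q_digits z S_sim0_iff_vals by (metis (no_types, lifting) UN_E disjoint_iff)
  then obtain r where r: "\<And>n c. c \<in> C n \<Longrightarrow> r c \<in> vals (digits z c) \<and> r c \<in> vals (digits z' c)" by (metis UN_I UNIV_I)
  have "vals (ext_val x z) \<inter> vals (ext_val x' z') \<noteq> {}"
  proof (cases "(\<exists>n. ready x z n) \<and> (\<exists>n. ready x' z' n)")
    case True
    then obtain n n' where n: "ready x z n" "ready x' z' n'" by blast
    let ?m = "max (final x z) (final x' z')"
    have "G x (final x z) r = G x ?m r" "G x' (final x' z') r = G x' ?m r"
      using ext_val_limit(2)[OF n(1), of r ?m] ext_val_limit(2)[OF n(2), of r ?m] r by auto
    then show ?thesis
      using ext_val_limit(1)[OF n(1), of r] ext_val_limit(1)[OF n(2), of r] r G by auto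
  next
    case False
    then have "ext_val x z = Map.empty \<or> ext_val x' z' = Map.empty" by (auto simp: ext_val_def)
    then show ?thesis using vals_nonempty[OF ext_val_in_digit_seqs] vals_empty by auto
  qed
  then show ?thesis by (simp add: S_sim0_iff_vals ext_val_in_digit_seqs)
qed

lemma
  assumes x: "x \<in> elems (N_dom (Suc k))"
  shows extension_elems: "extension x \<in> elems (S_dom (Suc k))"
    and S_app_extension: "z \<in> elems (S_dom k) \<Longrightarrow> S_app k (extension x) z = Ground (ext_val x z)"
proof -
  have sim: "S_sim0 (Ground (ext_val x z)) (Ground (ext_val x z'))"
    if "z \<in> elems (S_dom k)" "z' \<in> elems (S_dom k)" "S_sim k z z'" for z z'
    by (rule ext_val_sim) (use that q_sim in auto)
  show "extension x \<in> elems (S_dom (Suc k))" "z \<in> elems (S_dom k) \<Longrightarrow> S_app k (extension x) z = Ground (ext_val x z)"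
    unfolding extension_def using S_lam_elems[OF ext_val_continuous_right[OF x] sim]
      S_app_lam[OF ext_val_continuous_right[OF x] sim] by auto
qed

lemma extension_continuous:
  "continuous_map (scott_topology (N_dom (Suc k))) (scott_topology (S_dom (Suc k))) extension"
proof (rule continuous_into_S_Suc[OF porder_N_dom])
  show "extension ` elems (N_dom (Suc k)) \<subseteq> elems (S_dom (Suc k))" using extension_elems by blast
  fix z assume z: "z \<in> elems (S_dom k)"
  show "continuous_map (scott_topology (N_dom (Suc k))) (scott_topology S_ground) (\<lambda>x. S_app k (extension x) z)"
    by (rule continuous_map_eq[OF ext_val_continuous_left[OF z]])
      (use S_app_extension z in \<open>simp add: topspace_scott_topology\<close>)
qed

section \<open>Totality of the extension\<close>

lemma digits_total:
  assumes "z \<in> S_total k" "c \<in> C n"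
  shows "q c z = Ground (digits z c)" "digits z c \<in> digit_seqs" "\<And>i. digits z c i \<noteq> None"
proof -
  have "S_eq0 (q c z) (q c z)" using q_eq[OF assms(2)] assms(1) by (simp add: S_total_iff)
  then show "q c z = Ground (digits z c)" "digits z c \<in> digit_seqs" "\<And>i. digits z c i \<noteq> None"
    by (auto simp: S_eq0_iff digits_def)
qed

text \<open>On a late box both averages only weigh tables of value \<open>m\<close>, so the
  correction is a multiple of zero.\<close>

lemma stable_settled:
  assumes "stable x z m"
  shows "\<exists>n. settled x z n"
proof -
  obtain n0 U V where UV: "openin (scott_topology (N_dom (Suc k))) U" "x \<in> U"
    "openin (scott_topology (S_dom k)) V" "z \<in> V"
    and st: "\<forall>x'\<in>U. \<forall>z'\<in>V. \<forall>n\<ge>n0. \<forall>r. \<forall>t\<in>tables (C n) n.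
        (\<forall>c\<in>C n. r c \<in> vals (digits z' c |` {..<n0}) \<and> hat n (r c) (t c) > 0) \<longrightarrow>
        N_app k x' (e n t) = Ground (Some m)"
    using assms unfolding stable_def by (elim exE conjE)
  have "unchanged x' z' i" if x': "x' \<in> U" and z': "z' \<in> V" and i: "i \<ge> n0" for x' z' i
    unfolding unchanged_def
  proof (intro ballI interp_Suc_eq_of_avg)
    fix r assume r: "r \<in> prefix_box (Cs (Suc i)) i (digits z')"
    have "avg (C n) n (entry x' n) r = m" if n: "n \<in> {i, Suc i}" for n
    proof (rule avg_const[OF finite_C])
      fix t assume t: "t \<in> tables (C n) n" "\<And>c. c \<in> C n \<Longrightarrow> hat n (r c) (t c) > 0"
      have "r c \<in> vals (digits z' c |` {..<n0})" if "c \<in> C n" for c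
        using r n that vals_restrict_antimono[OF i, of "digits z' c"] unfolding prefix_box_def by fastforce
      moreover have "n0 \<le> n" using n i by auto
      ultimately have "N_app k x' (e n t) = Ground (Some m)" using st x' z' t by blast
      then show "entry x' n t = m" by (simp add: entry_def)
    qed
    then show "avg (C (Suc i)) (Suc i) (entry x' (Suc i)) r = avg (C i) i (entry x' i) r" by simp
  qed
  then show ?thesis using UV unfolding settled_def by blast
qed

text \<open>A finite prefix keeps the offending coordinate at distance more than \<delta>/2 from the
  natural numbers for all \<open>z'\<close> that share it. As soon as \<open>2 ^ n\<close> exceeds
  2/\<delta>, the damping factor is zero, whatever \<open>x'\<close> is.\<close>

lemma nonnat_settled:
  assumes x: "x \<in> elems (N_dom (Suc k))" and z: "z \<in> S_total k" and c: "c \<in> C i" "rho_S (q c z) \<notin> \<nat>"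
  shows "\<exists>n. settled x z n"
proof -
  note dt = digits_total[OF z c(1)]
  have zD: "z \<in> elems (S_dom k)" using z by (simp add: S_total_def)
  define \<delta> where "\<delta> = infdist (seq_val (digits z c)) \<nat>"
  have "\<delta> \<noteq> 0" using c(2) dt(1) in_closed_iff_infdist_zero[OF closed_Nats, of "seq_val (digits z c)"]
    by (auto simp: \<delta>_def)
  then have \<delta>: "\<delta> > 0" using infdist_nonneg[of "seq_val (digits z c)" "\<nat>"] by (simp add: \<delta>_def)
  have "open {r. infdist r \<nat> > \<delta> / 2}"
    by (rule open_Collect_less) (auto intro!: continuous_intros)
  then obtain j where j: "vals (digits z c |` {..<j}) \<subseteq> {r. infdist r \<nat> > \<delta> / 2}"
    using open_vals_prefix[OF dt(2,3), of "{r. infdist r \<nat> > \<delta> / 2}"] \<delta> by (auto simp: \<delta>_def)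
  define V where "V = {z' \<in> elems (S_dom k). \<forall>b\<in>Cs i. \<forall>l<j. digits z' b l = digits z b l}"
  have V: "openin (scott_topology (S_dom k)) V"
    unfolding V_def by (rule open_digits_agree[OF zD]) (use digits_total[OF z] in \<open>auto simp: avail_def\<close>)
  obtain N where N: "2 / \<delta> < 2 ^ N" using real_arch_pow[of 2 "2 / \<delta>"] by auto
  have "unchanged x' z' n" if z': "z' \<in> V" and n: "n \<ge> max (max i j) N" for x' z' n
    unfolding unchanged_def
  proof
    fix r assume r: "r \<in> prefix_box (Cs (Suc n)) n (digits z')"
    have "c \<in> Cs (Suc n)" using c(1) n by auto
    then have "r c \<in> vals (digits z' c |` {..<n})" using r unfolding prefix_box_def by blast
    then have "r c \<in> vals (digits z' c |` {..<j})" using vals_restrict_antimono[of j n] n by auto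
    moreover have "digits z' c |` {..<j} = digits z c |` {..<j}"
      using z' c(1) by (auto simp: V_def restrict_map_def fun_eq_iff)
    ultimately have "\<delta> / 2 < infdist (r c) \<nat>" using j by auto
    moreover have "2 / \<delta> < 2 ^ n" using n by (intro less_le_trans[OF N power_increasing]) auto
    ultimately have "(2 / \<delta>) * (\<delta> / 2) \<le> 2 ^ n * infdist (r c) \<nat>"
      using \<delta> by (intro mult_mono) auto
    then have "1 \<le> 2 ^ n * infdist (r c) \<nat>" using \<delta> by simp
    then show "G x' (Suc n) r = G x' n r"
      using interp_Suc_eq_of_defect[of C c i n r] finite_C c(1) n by simp
  qed
  moreover have "z \<in> V" using zD by (simp add: V_def)
  moreover have "openin (scott_topology (N_dom (Suc k))) (elems (N_dom (Suc k)))"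
    by (metis openin_topspace topspace_scott_topology)
  ultimately show ?thesis unfolding settled_def using V x by blast
qed

lemma settled_ready:
  assumes x: "x \<in> N_total (Suc k)" and z: "z \<in> S_total k" and n: "settled x z n"
  shows "ready x z n"
proof -
  have "N_app k x (e i t) \<noteq> Ground None" if "t \<in> tables (C i) i" for i t
    using x e_total[OF that] e_elems[OF that] by (fastforce simp: N_total_iff N_eq0_def)
  moreover have "avail (Cs n) (digits z) n" using digits_total(3)[OF z] by (auto simp: avail_def)
  ultimately show ?thesis using n by (simp add: ready_def)
qed

lemma ext_val_total:
  assumes z: "z \<in> S_total k" and n: "ready x z n"
  shows "ext_val x z p \<noteq> None"
proof -
  have "name_of (Cs (final x z)) (G x (final x z)) (digits z) p \<noteq> None"
    by (rule name_of_total[OF interp_coord_cont[OF finite_C]]) (use digits_total[OF z] in auto)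
  then show ?thesis using n by (auto simp: ext_val_def)
qed

text \<open>At natural coordinates the damped term is the plain average, which is \<open>m\<close>
  from stage \<open>n0\<close> on, and beyond the final stage it is also the limit.\<close>

lemma ext_val_stable:
  assumes x: "x \<in> N_total (Suc k)" and z: "z \<in> S_total k" and st: "stable x z m"
    and nat: "\<And>n c. c \<in> C n \<Longrightarrow> rho_S (q c z) \<in> \<nat>"
  shows "rho_S (S_app k (extension x) z) = real m"
proof -
  have xD: "x \<in> elems (N_dom (Suc k))" and zD: "z \<in> elems (S_dom k)"
    using x z unfolding N_total_def S_total_def by auto
  obtain n where n: "ready x z n" using stable_settled[OF st] settled_ready[OF x z] by blast
  obtain n0 where n0: "\<forall>n\<ge>n0. \<forall>r. \<forall>t\<in>tables (C n) n.
        (\<forall>c\<in>C n. r c \<in> vals (digits z c |` {..<n0}) \<and> hat n (r c) (t c) > 0) \<longrightarrow>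
        N_app k x (e n t) = Ground (Some m)"
    using st unfolding stable_def by meson
  define r where "r c = rho_S (q c z)" for c
  have r: "r c \<in> vals (digits z c)" if "c \<in> C i" for i c
    using digits_total[OF z that] vals_total by (simp add: r_def)
  define i where "i = max (final x z) n0"
  have "G x i r = avg (C i) i (entry x i) r" by (rule interp_nat_coords) (use nat r_def in auto)
  also have "\<dots> = m"
  proof (rule avg_const[OF finite_C])
    fix t assume t: "t \<in> tables (C i) i" "\<And>c. c \<in> C i \<Longrightarrow> hat i (r c) (t c) > 0"
    have "r c \<in> vals (digits z c |` {..<n0})" if "c \<in> C i" for c using r[OF that] vals_subset_restrict by blast
    moreover have "n0 \<le> i" by (simp add: i_def)
    ultimately have "N_app k x (e i t) = Ground (Some m)" using n0 t by blast
    then show "entry x i t = m" by (simp add: entry_def)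
  qed
  finally have "G x (final x z) r = m" using ext_val_limit(2)[OF n, of r i] r by (simp add: i_def)
  then have "real m \<in> vals (ext_val x z)" using ext_val_limit(1)[OF n, of r] r by simp
  moreover have "vals (ext_val x z) = {seq_val (ext_val x z)}"
    by (rule vals_total[OF ext_val_in_digit_seqs]) (rule ext_val_total[OF z n])
  ultimately show ?thesis by (simp add: S_app_extension[OF xD zD])
qed

end

text \<open>A second locale, because the assumption speaks of \<open>stable\<close>, which is
  defined in the first.\<close>

locale stable_coordinates = coordinates +
  assumes ex_stable: "x \<in> N_total (Suc k) \<Longrightarrow> z \<in> S_total k \<Longrightarrow> (\<And>n c. c \<in> C n \<Longrightarrow> rho_S (q c z) \<in> \<nat>)
    \<Longrightarrow> \<exists>m. stable x z m"
begin

text \<open>Equivalent elements have equal entries and hence the same functions \<open>G\<close>, so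
  \<open>ext_val_sim\<close> applies. Both results are maximal because every total \<open>z\<close>
  falls under the natural or the non-natural case.\<close>

lemma extension_eq:
  assumes xx: "N_eq (Suc k) x x'"
  shows "S_eq (Suc k) (extension x) (extension x')"
proof -
  have x: "x \<in> N_total (Suc k)" "x' \<in> N_total (Suc k)" using N_eq_refl[OF xx] N_total_iff by blast+
  then have xD: "x \<in> elems (N_dom (Suc k))" "x' \<in> elems (N_dom (Suc k))" by (auto simp: N_total_def)
  have G: "G x = G x'"
  proof
    fix n show "G x n = G x' n"
    proof (rule interp_cong)
      fix i t assume t: "t \<in> tables (C i) i"
      have "N_eq0 (N_app k x (e i t)) (N_app k x' (e i t))" using xx e_total[OF t] e_elems[OF t] by simp
      then show "entry x i t = entry x' i t" by (auto simp: entry_def N_eq0_def)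
    qed
  qed
  have mx: "maximal_in S_ground (Ground (ext_val y z))" if y: "y \<in> N_total (Suc k)" and z: "z \<in> S_total k" for y z
  proof -
    have "\<exists>n. settled y z n"
    proof (cases "\<forall>n. \<forall>c\<in>C n. rho_S (q c z) \<in> \<nat>")
      case True
      then show ?thesis using ex_stable[OF y z] stable_settled by blast
    next
      case False
      then show ?thesis using nonnat_settled[OF _ z] y by (auto simp: N_total_def)
    qed
    then obtain n where "ready y z n" using settled_ready[OF y z] by blast
    then show ?thesis
      unfolding maximal_S_ground_iff using ext_val_total[OF z] ext_val_in_digit_seqs by blast
  qed
  have "S_eq0 (S_app k (extension x) z) (S_app k (extension x') z')" if zz: "S_eq k z z'" for z z'
  proof -
    have z: "z \<in> S_total k" "z' \<in> S_total k" using S_eq_refl[OF zz] S_total_iff by blast+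
    then have zD: "z \<in> elems (S_dom k)" "z' \<in> elems (S_dom k)" by (auto simp: S_total_def)
    have "S_sim0 (Ground (ext_val x z)) (Ground (ext_val x' z'))"
      by (rule ext_val_sim[OF G zD]) (use q_eq zz in \<open>auto simp: S_eq0_def\<close>)
    then show ?thesis using mx x z by (simp add: S_eq0_def S_app_extension xD zD)
  qed
  then show ?thesis using extension_elems xD by simp
qed

end

section \<open>Tables at higher types\<close>

text \<open>A partial \<open>a\<close> gets the value on which all tables compatible with it agree.
  Unanimity is monotone, since more information leaves fewer compatible tables.\<close>

definition table_fun :: "(nat option obj \<Rightarrow> nat option obj set) \<Rightarrow> (nat option obj \<Rightarrow> nat) \<Rightarrow>
    nat option obj \<Rightarrow> nat option obj" where
  "table_fun K t a = (if \<exists>v. \<forall>c\<in>K a. t c = v then Ground (Some (THE v. \<forall>c\<in>K a. t c = v)) else Ground None)"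

text \<open>
  \<open>comp_tables k n a\<close> consists of the tables of stage \<open>n\<close> that are compatible with the information in
  the possibly partial element \<open>a\<close> of \<open>N(k)\<close>.
\<close>

primrec comp_tables :: "nat \<Rightarrow> nat \<Rightarrow> nat option obj \<Rightarrow> nat option obj set" where
  "comp_tables 0 = (\<lambda>n a. {Ground (Some v) | v. v \<le> n \<and> (\<forall>w. a = Ground (Some w) \<longrightarrow> v = min w n)})"
| "comp_tables (Suc k) = (\<lambda>n f. {N_lam k (table_fun (comp_tables k n) t) | t.
     t \<in> tables (\<Union>(comp_tables k n ` elems (N_dom k))) n \<and>
     (\<forall>c\<in>\<Union>(comp_tables k n ` elems (N_dom k)). \<forall>w. N_app k f c = Ground (Some w) \<longrightarrow> t c = min w n)})"

text \<open>Over all \<open>n\<close> these finite sets form a dense set of total elements: totality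
  is \<open>grid_total\<close>, density comes from \<open>comp_tables_above_compact\<close>.\<close>

definition grid :: "nat \<Rightarrow> nat \<Rightarrow> nat option obj set" where
  "grid k n = \<Union>(comp_tables k n ` elems (N_dom k))"

definition table :: "nat \<Rightarrow> nat \<Rightarrow> (nat option obj \<Rightarrow> nat) \<Rightarrow> nat option obj" where
  "table k n t = N_lam k (table_fun (comp_tables k n) t)"

lemma comp_tables_Suc:
  "comp_tables (Suc k) n f = {table k n t | t. t \<in> tables (grid k n) n \<and>
     (\<forall>c\<in>grid k n. \<forall>w. N_app k f c = Ground (Some w) \<longrightarrow> t c = min w n)}"
  by (simp add: grid_def table_def)

declare comp_tables.simps(2) [simp del]

lemma comp_tables_subset_grid: "a \<in> elems (N_dom k) \<Longrightarrow> comp_tables k n a \<subseteq> grid k n"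
  by (auto simp: grid_def)

lemma grid_Suc: "grid (Suc k) n \<subseteq> table k n ` tables (grid k n) n"
  unfolding grid_def[of "Suc k"] comp_tables_Suc by auto

lemma finite_grid: "finite (grid k n)"
proof (induction k)
  case 0
  have "grid 0 n \<subseteq> (\<lambda>v. Ground (Some v)) ` {..n}" by (auto simp: grid_def)
  then show ?case by (rule finite_subset) simp
next
  case (Suc k)
  then show ?case by (blast intro: finite_subset[OF grid_Suc] finite_imageI finite_tables)
qed

lemma comp_tables_nonempty: "comp_tables k n a \<noteq> {}"
proof (cases k)
  case 0
  then show ?thesis by (cases "\<exists>w. a = Ground (Some w)") auto
next
  case (Suc j)
  define t where "t = restrict (\<lambda>c. min (case gval (N_app j a c) of None \<Rightarrow> 0 | Some w \<Rightarrow> w) n) (grid j n)"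
  have "t \<in> tables (grid j n) n" by (auto simp: t_def tables_def)
  moreover have "\<forall>c\<in>grid j n. \<forall>w. N_app j a c = Ground (Some w) \<longrightarrow> t c = min w n" by (simp add: t_def)
  ultimately show ?thesis unfolding Suc comp_tables_Suc by blast
qed

lemma openin_finite_Collect:
  assumes "finite I" "\<And>i. i \<in> I \<Longrightarrow> openin (scott_topology D) {x \<in> elems D. P i x}"
  shows "openin (scott_topology D) {x \<in> elems D. \<forall>i\<in>I. P i x}"
proof -
  have "openin (scott_topology D) ((\<Inter>i\<in>I. {x \<in> elems D. P i x}) \<inter> topspace (scott_topology D))"
    by (rule openin_INT[OF assms])
  moreover have "(\<Inter>i\<in>I. {x \<in> elems D. P i x}) \<inter> topspace (scott_topology D) = {x \<in> elems D. \<forall>i\<in>I. P i x}"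
    by (auto simp: topspace_scott_topology)
  ultimately show ?thesis by simp
qed

lemma openin_elems: "openin (scott_topology D) (elems D)"
  by (metis openin_topspace topspace_scott_topology)

text \<open>Compatibility depends on finitely many defined values of \<open>a\<close>, and the set
  of compatible tables only shrinks when more become defined. The hypothesis on the grid is supplied
  by the induction in \<open>table_props\<close>.\<close>

lemma openin_comp_tables:
  assumes grid: "\<And>j. k = Suc j \<Longrightarrow> grid j n \<subseteq> elems (N_dom j)"
  shows "openin (scott_topology (N_dom k)) {a \<in> elems (N_dom k). comp_tables k n a \<subseteq> P}"
proof (subst openin_subopen, intro ballI)
  fix a assume "a \<in> {a \<in> elems (N_dom k). comp_tables k n a \<subseteq> P}"
  then have a: "a \<in> elems (N_dom k)" "comp_tables k n a \<subseteq> P" by auto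
  have "\<exists>T. openin (scott_topology (N_dom k)) T \<and> a \<in> T \<and> (\<forall>a'\<in>T. comp_tables k n a' \<subseteq> comp_tables k n a)"
  proof (cases k)
    case 0
    then obtain w where w: "a = Ground w" using a by (auto simp: N_ground_simps)
    show ?thesis
    proof (cases w)
      case None
      then show ?thesis using openin_elems[of "N_dom k"] a 0 w by (intro exI[of _ "elems (N_dom k)"]) auto
    next
      case (Some v)
      then show ?thesis using openin_N_ground[of v] 0 w by (intro exI[of _ "{a}"]) auto
    qed
  next
    case (Suc j)
    define I where "I = {c \<in> grid j n. N_app j a c \<noteq> Ground None}"
    define T where "T = {f \<in> elems (N_dom (Suc j)). \<forall>c\<in>I. N_app j f c = N_app j a c}"
    have "openin (scott_topology (N_dom (Suc j))) T"
      unfolding T_def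
    proof (rule openin_finite_Collect)
      show "finite I" using finite_grid by (simp add: I_def)
      fix c assume c: "c \<in> I"
      then have cD: "c \<in> elems (N_dom j)" using grid[OF Suc] by (auto simp: I_def)
      then obtain v where "N_app j a c = Ground (Some v)"
        using N_app_elems[of a j c] a c Suc by (auto simp: N_ground_simps I_def)
      then show "openin (scott_topology (N_dom (Suc j))) {f \<in> elems (N_dom (Suc j)). N_app j f c = N_app j a c}"
        using openin_value[OF N_eval_continuous[OF cD]] by simp
    qed
    moreover have "comp_tables k n f \<subseteq> comp_tables k n a" if "f \<in> T" for f
      using that unfolding Suc comp_tables_Suc T_def I_def by force
    moreover have "a \<in> T" using a Suc by (simp add: T_def)
    ultimately show ?thesis using Suc by blast
  qed
  then obtain T where T: "openin (scott_topology (N_dom k)) T" "a \<in> T"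
    "\<forall>a'\<in>T. comp_tables k n a' \<subseteq> comp_tables k n a" by blast
  then have "T \<subseteq> {a \<in> elems (N_dom k). comp_tables k n a \<subseteq> P}"
    using a(2) openin_scott_subset[OF T(1)] by blast
  then show "\<exists>T. openin (scott_topology (N_dom k)) T \<and> a \<in> T \<and> T \<subseteq> {a \<in> elems (N_dom k). comp_tables k n a \<subseteq> P}"
    using T by blast
qed

lemma table_fun_iff: "table_fun (comp_tables k n) t a = Ground (Some v) \<longleftrightarrow> (\<forall>c\<in>comp_tables k n a. t c = v)"
proof -
  obtain c where c: "c \<in> comp_tables k n a" using comp_tables_nonempty by blast
  have "(THE v. \<forall>c\<in>comp_tables k n a. t c = v) = v" if "\<forall>c\<in>comp_tables k n a. t c = v" for v
    using that c by (intro the_equality) auto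
  then show ?thesis unfolding table_fun_def by (auto simp del: split_paired_All)
qed

lemma table_totalI:
  assumes cont: "continuous_map (scott_topology (N_dom k)) (scott_topology N_ground) (table_fun (comp_tables k n) t)"
    and uniq: "\<And>a b. N_eq k a b \<Longrightarrow> \<exists>c. comp_tables k n a = {c} \<and> comp_tables k n b = {c}"
  shows "N_eq (Suc k) (table k n t) (table k n t)"
proof -
  have "N_eq0 (N_app k (table k n t) a) (N_app k (table k n t) b)" if ab: "N_eq k a b" for a b
  proof -
    obtain c where c: "comp_tables k n a = {c}" "comp_tables k n b = {c}" using uniq[OF ab] by blast
    have "table_fun (comp_tables k n) t a = Ground (Some (t c))" "table_fun (comp_tables k n) t b = Ground (Some (t c))"
      unfolding table_fun_iff using c by auto
    then show ?thesis using N_eq_elems[OF ab] N_app_lam[OF cont] by (simp add: table_def N_eq0_def)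
  qed
  then show ?thesis using N_lam_elems[OF cont] by (simp add: table_def)
qed

text \<open>The claims feed each other: totality of the tables at \<open>Suc k\<close> rests on
  continuity and uniqueness at \<open>k\<close>, and uniqueness at \<open>Suc k\<close> on totality
  of the grid at \<open>k\<close>, where equivalent functions have equal defined values.\<close>

lemma table_props:
  "(\<forall>c\<in>grid k n. N_eq k c c) \<and> (\<forall>a b. N_eq k a b \<longrightarrow> (\<exists>c. comp_tables k n a = {c} \<and> comp_tables k n b = {c})) \<and>
   continuous_map (scott_topology (N_dom k)) (scott_topology N_ground) (table_fun (comp_tables k n) t)"
proof (induction k arbitrary: t)
  case 0
  have "continuous_map (scott_topology (N_dom 0)) (scott_topology N_ground) (table_fun (comp_tables 0 n) t)"
    unfolding continuous_map_N_ground_iff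
  proof (intro conjI allI)
    show "table_fun (comp_tables 0 n) t ` elems (N_dom 0) \<subseteq> elems N_ground"
      by (auto simp: table_fun_def N_ground_simps)
    show "openin (scott_topology (N_dom 0)) {a \<in> elems (N_dom 0). table_fun (comp_tables 0 n) t a = Ground (Some v)}" for v
      using openin_comp_tables[of 0 n "{c. t c = v}"] unfolding table_fun_iff by (simp add: subset_iff Ball_def)
  qed
  moreover have "\<exists>c. comp_tables 0 n a = {c} \<and> comp_tables 0 n b = {c}" if "N_eq 0 a b" for a b
    using that by (auto simp: N_eq0_def)
  ultimately show ?case by (auto simp: grid_def N_eq0_def)
next
  case (Suc k)
  have gE: "grid k n \<subseteq> elems (N_dom k)" using Suc N_eq_elems by blast
  have "N_eq (Suc k) (table k n s) (table k n s)" for s by (rule table_totalI) (use Suc in blast)+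
  then have gt: "\<forall>c\<in>grid (Suc k) n. N_eq (Suc k) c c" using grid_Suc[of k n] by blast
  moreover have "\<exists>c. comp_tables (Suc k) n f = {c} \<and> comp_tables (Suc k) n g = {c}" if fg: "N_eq (Suc k) f g" for f g
  proof -
    have "\<exists>w. N_app k f c = Ground (Some w) \<and> N_app k g c = Ground (Some w)" if c: "c \<in> grid k n" for c
    proof -
      have "N_eq0 (N_app k f c) (N_app k g c)" using fg Suc c gE by (simp add: subset_iff)
      then show ?thesis by (auto simp: N_eq0_def)
    qed
    then obtain w where w: "\<And>c. c \<in> grid k n \<Longrightarrow> N_app k f c = Ground (Some (w c)) \<and> N_app k g c = Ground (Some (w c))"
      by metis
    define s where "s = restrict (\<lambda>c. min (w c) n) (grid k n)"
    have iff: "(t \<in> tables (grid k n) n \<and> (\<forall>c\<in>grid k n. \<forall>v. N_app k h c = Ground (Some v) \<longrightarrow> t c = min v n)) \<longleftrightarrow> t = s"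
      if "\<forall>c\<in>grid k n. N_app k h c = Ground (Some (w c))" for h t
    proof
      assume t: "t \<in> tables (grid k n) n \<and> (\<forall>c\<in>grid k n. \<forall>v. N_app k h c = Ground (Some v) \<longrightarrow> t c = min v n)"
      show "t = s"
      proof (rule extensionalityI)
        show "t \<in> extensional (grid k n)" using t by (auto simp: tables_def PiE_def)
        show "s \<in> extensional (grid k n)" by (simp add: s_def)
      qed (use t that in \<open>simp add: s_def\<close>)
    next
      assume "t = s"
      then show "t \<in> tables (grid k n) n \<and> (\<forall>c\<in>grid k n. \<forall>v. N_app k h c = Ground (Some v) \<longrightarrow> t c = min v n)"
        using that by (auto simp: s_def tables_def)
    qed
    have "comp_tables (Suc k) n h = {table k n s}"
      if "\<forall>c\<in>grid k n. N_app k h c = Ground (Some (w c))" for h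
      unfolding comp_tables_Suc by (simp only: iff[OF that]) blast
    then show ?thesis using w by blast
  qed
  moreover have "continuous_map (scott_topology (N_dom (Suc k))) (scott_topology N_ground) (table_fun (comp_tables (Suc k) n) t)"
    unfolding continuous_map_N_ground_iff
  proof (intro conjI allI)
    show "table_fun (comp_tables (Suc k) n) t ` elems (N_dom (Suc k)) \<subseteq> elems N_ground"
      by (auto simp: table_fun_def N_ground_simps)
    show "openin (scott_topology (N_dom (Suc k)))
        {a \<in> elems (N_dom (Suc k)). table_fun (comp_tables (Suc k) n) t a = Ground (Some v)}" for v
      using openin_comp_tables[of "Suc k" n "{c. t c = v}"] gE unfolding table_fun_iff
      by (simp add: subset_iff Ball_def)
  qed
  ultimately show ?case by blast
qed

lemma grid_total: "c \<in> grid k n \<Longrightarrow> N_eq k c c"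
  using table_props by blast

lemma grid_elems: "c \<in> grid k n \<Longrightarrow> c \<in> elems (N_dom k)"
  using grid_total N_eq_elems by blast

lemmas table_fun_continuous = table_props[THEN conjunct2, THEN conjunct2]

lemma table_total: "N_eq (Suc k) (table k n t) (table k n t)"
  by (rule table_totalI) (use table_props in blast)+

lemma N_app_table:
  "a \<in> elems (N_dom k) \<Longrightarrow> N_app k (table k n t) a = Ground (Some v) \<longleftrightarrow> (\<forall>c\<in>comp_tables k n a. t c = v)"
  unfolding table_def by (simp add: N_app_lam[OF table_fun_continuous] table_fun_iff)

section \<open>Compact elements\<close>

lemma compact_in_basis:
  assumes D: "omega_algebraic D" and x: "x \<in> U" and U: "openin (scott_topology D) U"
  shows "\<exists>b\<in>U. compact_in D b \<and> below D b x"
proof -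
  obtain B where B: "omega_basis D B" using D by (auto simp: omega_algebraic_def)
  have "x \<in> elems D" using openin_scott_subset[OF U] x by blast
  then have "directed_in D {b \<in> B. below D b x}" "is_lub_in D {b \<in> B. below D b x} x"
    using B by (auto simp: omega_basis_def)
  then have "{b \<in> B. below D b x} \<inter> U \<noteq> {}" using U x unfolding openin_scott_topology scott_open_def by blast
  then show ?thesis using B unfolding omega_basis_def by blast
qed

lemma openin_above_compact:
  assumes D: "porder_on D" and b: "compact_in D b"
  shows "openin (scott_topology D) {a \<in> elems D. below D b a}"
  unfolding openin_scott_topology scott_open_def
proof (intro conjI allI impI ballI)
  show "y \<in> {a \<in> elems D. below D b a}" if "x \<in> {a \<in> elems D. below D b a}" "y \<in> elems D" "below D x y" for x y
    using that b porder_trans[OF D, of b x y] by (auto simp: compact_in_def)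
  show "X \<inter> {a \<in> elems D. below D b a} \<noteq> {}"
    if "directed_in D X" "is_lub_in D X s" "s \<in> {a \<in> elems D. below D b a}" for X s
    using that b unfolding compact_in_def directed_in_def by blast
qed auto

lemma N_app_mono:
  assumes "f \<in> elems (N_dom (Suc k))" "a \<in> elems (N_dom k)" "b \<in> elems (N_dom k)" "below (N_dom k) a b"
    "N_app k f a = Ground (Some v)"
  shows "N_app k f b = Ground (Some v)"
  using scott_continuous_mono[OF porder_N_dom porder_N_ground N_app_continuous[OF assms(1)] assms(2-4)] assms(5)
  by (simp add: N_ground_simps)

lemma N_below_app:
  assumes "below (N_dom (Suc k)) f g" "a \<in> elems (N_dom k)" "N_app k f a = Ground (Some v)"
  shows "N_app k g a = Ground (Some v)"
proof -
  have "below N_ground (N_app k f a) (N_app k g a)" using assms(1,2) unfolding N_below_Suc by blast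
  then show ?thesis using assms(3) by (auto simp: N_ground_simps)
qed

lemma N_below_SucI:
  assumes f: "f \<in> elems (N_dom (Suc k))"
    and "\<And>a v. a \<in> elems (N_dom k) \<Longrightarrow> N_app k f a = Ground (Some v) \<Longrightarrow> N_app k g a = Ground (Some v)"
  shows "below (N_dom (Suc k)) f g"
  unfolding N_below_Suc
proof
  fix a assume a: "a \<in> elems (N_dom k)"
  then obtain w where "N_app k f a = Ground w" using N_app_elems[OF f] by (auto simp: N_ground_simps)
  then show "below N_ground (N_app k f a) (N_app k g a)"
    using assms(2)[OF a] by (cases w) (auto simp: N_ground_simps)
qed

text \<open>\<open>f\<close> is the directed supremum of its restrictions \<open>h B\<close> to what
  lies above finitely many compact elements; by compactness it is below one of these
  restrictions.\<close>

lemma compact_steps: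
  assumes f: "compact_in (N_dom (Suc k)) f"
  shows "\<exists>B. finite B \<and> (\<forall>b\<in>B. compact_in (N_dom k) b) \<and>
    (\<forall>a\<in>elems (N_dom k). \<forall>v. N_app k f a = Ground (Some v) \<longrightarrow>
       (\<exists>b\<in>B. below (N_dom k) b a \<and> N_app k f b = Ground (Some v)))"
proof -
  let ?D = "N_dom k" and ?E = "N_dom (Suc k)"
  have fE: "f \<in> elems ?E" using f by (simp add: compact_in_def)
  define h where "h B a = (if \<exists>b\<in>B. below ?D b a \<and> N_app k f b \<noteq> Ground None then N_app k f a else Ground None)" for B a
  let ?fam = "{B. finite B \<and> (\<forall>b\<in>B. compact_in ?D b)}"
  have h_iff: "h B a = Ground (Some v) \<longleftrightarrow> (\<exists>b\<in>B. below ?D b a \<and> N_app k f b = Ground (Some v))"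
    if B: "B \<in> ?fam" and a: "a \<in> elems ?D" for B a v
  proof -
    have "N_app k f a = N_app k f b" if b: "b \<in> B" "below ?D b a" "N_app k f b \<noteq> Ground None" for b
    proof -
      have bD: "b \<in> elems ?D" using b(1) B by (auto simp: compact_in_def)
      then obtain w where "N_app k f b = Ground (Some w)"
        using N_app_elems[OF fE bD] b(3) by (auto simp: N_ground_simps)
      then show ?thesis using N_app_mono[OF fE bD a b(2)] by simp
    qed
    note eq = this
    show ?thesis
    proof
      assume "h B a = Ground (Some v)"
      then obtain b where "b \<in> B" "below ?D b a" "N_app k f b \<noteq> Ground None" "N_app k f a = Ground (Some v)"
        unfolding h_def by (auto split: if_splits)
      then show "\<exists>b\<in>B. below ?D b a \<and> N_app k f b = Ground (Some v)" using eq by metis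
    next
      assume "\<exists>b\<in>B. below ?D b a \<and> N_app k f b = Ground (Some v)"
      then obtain b where "b \<in> B" "below ?D b a" "N_app k f b = Ground (Some v)" by blast
      then show "h B a = Ground (Some v)" using eq[of b] unfolding h_def by auto
    qed
  qed
  have cont: "continuous_map (scott_topology ?D) (scott_topology N_ground) (h B)" if B: "B \<in> ?fam" for B
    unfolding continuous_map_N_ground_iff
  proof (intro conjI allI)
    show "h B ` elems ?D \<subseteq> elems N_ground" using N_app_elems[OF fE] by (auto simp: h_def N_ground_simps)
    fix v
    have "{a \<in> elems ?D. h B a = Ground (Some v)} =
        (\<Union>b\<in>{b \<in> B. N_app k f b = Ground (Some v)}. {a \<in> elems ?D. below ?D b a})"
      using h_iff[OF B] by auto
    moreover have "openin (scott_topology ?D) \<dots>"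
      by (rule openin_Union) (use B openin_above_compact[OF porder_N_dom] in auto)
    ultimately show "openin (scott_topology ?D) {a \<in> elems ?D. h B a = Ground (Some v)}" by simp
  qed
  define X where "X = (\<lambda>B. N_lam k (h B)) ` ?fam"
  have app: "N_app k (N_lam k (h B)) a = h B a" if "B \<in> ?fam" "a \<in> elems ?D" for B a
    using N_app_lam[OF cont[OF that(1)] that(2)] .
  have el: "N_lam k (h B) \<in> elems ?E" if "B \<in> ?fam" for B using N_lam_elems[OF cont[OF that]] .
  have "directed_in ?E X"
    unfolding directed_in_def
  proof (intro conjI ballI)
    show "X \<subseteq> elems ?E" using el by (auto simp: X_def)
    show "X \<noteq> {}" by (auto simp: X_def)
    fix x y assume "x \<in> X" "y \<in> X"
    then obtain A B where AB: "A \<in> ?fam" "B \<in> ?fam" "x = N_lam k (h A)" "y = N_lam k (h B)" by (auto simp: X_def)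
    then have u: "A \<union> B \<in> ?fam" by auto
    have "below ?E x (N_lam k (h (A \<union> B)))" "below ?E y (N_lam k (h (A \<union> B)))"
      unfolding AB(3,4) using AB(1,2) u el app h_iff by (auto intro!: N_below_SucI)
    then show "\<exists>z\<in>X. below ?E x z \<and> below ?E y z" using u by (auto simp: X_def)
  qed
  moreover have "is_lub_in ?E X f"
    unfolding is_lub_in_def
  proof (intro conjI ballI impI)
    show "f \<in> elems ?E" by (rule fE)
    show "below ?E x f" if x: "x \<in> X" for x
    proof -
      obtain B where B: "B \<in> ?fam" "x = N_lam k (h B)" using x by (auto simp: X_def)
      show ?thesis unfolding B(2)
        by (rule N_below_SucI[OF el[OF B(1)]]) (use app[OF B(1)] in \<open>auto simp: h_def split: if_splits\<close>)
    qed
    fix u assume ub: "\<forall>x\<in>X. below ?E x u"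
    show "below ?E f u"
    proof (rule N_below_SucI[OF fE])
      fix a v assume a: "a \<in> elems ?D" "N_app k f a = Ground (Some v)"
      \<comment> \<open>Continuity of \<open>f\<close> finds its value at \<open>a\<close> already
        at a compact element below \<open>a\<close>, so a single step accounts for it.\<close>
      obtain b where b: "compact_in ?D b" "below ?D b a" "N_app k f b = Ground (Some v)"
        using compact_in_basis[OF omega_algebraic_N_dom _ openin_value[OF N_app_continuous[OF fE]], of a] a by auto
      have B: "{b} \<in> ?fam" using b by simp
      have "N_app k (N_lam k (h {b})) a = Ground (Some v)" using app[OF B a(1)] h_iff[OF B a(1)] b by simp
      moreover have "below ?E (N_lam k (h {b})) u" using ub B by (auto simp: X_def)
      ultimately show "N_app k u a = Ground (Some v)" using N_below_app a(1) by blast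
    qed
  qed
  ultimately obtain x where "x \<in> X" "below ?E f x"
    using f porder_refl[OF porder_N_dom fE] unfolding compact_in_def by blast
  then obtain B where B: "B \<in> ?fam" "below ?E f (N_lam k (h B))" by (auto simp: X_def)
  have "\<exists>b\<in>B. below ?D b a \<and> N_app k f b = Ground (Some v)"
    if "a \<in> elems ?D" "N_app k f a = Ground (Some v)" for a v
    using N_below_app[OF B(2) that] app[OF B(1) that(1)] h_iff[OF B(1) that(1)] by simp
  then show ?thesis using B(1) by blast
qed

lemma ex_bound_finite:
  assumes "finite B" "\<And>b. b \<in> B \<Longrightarrow> \<exists>n0::nat. \<forall>n\<ge>n0. P b n"
  shows "\<exists>n0. \<forall>b\<in>B. \<forall>n\<ge>n0. P b n"
proof -
  obtain N where N: "\<And>b n. b \<in> B \<Longrightarrow> n \<ge> N b \<Longrightarrow> P b n" using assms(2) by metis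
  have "N b \<le> (\<Sum>b\<in>B. N b)" if "b \<in> B" for b using member_le_sum[OF that _ assms(1), of N] by simp
  then show ?thesis using N by (intro exI[of _ "\<Sum>b\<in>B. N b"]) (meson le_trans)
qed

text \<open>At higher type \<open>b\<close> is given by finitely many steps. For large
  \<open>n\<close>, the grid points compatible with an argument above a step are above that step
  too, and the step value is no longer cut off by \<open>n\<close>. So every compatible table
  reproduces the step.\<close>

lemma comp_tables_above_compact:
  assumes "compact_in (N_dom k) b"
  shows "\<exists>n0. \<forall>n\<ge>n0. \<forall>a\<in>elems (N_dom k). below (N_dom k) b a \<longrightarrow> (\<forall>c\<in>comp_tables k n a. below (N_dom k) b c)"
  using assms
proof (induction k arbitrary: b)
  case 0
  then obtain w where w: "b = Ground w" by (auto simp: compact_in_def N_ground_simps)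
  show ?case
  proof (cases w)
    case None
    then show ?thesis by (simp add: w N_ground_simps)
  next
    case (Some v)
    then show ?thesis by (intro exI[of _ v]) (auto simp: w N_ground_simps)
  qed
next
  case (Suc k)
  have bE: "b \<in> elems (N_dom (Suc k))" using Suc.prems by (simp add: compact_in_def)
  obtain B where B: "finite B" "\<And>b. b \<in> B \<Longrightarrow> compact_in (N_dom k) b"
    "\<And>a v. a \<in> elems (N_dom k) \<Longrightarrow> N_app k b a = Ground (Some v) \<Longrightarrow>
       \<exists>c\<in>B. below (N_dom k) c a \<and> N_app k b c = Ground (Some v)"
    using compact_steps[OF Suc.prems] by blast
  have "\<exists>n0. \<forall>n\<ge>n0. (\<forall>a\<in>elems (N_dom k). below (N_dom k) d a \<longrightarrow> (\<forall>c\<in>comp_tables k n a. below (N_dom k) d c)) \<and>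
      the (gval (N_app k b d)) \<le> n" if d: "d \<in> B" for d
  proof -
    obtain n0 where "\<forall>n\<ge>n0. \<forall>a\<in>elems (N_dom k). below (N_dom k) d a \<longrightarrow> (\<forall>c\<in>comp_tables k n a. below (N_dom k) d c)"
      using Suc.IH[OF B(2)[OF d]] by blast
    then show ?thesis by (intro exI[of _ "max n0 (the (gval (N_app k b d)))"]) auto
  qed
  then obtain n0 where n0: "\<forall>d\<in>B. \<forall>n\<ge>n0. (\<forall>a\<in>elems (N_dom k). below (N_dom k) d a \<longrightarrow>
      (\<forall>c\<in>comp_tables k n a. below (N_dom k) d c)) \<and> the (gval (N_app k b d)) \<le> n"
    using ex_bound_finite[OF B(1), where P = "\<lambda>d n. (\<forall>a\<in>elems (N_dom k). below (N_dom k) d a \<longrightarrow>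
      (\<forall>c\<in>comp_tables k n a. below (N_dom k) d c)) \<and> the (gval (N_app k b d)) \<le> n"] by blast
  show ?case
  proof (intro exI allI impI ballI)
    fix n g h assume n: "n \<ge> n0" and g: "g \<in> elems (N_dom (Suc k))" "below (N_dom (Suc k)) b g"
      and h: "h \<in> comp_tables (Suc k) n g"
    obtain t where t: "h = table k n t" "\<And>c w. c \<in> grid k n \<Longrightarrow> N_app k g c = Ground (Some w) \<Longrightarrow> t c = min w n"
      using h unfolding comp_tables_Suc by blast
    show "below (N_dom (Suc k)) b h"
    proof (rule N_below_SucI[OF bE])
      fix a v assume a: "a \<in> elems (N_dom k)" "N_app k b a = Ground (Some v)"
      obtain d where d: "d \<in> B" "below (N_dom k) d a" "N_app k b d = Ground (Some v)" using B(3)[OF a] by blast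
      have dD: "d \<in> elems (N_dom k)" using B(2)[OF d(1)] by (simp add: compact_in_def)
      have nd: "(\<forall>a\<in>elems (N_dom k). below (N_dom k) d a \<longrightarrow> (\<forall>c\<in>comp_tables k n a. below (N_dom k) d c)) \<and>
        the (gval (N_app k b d)) \<le> n" using n0 d(1) n by blast
      have "t c = v" if c: "c \<in> comp_tables k n a" for c
      proof -
        have cg: "c \<in> grid k n" using comp_tables_subset_grid[OF a(1)] c by blast
        have "below (N_dom k) d c" using nd a(1) d(2) c by blast
        then have "N_app k b c = Ground (Some v)" using N_app_mono[OF bE dD grid_elems[OF cg] _ d(3)] by blast
        then have "N_app k g c = Ground (Some v)" using N_below_app[OF g(2) grid_elems[OF cg]] by blast
        then show ?thesis using t(2)[OF cg] nd d(3) by simp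
      qed
      then show "N_app k h a = Ground (Some v)" unfolding t(1) N_app_table[OF a(1)] by blast
    qed
  qed
qed

section \<open>Coordinates through an embedding of lower type\<close>

lemma openin_prefix:
  assumes f: "continuous_map (scott_topology D) (scott_topology S_ground) f"
  shows "openin (scott_topology D) {a \<in> elems D. s |` {..<j} \<subseteq>\<^sub>m gval (f a)}"
proof -
  have "openin (scott_topology D)
      {a \<in> elems D. \<forall>i\<in>{i. i < j \<and> s i \<noteq> None}. gval (f a) i = Some (the (s i))}"
    by (rule openin_finite_Collect) (auto intro: openin_digit[OF f])
  moreover have "s |` {..<j} \<subseteq>\<^sub>m g \<longleftrightarrow> (\<forall>i\<in>{i. i < j \<and> s i \<noteq> None}. g i = Some (the (s i)))" for g
    by (auto simp: map_le_def restrict_map_def dom_def split: if_splits)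
  ultimately show ?thesis by simp
qed

lemma vals_prefix_mono:
  assumes "s |` {..<j} \<subseteq>\<^sub>m s'" "j \<le> n"
  shows "vals (s' |` {..<n}) \<subseteq> vals (s |` {..<j})"
proof (rule vals_antimono, rule map_leI)
  fix i v assume "(s |` {..<j}) i = Some v"
  moreover from this have "i < j" by (auto simp: restrict_map_def split: if_splits)
  ultimately show "(s' |` {..<n}) i = Some v" using map_le_SomeD[OF assms(1)] assms(2) by simp
qed

lemma S_sim_refl: "x \<in> elems (S_dom k) \<Longrightarrow> S_sim k x x"
proof (cases k)
  case 0
  assume "x \<in> elems (S_dom k)"
  then have "x = Ground (gval x)" "gval x \<in> digit_seqs" using S_ground_elemD[of x] by (simp_all add: 0 S_dom_0)
  then show ?thesis using vals_nonempty S_sim0_iff_vals[of "gval x" "gval x"] by (simp add: 0 S_sim_0)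
next
  case (Suc j)
  assume x: "x \<in> elems (S_dom k)"
  then have "S_app j x \<in> sim_maps (S_dom j) (S_sim j)" using S_app_sim_maps Suc by blast
  then show ?thesis using x unfolding Suc S_sim_Suc by (auto simp: sim_maps_def)
qed

text \<open>The induction needs preservation of equivalence and not just of totality: it makes a
  total \<open>z\<close> take equal reals at the images of equivalent elements.\<close>

definition total_map :: "nat \<Rightarrow> (nat option obj \<Rightarrow> (nat \<rightharpoonup> int) obj) \<Rightarrow> bool" where
  "total_map k p \<longleftrightarrow> continuous_map (scott_topology (N_dom k)) (scott_topology (S_dom k)) p \<and>
     (\<forall>a b. N_eq k a b \<longrightarrow> S_eq k (p a) (p b))"

text \<open>Decided by a finite prefix and hence open. The radius \<open>1/4\<close> makes
  \<open>v\<close> unique and is the one that \<open>hat_pos_unique\<close> asks for.\<close>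

definition near :: "(nat \<rightharpoonup> int) \<Rightarrow> nat \<Rightarrow> bool" where
  "near s v \<longleftrightarrow> (\<exists>j. vals (s |` {..<j}) \<subseteq> {r. \<bar>r - real v\<bar> \<le> 1/4})"

lemma near_unique:
  assumes "s \<in> digit_seqs" "near s v" "near s w"
  shows "v = w"
proof -
  obtain r where "r \<in> vals s" using vals_nonempty[OF assms(1)] by blast
  then have "\<bar>r - real v\<bar> \<le> 1/4" "\<bar>r - real w\<bar> \<le> 1/4"
    using assms(2,3) vals_subset_restrict unfolding near_def by blast+
  then show ?thesis by linarith
qed

lemma near_of_total:
  assumes "s \<in> digit_seqs" "\<And>n. s n \<noteq> None" "seq_val s = real v"
  shows "near s v"
proof -
  obtain j where "vals (s |` {..<j}) \<subseteq> ball (real v) (1/4)"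
    using open_vals_prefix[OF assms(1,2), of "ball (real v) (1/4)"] assms(3) by auto
  moreover have "ball (real v) (1/4) \<subseteq> {r. \<bar>r - real v\<bar> \<le> 1/4}" by (auto simp: dist_real_def abs_minus_commute)
  ultimately show ?thesis unfolding near_def by blast
qed

text \<open>In general a partial element only; in the natural case \<open>round_total\<close> makes
  it total.\<close>

definition round_fun :: "nat \<Rightarrow> (nat option obj \<Rightarrow> (nat \<rightharpoonup> int) obj) \<Rightarrow> nat option obj" where
  "round_fun k f = N_lam k (\<lambda>a. if \<exists>v. near (gval (f a)) v then Ground (Some (THE v. near (gval (f a)) v)) else Ground None)"

lemma
  assumes f: "continuous_map (scott_topology (N_dom k)) (scott_topology S_ground) f"
  shows round_fun_elems: "round_fun k f \<in> elems (N_dom (Suc k))"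
    and N_app_round_fun: "a \<in> elems (N_dom k) \<Longrightarrow> N_app k (round_fun k f) a = Ground (Some v) \<longleftrightarrow> near (gval (f a)) v"
proof -
  let ?g = "\<lambda>a. if \<exists>v. near (gval (f a)) v then Ground (Some (THE v. near (gval (f a)) v)) else Ground None"
  have ds: "gval (f a) \<in> digit_seqs" if "a \<in> elems (N_dom k)" for a
    using S_ground_elemD[OF scott_continuous_elems[OF f that]] by blast
  have g: "?g a = Ground (Some v) \<longleftrightarrow> near (gval (f a)) v" if a: "a \<in> elems (N_dom k)" for a v
  proof -
    have "(THE v. near (gval (f a)) v) = w" if "near (gval (f a)) w" for w
      using that near_unique[OF ds[OF a]] by blast
    then show ?thesis by auto
  qed
  have cont: "continuous_map (scott_topology (N_dom k)) (scott_topology N_ground) ?g"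
    unfolding continuous_map_N_ground_iff
  proof (intro conjI allI)
    show "?g ` elems (N_dom k) \<subseteq> elems N_ground" by (auto simp: N_ground_simps)
    fix v
    show "openin (scott_topology (N_dom k)) {a \<in> elems (N_dom k). ?g a = Ground (Some v)}"
    proof (subst openin_subopen, intro ballI)
      fix a assume "a \<in> {a \<in> elems (N_dom k). ?g a = Ground (Some v)}"
      then have a: "a \<in> elems (N_dom k)" "near (gval (f a)) v" using g by auto
      then obtain j where j: "vals (gval (f a) |` {..<j}) \<subseteq> {r. \<bar>r - real v\<bar> \<le> 1/4}" unfolding near_def by blast
      let ?T = "{b \<in> elems (N_dom k). gval (f a) |` {..<j} \<subseteq>\<^sub>m gval (f b)}"
      have "near (gval (f b)) v" if "b \<in> ?T" for b
        using that j vals_prefix_mono[of "gval (f a)" j "gval (f b)" j] unfolding near_def by blast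
      then have "?T \<subseteq> {a \<in> elems (N_dom k). ?g a = Ground (Some v)}" using g by blast
      moreover have "a \<in> ?T" using a restrict_map_le by blast
      ultimately show "\<exists>T. openin (scott_topology (N_dom k)) T \<and> a \<in> T \<and>
          T \<subseteq> {a \<in> elems (N_dom k). ?g a = Ground (Some v)}"
        using openin_prefix[OF f] by blast
    qed
  qed
  show "round_fun k f \<in> elems (N_dom (Suc k))" unfolding round_fun_def by (rule N_lam_elems[OF cont])
  show "N_app k (round_fun k f) a = Ground (Some v) \<longleftrightarrow> near (gval (f a)) v" if "a \<in> elems (N_dom k)"
    unfolding round_fun_def N_app_lam[OF cont that] by (rule g[OF that])
qed

section \<open>The step from type \<open>k\<close> to type \<open>k + 2\<close>\<close>

context
  fixes k :: nat and p :: "nat option obj \<Rightarrow> (nat \<rightharpoonup> int) obj"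
  assumes p: "total_map k p"
begin

lemma p_elems: "a \<in> elems (N_dom k) \<Longrightarrow> p a \<in> elems (S_dom k)"
  using p scott_continuous_elems[of "N_dom k" "S_dom k" p a] by (simp add: total_map_def)

lemma comp_p_continuous:
  assumes "z \<in> elems (S_dom (Suc k))"
  shows "continuous_map (scott_topology (N_dom k)) (scott_topology S_ground) (\<lambda>a. S_app k z (p a))"
  using continuous_map_compose[OF _ S_app_continuous[OF assms], of _ p] p by (simp add: total_map_def comp_def)

lemma coordinates_Suc: "coordinates (Suc k) (grid k) (\<lambda>c z. S_app k z (p c)) (table k)"
proof
  show "finite (grid k n)" for n by (rule finite_grid)
  fix n c assume c: "c \<in> grid k n"
  then have pc: "p c \<in> elems (S_dom k)" using p_elems grid_elems by blast
  then show "continuous_map (scott_topology (S_dom (Suc k))) (scott_topology S_ground) (\<lambda>z. S_app k z (p c))"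
    by (rule S_eval_continuous)
  show "S_sim0 (S_app k z (p c)) (S_app k z' (p c))" if "S_sim (Suc k) z z'" for z z'
    using that S_sim_refl[OF pc] pc unfolding S_sim_Suc by blast
  have "S_eq k (p c) (p c)" using p grid_total[OF c] by (simp add: total_map_def)
  then show "S_eq0 (S_app k z (p c)) (S_app k z' (p c))" if "S_eq (Suc k) z z'" for z z'
    using that pc by simp
next
  show "N_eq (Suc k) (table k n t) (table k n t)" for n t by (rule table_total)
qed

text \<open>The natural numbers are closed in the reals. A non-natural value at \<open>a\<close>
  would thus persist on a neighbourhood of \<open>a\<close>, and by density this contains a grid
  point, where the value is natural.\<close>

lemma round_total:
  assumes z: "z \<in> S_total (Suc k)" and nat: "\<forall>n. \<forall>c\<in>grid k n. rho_S (S_app k z (p c)) \<in> \<nat>"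
    and ab: "N_eq k a b"
  shows "\<exists>v. N_app k (round_fun k (\<lambda>a. S_app k z (p a))) a = Ground (Some v) \<and>
    N_app k (round_fun k (\<lambda>a. S_app k z (p a))) b = Ground (Some v) \<and> rho_S (S_app k z (p a)) = real v"
proof -
  have zD: "z \<in> elems (S_dom (Suc k))" using z by (simp add: S_total_def)
  note cont = comp_p_continuous[OF zD]
  have zz: "S_eq0 (S_app k z (p a)) (S_app k z (p b))" if "N_eq k a b" for a b
    using z p p_elems N_eq_elems[OF that] that by (simp add: S_total_iff total_map_def)
  obtain s t where st: "S_app k z (p a) = Ground s" "S_app k z (p b) = Ground t" "s \<in> digit_seqs" "t \<in> digit_seqs"
    "\<And>n. s n \<noteq> None" "\<And>n. t n \<noteq> None" "seq_val s = seq_val t"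
    using zz[OF ab] unfolding S_eq0_iff by blast
  have aD: "a \<in> elems (N_dom k)" "b \<in> elems (N_dom k)" using N_eq_elems[OF ab] by blast+
  have "seq_val s \<in> \<nat>"
  proof (rule ccontr)
    assume "seq_val s \<notin> \<nat>"
    then obtain j where j: "vals (s |` {..<j}) \<subseteq> - \<nat>"
      using open_vals_prefix[OF st(3,5), of "- \<nat>"] closed_Nats by (auto simp: open_Compl)
    let ?T = "{a' \<in> elems (N_dom k). s |` {..<j} \<subseteq>\<^sub>m gval (S_app k z (p a'))}"
    have T: "openin (scott_topology (N_dom k)) ?T" by (rule openin_prefix[OF cont])
    have aT: "a \<in> ?T" using aD st(1) restrict_map_le by simp
    obtain d where d: "d \<in> ?T" "compact_in (N_dom k) d" "below (N_dom k) d a"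
      using compact_in_basis[OF omega_algebraic_N_dom aT T] by blast
    obtain n where n: "\<forall>c\<in>comp_tables k n a. below (N_dom k) d c"
      using comp_tables_above_compact[OF d(2)] aD(1) d(3) by blast
    obtain c where c: "c \<in> comp_tables k n a" using comp_tables_nonempty by blast
    have cg: "c \<in> grid k n" using comp_tables_subset_grid[OF aD(1)] c by blast
    have "c \<in> ?T" by (rule open_upward[OF T d(1) grid_elems[OF cg]]) (use n c in blast)
    moreover obtain u where u: "S_app k z (p c) = Ground u" "u \<in> digit_seqs" "\<And>n. u n \<noteq> None"
      using zz[OF grid_total[OF cg]] unfolding S_eq0_iff by blast
    ultimately have "s |` {..<j} \<subseteq>\<^sub>m u" by simp
    then have "seq_val u \<in> vals (s |` {..<j})" using vals_antimono vals_total[OF u(2,3)] by blast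
    moreover have "seq_val u \<in> \<nat>" using nat cg u(1) rho_S_Ground by metis
    ultimately show False using j by blast
  qed
  then obtain v where v: "seq_val s = real v" by (auto elim: Nats_cases)
  have "near s v" "near t v" using near_of_total st v by auto
  then show ?thesis using N_app_round_fun[OF cont] aD st v by auto
qed

text \<open>By continuity \<open>x\<close> needs only a compact part \<open>y0\<close> of the
  rounded function, consisting of finitely many steps. Near \<open>z\<close> and at late stages
  every plausible table lies above \<open>y0\<close>, and so has the value \<open>m\<close> under
  each nearby \<open>x'\<close>.\<close>

lemma stable_Suc:
  assumes x: "x \<in> N_total (Suc (Suc k))" and z: "z \<in> S_total (Suc k)"
    and nat: "\<forall>n. \<forall>c\<in>grid k n. rho_S (S_app k z (p c)) \<in> \<nat>"
  shows "N_eq (Suc k) (round_fun k (\<lambda>a. S_app k z (p a))) (round_fun k (\<lambda>a. S_app k z (p a)))"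
    and "N_app (Suc k) x (round_fun k (\<lambda>a. S_app k z (p a))) = Ground (Some m) \<Longrightarrow>
      coordinates.stable (Suc k) (grid k) (\<lambda>c z. S_app k z (p c)) (table k) x z m"
proof -
  interpret coordinates "Suc k" "grid k" "\<lambda>c z. S_app k z (p c)" "table k" by (rule coordinates_Suc)
  have zD: "z \<in> elems (S_dom (Suc k))" and xD: "x \<in> elems (N_dom (Suc (Suc k)))"
    using z x by (simp_all add: S_total_def N_total_def)
  define y where "y = round_fun k (\<lambda>a. S_app k z (p a))"
  note cont = comp_p_continuous[OF zD]
  have yD: "y \<in> elems (N_dom (Suc k))" unfolding y_def by (rule round_fun_elems[OF cont])
  show "N_eq (Suc k) y y"
    unfolding N_eq.simps N_eq0_def using yD round_total[OF z nat] unfolding y_def by blast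
  assume xy: "N_app (Suc k) x y = Ground (Some m)"
  then have "y \<in> {y \<in> elems (N_dom (Suc k)). N_app (Suc k) x y = Ground (Some m)}" using yD by simp
  then obtain y0 where y0: "y0 \<in> elems (N_dom (Suc k))" "N_app (Suc k) x y0 = Ground (Some m)"
    "compact_in (N_dom (Suc k)) y0" "below (N_dom (Suc k)) y0 y"
    using compact_in_basis[OF omega_algebraic_N_dom _ openin_value[OF N_app_continuous[OF xD]], of y] by blast
  obtain B0 where B0: "finite B0" "\<And>b. b \<in> B0 \<Longrightarrow> compact_in (N_dom k) b"
    "\<And>a v. a \<in> elems (N_dom k) \<Longrightarrow> N_app k y0 a = Ground (Some v) \<Longrightarrow>
       \<exists>c\<in>B0. below (N_dom k) c a \<and> N_app k y0 c = Ground (Some v)"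
    using compact_steps[OF y0(3)] by blast
  define B where "B = {b \<in> B0. N_app k y0 b \<noteq> Ground None}"
  have B: "finite B" using B0 by (simp add: B_def)
  have BD: "b \<in> elems (N_dom k)" "compact_in (N_dom k) b" if "b \<in> B" for b
    using that B0(2) by (auto simp: B_def compact_in_def)
  have "\<exists>w. N_app k y0 b = Ground (Some w)" if b: "b \<in> B" for b
    using N_app_elems[OF y0(1) BD(1)[OF b]] b by (auto simp: B_def N_ground_simps)
  then obtain w where w: "\<And>b. b \<in> B \<Longrightarrow> N_app k y0 b = Ground (Some (w b))" by metis
  have "near (gval (S_app k z (p b))) (w b)" if b: "b \<in> B" for b
    using N_below_app[OF y0(4) BD(1)[OF b] w[OF b]] N_app_round_fun[OF cont BD(1)[OF b]] by (simp add: y_def)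
  then obtain j where j: "\<And>b. b \<in> B \<Longrightarrow>
      vals (gval (S_app k z (p b)) |` {..<j b}) \<subseteq> {r. \<bar>r - real (w b)\<bar> \<le> 1/4}"
    unfolding near_def by metis
  have "\<exists>n0. \<forall>n\<ge>n0. (\<forall>a\<in>elems (N_dom k). below (N_dom k) b a \<longrightarrow> (\<forall>c\<in>comp_tables k n a. below (N_dom k) b c)) \<and>
      w b \<le> n \<and> j b \<le> n" if b: "b \<in> B" for b
  proof -
    obtain n0 where "\<forall>n\<ge>n0. \<forall>a\<in>elems (N_dom k). below (N_dom k) b a \<longrightarrow> (\<forall>c\<in>comp_tables k n a. below (N_dom k) b c)"
      using comp_tables_above_compact[OF BD(2)[OF b]] by blast
    then show ?thesis by (intro exI[of _ "max n0 (max (w b) (j b))"]) auto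
  qed
  then obtain n0 where n0: "\<forall>b\<in>B. \<forall>n\<ge>n0. (\<forall>a\<in>elems (N_dom k). below (N_dom k) b a \<longrightarrow>
      (\<forall>c\<in>comp_tables k n a. below (N_dom k) b c)) \<and> w b \<le> n \<and> j b \<le> n"
    using ex_bound_finite[OF B, where P = "\<lambda>b n. (\<forall>a\<in>elems (N_dom k). below (N_dom k) b a \<longrightarrow>
      (\<forall>c\<in>comp_tables k n a. below (N_dom k) b c)) \<and> w b \<le> n \<and> j b \<le> n"] by blast
  define U where "U = {x' \<in> elems (N_dom (Suc (Suc k))). N_app (Suc k) x' y0 = Ground (Some m)}"
  \<comment> \<open>Finitely many conditions at the points \<open>p b\<close> serve all stages: by
    monotonicity they carry over to each grid point above \<open>b\<close>.\<close>
  define V where "V = {z' \<in> elems (S_dom (Suc k)). \<forall>b\<in>B. gval (S_app k z (p b)) |` {..<j b} \<subseteq>\<^sub>m gval (S_app k z' (p b))}"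
  have oU: "openin (scott_topology (N_dom (Suc (Suc k)))) U"
    unfolding U_def by (rule openin_value[OF N_eval_continuous[OF y0(1)]])
  have oV: "openin (scott_topology (S_dom (Suc k))) V"
    unfolding V_def by (rule openin_finite_Collect[OF B]) (rule openin_prefix[OF S_eval_continuous[OF p_elems[OF BD(1)]]])
  have main: "\<forall>x'\<in>U. \<forall>z'\<in>V. \<forall>n\<ge>n0. \<forall>r. \<forall>t\<in>tables (grid k n) n.
      (\<forall>c\<in>grid k n. r c \<in> vals (digits z' c |` {..<n0}) \<and> hat n (r c) (t c) > 0) \<longrightarrow>
      N_app (Suc k) x' (table k n t) = Ground (Some m)"
  proof (intro ballI allI impI)
    fix x' z' n r t
    assume x': "x' \<in> U" and z': "z' \<in> V" and n: "n \<ge> n0" and t: "t \<in> tables (grid k n) n"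
      and r: "\<forall>c\<in>grid k n. r c \<in> vals (digits z' c |` {..<n0}) \<and> hat n (r c) (t c) > 0"
    have z'D: "z' \<in> elems (S_dom (Suc k))" and x'D: "x' \<in> elems (N_dom (Suc (Suc k)))"
      using z' x' by (simp_all add: V_def U_def)
    have "below (N_dom (Suc k)) y0 (table k n t)"
    proof (rule N_below_SucI[OF y0(1)])
      fix a v assume a: "a \<in> elems (N_dom k)" "N_app k y0 a = Ground (Some v)"
      obtain b where "b \<in> B0" and ba: "below (N_dom k) b a" and bv: "N_app k y0 b = Ground (Some v)"
        using B0(3)[OF a] by blast
      then have "b \<in> B" by (simp add: B_def)
      then have b: "b \<in> B" "below (N_dom k) b a" "w b = v" using ba bv w by auto
      have nb: "(\<forall>a\<in>elems (N_dom k). below (N_dom k) b a \<longrightarrow> (\<forall>c\<in>comp_tables k n a. below (N_dom k) b c)) \<and> w b \<le> n"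
        using n0 b(1) n by blast
      have jb: "j b \<le> n0" using n0 b(1) by blast
      have "t c = v" if c: "c \<in> comp_tables k n a" for c
      proof -
        have cg: "c \<in> grid k n" using comp_tables_subset_grid[OF a(1)] c by blast
        have cD: "c \<in> elems (N_dom k)" using grid_elems[OF cg] .
        have "below (N_dom k) b c" using nb a(1) b(2) c by blast
        then have "below S_ground (S_app k z' (p b)) (S_app k z' (p c))"
          by (rule scott_continuous_mono[OF porder_N_dom porder_S_ground comp_p_continuous[OF z'D] BD(1)[OF b(1)] cD])
        then have "gval (S_app k z' (p b)) \<subseteq>\<^sub>m digits z' c"
          using S_ground_below_iff S_app_elems[OF z'D p_elems] BD(1)[OF b(1)] cD by (simp add: digits_def)
        then have "gval (S_app k z (p b)) |` {..<j b} \<subseteq>\<^sub>m digits z' c"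
          using z' b(1) map_le_trans unfolding V_def by blast
        then have "r c \<in> vals (gval (S_app k z (p b)) |` {..<j b})"
          using vals_prefix_mono[OF _ jb] r cg by blast
        then have "\<bar>r c - real v\<bar> \<le> 1/4" using j[OF b(1)] b(3) by auto
        then show ?thesis using hat_pos_unique[of "r c" v n "t c"] nb b(3) r cg by blast
      qed
      then show "N_app k (table k n t) a = Ground (Some v)" unfolding N_app_table[OF a(1)] by blast
    qed
    then show "N_app (Suc k) x' (table k n t) = Ground (Some m)"
      using N_app_mono[OF x'D y0(1)] N_eq_elems[OF table_total] x' by (simp add: U_def)
  qed
  have "x \<in> U" using xD y0(2) by (simp add: U_def)
  moreover have "z \<in> V" unfolding V_def using zD restrict_map_le by blast
  ultimately show "stable x z m"
    unfolding stable_def using oU oV main by (intro exI[of _ n0] exI[of _ U] exI[of _ V] conjI)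
qed

text \<open>By \<open>link\<close>, the coordinates of \<open>p' y\<close> are values of
  \<open>y\<close>. They are natural, and rounding \<open>p' y\<close> gives an element equivalent
  to \<open>y\<close>, which a total \<open>x\<close> cannot tell from \<open>y\<close>.\<close>

lemma ex_total_map_Suc:
  assumes p': "total_map (Suc k) p'"
    and link: "\<And>y a. y \<in> N_total (Suc k) \<Longrightarrow> a \<in> N_total k \<Longrightarrow>
      real (rho_N (N_app k y a)) = rho_S (S_app k (p' y) (p a))"
  shows "\<exists>p''. total_map (Suc (Suc k)) p'' \<and> (\<forall>x\<in>N_total (Suc (Suc k)). \<forall>y\<in>N_total (Suc k).
      real (rho_N (N_app (Suc k) x y)) = rho_S (S_app (Suc k) (p'' x) (p' y)))"
proof -
  interpret coordinates "Suc k" "grid k" "\<lambda>c z. S_app k z (p c)" "table k" by (rule coordinates_Suc)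
  have app: "\<exists>m. N_app (Suc k) x y = Ground (Some m)"
    if "x \<in> N_total (Suc (Suc k))" "N_eq (Suc k) y y" for x y
  proof -
    have "N_eq0 (N_app (Suc k) x y) (N_app (Suc k) x y)"
      using that N_eq_elems[OF that(2)] unfolding N_total_iff N_eq.simps(2)[of "Suc k"] by blast
    then show ?thesis by (auto simp: N_eq0_def)
  qed
  interpret stable_coordinates "Suc k" "grid k" "\<lambda>c z. S_app k z (p c)" "table k"
  proof
    fix x z assume x: "x \<in> N_total (Suc (Suc k))" and z: "z \<in> S_total (Suc k)"
      and "\<And>n c. c \<in> grid k n \<Longrightarrow> rho_S (S_app k z (p c)) \<in> \<nat>"
    then have nat: "\<forall>n. \<forall>c\<in>grid k n. rho_S (S_app k z (p c)) \<in> \<nat>" by blast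
    obtain m where "N_app (Suc k) x (round_fun k (\<lambda>a. S_app k z (p a))) = Ground (Some m)"
      using app[OF x stable_Suc(1)[OF x z nat]] by blast
    then show "\<exists>m. stable x z m" using stable_Suc(2)[OF x z nat] by blast
  qed
  have "real (rho_N (N_app (Suc k) x y)) = rho_S (S_app (Suc k) (extension x) (p' y))"
    if x: "x \<in> N_total (Suc (Suc k))" and y: "y \<in> N_total (Suc k)" for x y
  proof -
    have z: "p' y \<in> S_total (Suc k)" using p' y by (simp add: total_map_def N_total_iff S_total_iff)
    then have zD: "p' y \<in> elems (S_dom (Suc k))" by (simp add: S_total_def)
    have nat: "\<forall>n. \<forall>c\<in>grid k n. rho_S (S_app k (p' y) (p c)) \<in> \<nat>"
      using link[OF y] grid_total N_total_iff by (metis of_nat_in_Nats)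
    let ?y = "round_fun k (\<lambda>a. S_app k (p' y) (p a))"
    have "N_eq0 (N_app k ?y a) (N_app k y b)" if ab: "N_eq k a b" for a b
    proof -
      obtain v where v: "N_app k ?y a = Ground (Some v)" "rho_S (S_app k (p' y) (p a)) = real v"
        using round_total[OF z nat ab] by blast
      have "a \<in> N_total k" using N_eq_refl[OF ab] N_total_iff by blast
      then have "rho_N (N_app k y a) = v" using link[OF y] v(2) by (metis of_nat_eq_iff)
      moreover have "N_eq0 (N_app k y a) (N_app k y b)" using y ab N_eq_elems[OF ab] by (simp add: N_total_iff)
      ultimately show ?thesis using v(1) by (auto simp: N_eq0_def rho_N_def)
    qed
    then have yy: "N_eq (Suc k) ?y y"
      using round_fun_elems[OF comp_p_continuous[OF zD]] y by (simp add: N_total_def)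
    then have "N_eq0 (N_app (Suc k) x ?y) (N_app (Suc k) x y)"
      using x N_eq_elems[OF yy] unfolding N_total_iff N_eq.simps(2)[of "Suc k"] by blast
    then obtain m where m: "N_app (Suc k) x ?y = Ground (Some m)" "N_app (Suc k) x y = Ground (Some m)"
      by (auto simp: N_eq0_def)
    have "rho_S (S_app (Suc k) (extension x) (p' y)) = real m"
      by (rule ext_val_stable[OF x z stable_Suc(2)[OF x z nat m(1)]]) (use nat in blast)
    then show ?thesis using m(2) by (simp add: rho_N_def)
  qed
  moreover have "total_map (Suc (Suc k)) extension" unfolding total_map_def using extension_continuous extension_eq by blast
  ultimately show ?thesis by blast
qed

end

section \<open>The two lowest types\<close>

definition emb0 :: "nat option obj \<Rightarrow> (nat \<rightharpoonup> int) obj" where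
  "emb0 a = (case gval a of None \<Rightarrow> Ground Map.empty
     | Some v \<Rightarrow> Ground (\<lambda>i. Some (if i = 0 then int v else 0)))"

lemma seq_val_nat: "seq_val (\<lambda>i. Some (if i = 0 then int v else 0)) = real v"
  by (simp add: seq_val_def)

lemma total_map_emb0: "total_map 0 emb0"
  unfolding total_map_def
proof (intro conjI allI impI)
  have ds: "(\<lambda>i. Some (if i = 0 then int v else 0)) \<in> digit_seqs" "Map.empty \<in> digit_seqs" for v
    by (auto simp: digit_seqs_def)
  show "S_eq 0 (emb0 a) (emb0 b)" if "N_eq 0 a b" for a b
    using that ds by (auto simp: N_eq0_def emb0_def S_eq0_iff)
  show "continuous_map (scott_topology (N_dom 0)) (scott_topology (S_dom 0)) emb0"
    unfolding S_dom_0 continuous_map_S_ground_iff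
  proof (intro conjI allI)
    show "emb0 ` elems (N_dom 0) \<subseteq> elems S_ground"
      using ds by (auto simp: emb0_def S_ground_simps split: option.splits)
    fix i v
    let ?A = "{a \<in> elems (N_dom 0). gval (emb0 a) i = Some v}"
    have "?A = (\<Union>w\<in>{w. Ground (Some w) \<in> ?A}. {Ground (Some w)})"
      by (auto simp: N_ground_simps emb0_def split: option.splits)
    moreover have "openin (scott_topology (N_dom 0)) \<dots>"
      by (rule openin_Union) (use openin_N_ground in auto)
    ultimately show "openin (scott_topology (N_dom 0)) ?A" by simp
  qed
qed

text \<open>The same construction with a single coordinate, the sequence itself. Stability only
  takes a prefix within \<open>1/4\<close> of \<open>v\<close> and stages not below
  \<open>v\<close>, so that \<open>v\<close> is among the table values.\<close>

lemma ex_total_map_1: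
  "\<exists>p. total_map (Suc 0) p \<and> (\<forall>x\<in>N_total (Suc 0). \<forall>y\<in>N_total 0.
      real (rho_N (N_app 0 x y)) = rho_S (S_app 0 (p x) (emb0 y)))"
proof -
  interpret coordinates 0 "\<lambda>_. {()}" "\<lambda>_ z. z" "\<lambda>_ t. Ground (Some (t ()))"
    by standard (auto simp: S_dom_0 S_sim_0 N_eq0_def)
  have st: "stable x z m"
    if x: "x \<in> elems (N_dom (Suc 0))" and z: "z \<in> S_total 0" "rho_S z = real v"
      and m: "N_app 0 x (Ground (Some v)) = Ground (Some m)" for x z v m
  proof -
    obtain s where s: "z = Ground s" "s \<in> digit_seqs" "\<And>n. s n \<noteq> None"
      using z(1) by (auto simp: S_total_iff S_eq0_iff)
    have zD: "z \<in> elems (S_dom 0)" using z(1) by (simp add: S_total_def)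
    have "near s v" using near_of_total s z(2) by simp
    then obtain j where j: "vals (s |` {..<j}) \<subseteq> {r. \<bar>r - real v\<bar> \<le> 1/4}" unfolding near_def by blast
    define U where "U = {x' \<in> elems (N_dom (Suc 0)). N_app 0 x' (Ground (Some v)) = Ground (Some m)}"
    define V where "V = {z' \<in> elems (S_dom 0). s |` {..<j} \<subseteq>\<^sub>m gval z'}"
    have "openin (scott_topology (N_dom (Suc 0))) U"
      unfolding U_def by (rule openin_value[OF N_eval_continuous]) (simp add: N_ground_simps)
    moreover have "openin (scott_topology (S_dom 0)) V"
      unfolding V_def S_dom_0 by (rule openin_prefix) simp
    moreover have "\<forall>x'\<in>U. \<forall>z'\<in>V. \<forall>n\<ge>max j v. \<forall>r. \<forall>t\<in>tables {()} n.
      (\<forall>c\<in>{()}. r c \<in> vals (digits z' c |` {..<max j v}) \<and> hat n (r c) (t c) > 0) \<longrightarrow>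
      N_app 0 x' (Ground (Some (t ()))) = Ground (Some m)"
    proof (intro ballI allI impI)
      fix x' z' n r and t :: "unit \<Rightarrow> nat"
      assume x': "x' \<in> U" and z': "z' \<in> V" and n: "n \<ge> max j v"
        and r: "\<forall>c\<in>{()}. r c \<in> vals (digits z' c |` {..<max j v}) \<and> hat n (r c) (t c) > 0"
      have "r () \<in> vals (s |` {..<j})"
        using vals_prefix_mono[of s j "gval z'" "max j v"] z' r by (auto simp: V_def digits_def)
      then have "t () = v" using hat_pos_unique[of "r ()" v n "t ()"] j r n by auto
      then show "N_app 0 x' (Ground (Some (t ()))) = Ground (Some m)" using x' by (simp add: U_def)
    qed
    moreover have "x \<in> U" using x m by (simp add: U_def)
    moreover have "z \<in> V" using zD restrict_map_le by (simp add: V_def s(1))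
    ultimately show ?thesis unfolding stable_def by (intro exI[of _ "max j v"] exI[of _ U] exI[of _ V] conjI)
  qed
  have app: "\<exists>m. N_app 0 x (Ground (Some v)) = Ground (Some m)" if "x \<in> N_total (Suc 0)" for x v
    using that by (simp add: N_total_iff N_eq0_def N_ground_simps) blast
  interpret stable_coordinates 0 "\<lambda>_. {()}" "\<lambda>_ z. z" "\<lambda>_ t. Ground (Some (t ()))"
  proof
    fix x z assume x: "x \<in> N_total (Suc 0)" and z: "z \<in> S_total 0" and nat: "\<And>n c. c \<in> {()} \<Longrightarrow> rho_S z \<in> \<nat>"
    obtain v where "rho_S z = real v" using nat by (auto elim: Nats_cases)
    then show "\<exists>m. stable x z m" using st[OF _ z] app[OF x] x unfolding N_total_def by blast
  qed
  have "real (rho_N (N_app 0 x y)) = rho_S (S_app 0 (extension x) (emb0 y))"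
    if x: "x \<in> N_total (Suc 0)" and y: "y \<in> N_total 0" for x y
  proof -
    obtain v where v: "y = Ground (Some v)" using y by (auto simp: N_total_iff N_eq0_def)
    obtain m where m: "N_app 0 x y = Ground (Some m)" using app[OF x] v by blast
    have z: "emb0 y \<in> S_total 0" using total_map_emb0 y by (auto simp: total_map_def N_total_iff S_total_iff)
    have val: "rho_S (emb0 y) = real v" by (simp add: emb0_def v seq_val_nat)
    have "stable x (emb0 y) m" using st[OF _ z val] m v x by (simp add: N_total_def)
    then have "rho_S (S_app 0 (extension x) (emb0 y)) = real m" by (rule ext_val_stable[OF x z]) (simp add: val)
    then show ?thesis using m by (simp add: rho_N_def)
  qed
  moreover have "total_map (Suc 0) extension" unfolding total_map_def using extension_continuous extension_eq by blast
  ultimately show ?thesis by blast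
qed

theorem theorem5p2:
  shows "\<exists>\<pi> :: nat \<Rightarrow> nat option obj \<Rightarrow> (nat \<rightharpoonup> int) obj.
    (\<forall>k. continuous_map (scott_topology (N_dom k)) (scott_topology (S_dom k)) (\<pi> k) \<and>
         \<pi> k ` N_total k \<subseteq> S_total k) \<and>
    (\<forall>k. \<forall>x\<in>N_total (Suc k). \<forall>y\<in>N_total k.
         real (rho_N (N_app k x y)) = rho_S (S_app k (\<pi> (Suc k) x) (\<pi> k y)))"
proof -
  \<comment> \<open>Pairs of consecutive maps are chosen, because the next map is obtained from the
    last two and the link between them.\<close>
  define P where "P k pp \<longleftrightarrow> total_map k (fst pp) \<and> total_map (Suc k) (snd pp) \<and>
    (\<forall>x\<in>N_total (Suc k). \<forall>y\<in>N_total k.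
       real (rho_N (N_app k x y)) = rho_S (S_app k (snd pp x) (fst pp y)))" for k pp
  have "\<exists>f. \<forall>k. P k (f k) \<and> fst (f (Suc k)) = snd (f k)"
  proof (rule dependent_nat_choice)
    obtain p where "total_map (Suc 0) p" "\<forall>x\<in>N_total (Suc 0). \<forall>y\<in>N_total 0.
      real (rho_N (N_app 0 x y)) = rho_S (S_app 0 (p x) (emb0 y))"
      using ex_total_map_1 by blast
    then show "\<exists>pp. P 0 pp" using total_map_emb0 unfolding P_def by (intro exI[of _ "(emb0, p)"]) simp
    fix pp k assume pp: "P k pp"
    then obtain p'' where "total_map (Suc (Suc k)) p''" "\<forall>x\<in>N_total (Suc (Suc k)). \<forall>y\<in>N_total (Suc k).
      real (rho_N (N_app (Suc k) x y)) = rho_S (S_app (Suc k) (p'' x) (snd pp y))"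
      using ex_total_map_Suc[of k "fst pp" "snd pp"] unfolding P_def by blast
    then show "\<exists>qq. P (Suc k) qq \<and> fst qq = snd pp"
      using pp unfolding P_def by (intro exI[of _ "(snd pp, p'')"]) simp
  qed
  then obtain f where f: "\<And>k. P k (f k)" "\<And>k. fst (f (Suc k)) = snd (f k)" by blast
  show ?thesis
  proof (intro exI[of _ "\<lambda>k. fst (f k)"] conjI allI ballI)
    fix k
    have t: "total_map k (fst (f k))" using f(1) by (simp add: P_def)
    then show "continuous_map (scott_topology (N_dom k)) (scott_topology (S_dom k)) (fst (f k))"
      by (simp add: total_map_def)
    show "fst (f k) ` N_total k \<subseteq> S_total k" using t by (auto simp: total_map_def N_total_iff S_total_iff)
    fix x y assume "x \<in> N_total (Suc k)" "y \<in> N_total k"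
    then show "real (rho_N (N_app k x y)) = rho_S (S_app k (fst (f (Suc k)) x) (fst (f k) y))"
      using f(1)[of k] unfolding P_def f(2) by blast
  qed
qed

end
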